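(* Let $\mathcal{C}=\mathrm{Forb}(C_5)$ be the class of all connected graphs that do not contain the cycle $C_5$ with five vertices as a topological minor. Then the constant $y=C^\bullet(\rho)$ is the unique positive solution to $zB''(z)=1$, where $B'(z)=z(z+2)e^z-z(15z+2z^2+6)/6$. Moreover, we have $$\kappa=(2y^2+4y+3)\,y\,e^y-(3y^2+12y+4)\,y/2\approx1.10355$$ and $\sigma^2=1+B'''(y)y^2\approx2.14989$.
   Context: Graphs are finite, simple, undirected and vertex-labelled. $\mathcal{B}\subset\mathcal{C}$ is the subclass of graphs in $\mathcal{C}$ that are 2-connected (connected, at least three vertices, no cutvertex) or consist of a single edge with its two ends. $C(z)=\sum_n|\mathcal{C}_n|z^n/n!$ and $B(z)=\sum_n|\mathcal{B}_n|z^n/n!$ are the exponential generating functions (a subscript $n$ denotes the objects with vertex set $\{1,\dots,n\}$); $\rho$ is the radius of convergence of $C(z)$ and $C^\bullet(z)=zC'(z)$. A $\mathcal{B}'^\bullet$-object on a finite set $U$ is a graph in $\mathcal{B}$ with vertex set $U\cup\{*\}$, $*\notin U$, together with a distinguished root vertex in $U$; its size $|\cdot|$ is $|U|$; the exponential generating function is $B'^\bullet(z)=zB''(z)$. The scaling factor is $\kappa=\mathbb{E}[\mathsf{sp}(\mathsf{B})]$, where $\mathsf{sp}(\mathsf{B})$ is the graph distance in $\mathsf{B}$ from $*$ to the root and $\mathsf{B}\in\mathcal{B}'^\bullet$ follows the Boltzmann distribution with parameter $y$: each object on label set $\{1,\dots,m\}$ has probability $y^m/(m!\,B'^\bullet(y))$.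 Also $\sigma^2=\mathbb{E}[|\mathsf{B}|]$. The symbol $\approx$ indicates a numerical approximation. *)

theory Defs
  imports
    "HOL-Analysis.Analysis"
    "HOL-Probability.Probability_Measure"
    "Graph_Theory.Graph_Theory"
begin

text \<open>
  A finite simple undirected graph is a \<^term>\<open>G :: 'a pair_pre_digraph\<close> with \<^term>\<open>pair_graph G\<close>:
  a finite, loop-free, symmetric arc relation, where the two arcs \<open>(u, v)\<close> and \<open>(v, u)\<close> together
  are one undirected edge.  Two labelled graphs are the same iff they are equal as records.
\<close>

definition cycle_graph :: "nat \<Rightarrow> nat pair_pre_digraph" where
  "cycle_graph n = \<lparr> pverts = {0..<n},
     parcs = {(i, j). i < n \<and> j < n \<and> (j = (i + 1) mod n \<or> i = (j + 1) mod n)} \<rparr>"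

text \<open>
  Subdividing keeps the branch vertices and adds new ones of the same type, so the subdivided
  graph \<open>K'\<close> is an isomorphic copy of \<open>K\<close> whose vertices lie among those of \<open>G\<close>.
\<close>

definition topological_minor :: "'b pair_pre_digraph \<Rightarrow> 'a pair_pre_digraph \<Rightarrow> bool" where
  "topological_minor K G \<longleftrightarrow>
     (\<exists>K' H. digraph_iso (with_proj K) (with_proj K') \<and> subdivision_pair K' H
        \<and> subgraph (with_proj H) (with_proj G))"

text \<open>\<open>Digraph_Component.connected\<close> excludes the graph without vertices.\<close>

definition Forb :: "'b pair_pre_digraph \<Rightarrow> 'a pair_pre_digraph set" where
  "Forb K = {G. pair_graph G \<and> Digraph_Component.connected (with_proj G)
                \<and> \<not> topological_minor K G}"

definition cutvertex :: "'a pair_pre_digraph \<Rightarrow> 'a \<Rightarrow> bool" where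
  "cutvertex G v \<longleftrightarrow> v \<in> pverts G \<and>
     (\<exists>u \<in> pverts G - {v}. \<exists>w \<in> pverts G - {v}.
        reachable (with_proj G) u w
        \<and> \<not> reachable (pre_digraph.del_vert (with_proj G) v) u w)"

definition two_connected :: "'a pair_pre_digraph \<Rightarrow> bool" where
  "two_connected G \<longleftrightarrow> Digraph_Component.connected (with_proj G) \<and> 3 \<le> card (pverts G)
     \<and> (\<forall>v. \<not> cutvertex G v)"

definition single_edge :: "'a pair_pre_digraph \<Rightarrow> bool" where
  "single_edge G \<longleftrightarrow>
     (\<exists>u v. u \<noteq> v \<and> pverts G = {u, v} \<and> parcs G = {(u, v), (v, u)})"

definition blocks :: "'a pair_pre_digraph set \<Rightarrow> 'a pair_pre_digraph set" where
  "blocks \<C> = {G \<in> \<C>. two_connected G \<or> single_edge G}"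

definition egf :: "nat pair_pre_digraph set \<Rightarrow> real fps" where
  "egf \<A> = Abs_fps (\<lambda>n. real (card {G \<in> \<A>. pverts G = {1..n}}) / fact n)"

definition pointed :: "real fps \<Rightarrow> real fps" where
  "pointed F = fps_X * fps_deriv F"

text \<open>
  The distinguished vertex \<open>*\<close> of a derived object is the vertex \<open>0\<close>, which lies in none of the
  label sets \<open>{1..m}\<close>.
\<close>

definition derived_pointed_objects ::
    "nat pair_pre_digraph set \<Rightarrow> nat set \<Rightarrow> (nat pair_pre_digraph \<times> nat) set" where
  "derived_pointed_objects \<B> U = {(G, r). G \<in> \<B> \<and> pverts G = insert 0 U \<and> r \<in> U}"

definition obj_size :: "nat pair_pre_digraph \<times> nat \<Rightarrow> nat" where
  "obj_size X = card (pverts (fst X) - {0})"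

definition sp :: "nat pair_pre_digraph \<times> nat \<Rightarrow> real" where
  "sp X = real_of_ereal (wf_digraph.\<mu> (with_proj (fst X)) (\<lambda>_. 1) 0 (snd X))"

text \<open>
  The Boltzmann distribution; it is a probability measure exactly when the normalising constant
  is the total weight, so this has to be proved for the parameter in question.
\<close>

definition boltzmann ::
    "nat pair_pre_digraph set \<Rightarrow> real \<Rightarrow> (nat pair_pre_digraph \<times> nat) measure" where
  "boltzmann \<B> y =
     point_measure (\<Union>m. derived_pointed_objects \<B> {1..m})
       (\<lambda>X. ennreal (y ^ obj_size X /
              (fact (obj_size X) * eval_fps (pointed (fps_deriv (egf \<B>))) y)))"

end

theory Submission
  imports Defs
begin

text \<open>
  A graph contains \<open>C\<^sub>5\<close> as a topological minor iff it has a cycle with at least five vertices.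
  Such a cycle lies in a single block, so the class is determined by its blocks.  An ear argument
  shows that a block on \<open>n \<ge> 5\<close> vertices is the complete bipartite graph with sides of sizes 2 and
  \<open>n - 2\<close>, possibly with an edge between the two vertices of the small side.  This gives \<open>B'\<close>, and
  since every distance in a block is at most 2, it also gives \<open>\<kappa>\<close>.

  Root a connected graph at a vertex and let its core be the union of the blocks at the root.
  Every other vertex hangs below a unique core vertex, so \<open>C'(z) = A(z C'(z))\<close>, where \<open>A\<close> counts cores.
  Splitting off the block that contains a fixed vertex gives \<open>A' = B'' A\<close>, hence \<open>A = exp B'\<close>.
  So \<open>R = z C'\<close> is inverse to \<open>w \<mapsto> w exp (- B'(w))\<close>, which is maximal where \<open>w B''(w) = 1\<close>;
  the maximum is \<open>\<rho>\<close>, and it is attained at \<open>y = R(\<rho>)\<close>.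
\<close>

subsection \<open>Edge sets, connectivity and cycles\<close>

text \<open>Graphs are handled as edge relations on an explicit vertex set, so that gluing,
  restricting and relabelling are operations on sets and counts are cardinalities of sets of
  relations; \<open>Forb_iff\<close> and \<open>blocks_iff\<close> lead back to the graphs of the
  statement. Removing one block at a time spares a theory of block trees: it yields a linear
  differential equation, whose solution is the exponential. A graph on at most four vertices has no
  cycle of length five, so there every 2-connected graph is a block of the class. The counts 1, 1,
  10 for two, three and four vertices replace the values 2, 6, 12 of \<open>n * (n - 1)\<close>, and
  these differences make up the polynomial subtracted in B''. The delicate point is the value of R
  at rho, on the boundary of its disc of convergence. An induction bounds the truncations of R there
  by the solution of w B''(w) = 1; the functional equation survives the limit of truncations, and
  strictness of the maximum leaves only one possible value. The same maximum forbids convergence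
  further out.\<close>

definition edge_closed :: "('a \<times> 'a) set \<Rightarrow> 'a set \<Rightarrow> 'a set \<Rightarrow> bool" where
  "edge_closed E S T \<longleftrightarrow> T \<subseteq> S \<and> (\<forall>u\<in>T. \<forall>v\<in>S. (u, v) \<in> E \<longrightarrow> v \<in> T)"

text \<open>Connectivity is expressed through closed sets instead of paths: gluing and restricting
  then only require intersections of closed sets. Simple paths are extracted in
  \<open>conn_path\<close>, for the ear argument.\<close>

definition conn :: "('a \<times> 'a) set \<Rightarrow> 'a set \<Rightarrow> bool" where
  "conn E S \<longleftrightarrow> S \<noteq> {} \<and> (\<forall>T. edge_closed E S T \<longrightarrow> T = {} \<or> T = S)"

definition edge_graphs :: "'a set \<Rightarrow> ('a \<times> 'a) set set" where
  "edge_graphs S = {E. E \<subseteq> S \<times> S \<and> sym E \<and> irrefl E}"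

abbreviation walk :: "('a \<times> 'a) set \<Rightarrow> 'a list \<Rightarrow> bool" where
  "walk E \<equiv> successively (\<lambda>u v. (u, v) \<in> E)"

text \<open>A single edge run back and forth counts as a cycle of length 2; such degenerate cycles
  are harmless, as only lengths from 5 on matter.\<close>

definition cyc :: "('a \<times> 'a) set \<Rightarrow> 'a list \<Rightarrow> bool" where
  "cyc E xs \<longleftrightarrow> xs \<noteq> [] \<and> distinct xs \<and> walk E xs \<and> (last xs, hd xs) \<in> E"

definition longcyc :: "('a \<times> 'a) set \<Rightarrow> bool" where
  "longcyc E \<longleftrightarrow> (\<exists>xs. cyc E xs \<and> 5 \<le> length xs)"

definition conn_graphs :: "'a set \<Rightarrow> ('a \<times> 'a) set set" where
  "conn_graphs S = {E \<in> edge_graphs S. conn E S \<and> \<not> longcyc E}"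

text \<open>The root may be a cutvertex, no other vertex may: these are the graphs all of whose
  blocks contain \<open>r\<close>, counted by A. The one-vertex graph is among them and gives A its
  constant term 1.\<close>

definition core_graphs :: "'a \<Rightarrow> 'a set \<Rightarrow> ('a \<times> 'a) set set" where
  "core_graphs r S = {E \<in> conn_graphs S. \<forall>x\<in>S - {r}. conn E (S - {x})}"

text \<open>One condition covers the 2-connected graphs and the single edge: with two vertices,
  deleting either leaves a singleton, which is connected. See \<open>block_iff\<close>.\<close>

definition block_graphs :: "'a set \<Rightarrow> ('a \<times> 'a) set set" where
  "block_graphs S = {E \<in> conn_graphs S. 2 \<le> card S \<and> (\<forall>x\<in>S. conn E (S - {x}))}"

lemma edge_closedI:
  assumes "T \<subseteq> S" "\<And>u v. u \<in> T \<Longrightarrow> v \<in> S \<Longrightarrow> (u, v) \<in> E \<Longrightarrow> v \<in> T"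
  shows "edge_closed E S T"
  using assms by (auto simp: edge_closed_def)

lemma connI:
  assumes "S \<noteq> {}" "\<And>T x. edge_closed E S T \<Longrightarrow> x \<in> T \<Longrightarrow> S \<subseteq> T"
  shows "conn E S"
  unfolding conn_def using assms by (metis all_not_in_conv edge_closed_def subset_antisym)

lemma connD: "conn E S \<Longrightarrow> edge_closed E S T \<Longrightarrow> x \<in> T \<Longrightarrow> S \<subseteq> T"
  by (auto simp: conn_def)

lemma conn_nonempty: "conn E S \<Longrightarrow> S \<noteq> {}"
  by (simp add: conn_def)

lemma conn_singleton [simp]: "conn E {x}"
  by (rule connI) (auto simp: edge_closed_def)

lemma conn_cong:
  assumes "\<And>u v. u \<in> S \<Longrightarrow> v \<in> S \<Longrightarrow> (u, v) \<in> E \<longleftrightarrow> (u, v) \<in> E'"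
  shows "conn E S \<longleftrightarrow> conn E' S"
proof -
  have "edge_closed E S T \<longleftrightarrow> edge_closed E' S T" for T
    using assms unfolding edge_closed_def by blast
  then show ?thesis by (simp add: conn_def)
qed

lemma conn_mono:
  assumes "conn E S" "E \<subseteq> E'"
  shows "conn E' S"
proof (rule connI)
  show "S \<noteq> {}" using assms by (simp add: conn_def)
  fix T x assume "edge_closed E' S T" "x \<in> T"
  then show "S \<subseteq> T"
    using connD[OF assms(1), of T x] assms(2) by (auto simp: edge_closed_def)
qed

lemma conn_Un:
  assumes "conn E S1" "conn E S2" "x \<in> S1" "x \<in> S2"
  shows "conn E (S1 \<union> S2)"
proof (rule connI)
  show "S1 \<union> S2 \<noteq> {}" using assms by auto
  fix T y assume T: "edge_closed E (S1 \<union> S2) T" "y \<in> T"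
  have c: "edge_closed E S1 (T \<inter> S1)" "edge_closed E S2 (T \<inter> S2)"
    using T by (auto simp: edge_closed_def)
  have "y \<in> S1 \<or> y \<in> S2" using T by (auto simp: edge_closed_def)
  then have "x \<in> T"
    using connD[OF assms(1) c(1), of y] connD[OF assms(2) c(2), of y] T assms by blast
  then show "S1 \<union> S2 \<subseteq> T"
    using connD[OF assms(1) c(1), of x] connD[OF assms(2) c(2), of x] assms by blast
qed

lemma conn_image:
  assumes "conn E T"
  shows "conn (map_prod f f ` E) (f ` T)"
proof (rule connI)
  show "f ` T \<noteq> {}" using assms by (simp add: conn_def)
  fix T' x assume T': "edge_closed (map_prod f f ` E) (f ` T) T'" "x \<in> T'"
  have "edge_closed E T (T \<inter> f -` T')"
    using T' by (fastforce simp: edge_closed_def)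
  moreover obtain a where "a \<in> T \<inter> f -` T'" using T' by (auto simp: edge_closed_def)
  ultimately have "T \<subseteq> T \<inter> f -` T'" using connD[OF assms] by blast
  then show "f ` T \<subseteq> T'" by auto
qed

lemma cyc_mono:
  assumes "cyc E xs" "\<And>u v. u \<in> set xs \<Longrightarrow> v \<in> set xs \<Longrightarrow> (u, v) \<in> E \<Longrightarrow> (u, v) \<in> E'"
  shows "cyc E' xs"
proof -
  have "walk E' xs"
    using assms by (auto simp: cyc_def intro: successively_mono)
  then show ?thesis using assms by (auto simp: cyc_def)
qed

lemma longcyc_mono: "longcyc E \<Longrightarrow> E \<subseteq> E' \<Longrightarrow> longcyc E'"
  unfolding longcyc_def by (meson cyc_mono subsetD)

lemma cyc_rotate:
  assumes "cyc E (as @ w # bs)"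
  shows "cyc E (w # bs @ as)"
  using assms unfolding cyc_def
  by (cases as; cases bs rule: rev_cases) (auto simp: successively_append_iff successively_Cons hd_append)

text \<open>The only way into or out of \<open>D\<close> is through \<open>w\<close>. Symmetry
  serves the part of the walk before it meets \<open>D\<close>.\<close>

lemma successively_in_closed:
  assumes "walk E ys" "sym E" "set ys \<inter> D \<noteq> {}" "w \<notin> set ys"
    "\<And>u v. u \<in> D \<Longrightarrow> (u, v) \<in> E \<Longrightarrow> v \<in> D \<or> v = w"
  shows "set ys \<subseteq> D"
  using assms(1,3,4)
proof (induction ys)
  case (Cons y ys)
  show ?case
  proof (cases ys)
    case Nil
    then show ?thesis using Cons by auto
  next
    case (Cons z zs)
    then have e: "(y, z) \<in> E" "(z, y) \<in> E" using Cons.prems assms(2) by (auto dest: symD)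
    have s: "walk E ys" using Cons.prems Cons by simp
    have "set ys \<inter> D \<noteq> {}"
    proof (cases "y \<in> D")
      case True
      then show ?thesis using assms(5)[OF _ e(1)] Cons.prems Cons by auto
    next
      case False
      then show ?thesis using Cons.prems by auto
    qed
    then have "set ys \<subseteq> D" using Cons.IH s Cons.prems by auto
    moreover have "y \<in> D" using assms(5)[OF _ e(2)] calculation Cons Cons.prems by auto
    ultimately show ?thesis by auto
  qed
qed auto

text \<open>A cycle passes the gate \<open>w\<close> at most once. Opened at \<open>w\<close>, it
  becomes a walk that avoids \<open>w\<close> and therefore cannot leave \<open>D\<close>. This is
  what confines a cycle to one part of a glued graph.\<close>

lemma cyc_in_closed:
  assumes "cyc E xs" "sym E" "set xs \<inter> D \<noteq> {}" "w \<notin> D"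
    "\<And>u v. u \<in> D \<Longrightarrow> (u, v) \<in> E \<Longrightarrow> v \<in> D \<or> v = w"
  shows "set xs \<subseteq> insert w D"
proof (cases "w \<in> set xs")
  case False
  then show ?thesis using successively_in_closed[of E xs D w] assms by (auto simp: cyc_def)
next
  case True
  then obtain as bs where xs: "xs = as @ w # bs" by (meson split_list)
  then have "cyc E (w # bs @ as)" using cyc_rotate assms(1) by metis
  then have "walk E (bs @ as)" "w \<notin> set (bs @ as)"
    by (auto simp: cyc_def successively_Cons)
  then have "set (bs @ as) \<subseteq> D"
    using successively_in_closed[of E "bs @ as" D w] assms xs by auto
  then show ?thesis using xs by auto
qed

lemma cyc_Field: "cyc E xs \<Longrightarrow> E \<subseteq> S \<times> S \<Longrightarrow> set xs \<subseteq> S"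
proof (induction xs rule: rev_induct)
  case (snoc x xs)
  then show ?case
  proof (cases xs)
    case (Cons y ys)
    \<comment> \<open>Every entry of a walk except the last is the source of an edge; the last entry
      is the source of the closing edge.\<close>
    have "u \<in> S" if "u \<in> set (butlast zs)" "walk E zs" for u zs
      using that
    proof (induction zs)
      case (Cons z zs)
      then show ?case using snoc.prems(2) by (cases zs) auto
    qed auto
    then have "\<forall>u\<in>set xs. u \<in> S" using snoc.prems unfolding cyc_def by (metis butlast_snoc)
    moreover have "x \<in> S" using snoc.prems unfolding cyc_def by auto
    ultimately show ?thesis by auto
  qed (auto simp: cyc_def)
qed auto

text \<open>A cycle using both graphs would have to pass their only common vertex \<open>w\<close>
  twice.\<close>

lemma longcyc_Un:
  assumes "E1 \<in> edge_graphs S1" "E2 \<in> edge_graphs S2" "S1 \<inter> S2 \<subseteq> {w}" "longcyc (E1 \<union> E2)"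
  shows "longcyc E1 \<or> longcyc E2"
proof -
  obtain xs where xs: "cyc (E1 \<union> E2) xs" "5 \<le> length xs" using assms by (auto simp: longcyc_def)
  have g: "E1 \<subseteq> S1 \<times> S1" "E2 \<subseteq> S2 \<times> S2" "sym (E1 \<union> E2)" "irrefl E1" "irrefl E2"
    using assms by (auto simp: edge_graphs_def intro: sym_Un)
  have sub: "set xs \<subseteq> S1 \<union> S2" using cyc_Field[OF xs(1), of "S1 \<union> S2"] g by blast
  show ?thesis
  proof (cases "set xs \<inter> (S1 - {w}) = {}")
    case False
    have "set xs \<subseteq> insert w (S1 - {w})"
      by (rule cyc_in_closed[OF xs(1) g(3) False]) (use g assms in blast)+
    \<comment> \<open>An edge of \<open>E2\<close> between vertices of the cycle would be a loop at
      \<open>w\<close>.\<close>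
    then have "cyc E1 xs"
      by (intro cyc_mono[OF xs(1)]) (use g assms in \<open>auto simp: irrefl_def, blast\<close>)
    then show ?thesis using xs by (auto simp: longcyc_def)
  next
    case True
    then have s: "set xs \<subseteq> insert w S2" using sub by blast
    have "cyc E2 xs"
      by (intro cyc_mono[OF xs(1)]) (use g assms s True in \<open>auto simp: irrefl_def, blast\<close>)
    then show ?thesis using xs by (auto simp: longcyc_def)
  qed
qed

lemma edge_graphs_Un: "E1 \<in> edge_graphs S1 \<Longrightarrow> E2 \<in> edge_graphs S2 \<Longrightarrow> E1 \<union> E2 \<in> edge_graphs (S1 \<union> S2)"
  by (auto simp: edge_graphs_def sym_def irrefl_def)

section \<open>Induced subgraphs\<close>

definition induced :: "('a \<times> 'a) set \<Rightarrow> 'a set \<Rightarrow> ('a \<times> 'a) set" where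
  "induced E S = {(u, v) \<in> E. u \<in> S \<and> v \<in> S}"

lemma induced_edge_graphs: "E \<in> edge_graphs S \<Longrightarrow> induced E T \<in> edge_graphs T"
  by (auto simp: induced_def edge_graphs_def sym_def irrefl_def)

lemma conn_induced: "S \<subseteq> T \<Longrightarrow> conn (induced E T) S \<longleftrightarrow> conn E S"
  by (rule conn_cong) (auto simp: induced_def)

lemma longcyc_induced: "longcyc (induced E T) \<Longrightarrow> longcyc E"
  by (erule longcyc_mono) (auto simp: induced_def)

lemma induced_conn_graphs:
  assumes "E \<in> edge_graphs S" "\<not> longcyc E" "conn E K"
  shows "induced E K \<in> conn_graphs K"
  using induced_edge_graphs[OF assms(1), of K] longcyc_induced[of E K] assms
  by (auto simp: conn_graphs_def conn_induced)

lemma induced_core_graphs: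
  assumes "E \<in> edge_graphs S" "\<not> longcyc E" "conn E K" "\<And>x. x \<in> K - {r} \<Longrightarrow> conn E (K - {x})"
  shows "induced E K \<in> core_graphs r K"
  using induced_conn_graphs[OF assms(1-3)] assms(4) conn_induced[OF Diff_subset, of E K]
  by (auto simp: core_graphs_def)

lemma finite_edge_graphs: "finite S \<Longrightarrow> finite (edge_graphs S)"
  by (rule finite_subset[of _ "Pow (S \<times> S)"]) (auto simp: edge_graphs_def)

lemma finite_conn_graphs: "finite S \<Longrightarrow> finite (conn_graphs S)"
  by (rule finite_subset[OF _ finite_edge_graphs]) (auto simp: conn_graphs_def)

lemma finite_core_graphs: "finite S \<Longrightarrow> finite (core_graphs r S)"
  by (rule finite_subset[OF _ finite_edge_graphs]) (auto simp: conn_graphs_def core_graphs_def)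

lemma finite_block_graphs: "finite S \<Longrightarrow> finite (block_graphs S)"
  by (rule finite_subset[OF _ finite_edge_graphs]) (auto simp: conn_graphs_def block_graphs_def)

section \<open>Relabelling along injections\<close>

lemma edge_graphs_image:
  assumes "E \<in> edge_graphs S" "inj_on f S"
  shows "map_prod f f ` E \<in> edge_graphs (f ` S)"
  unfolding edge_graphs_def
proof (intro CollectI conjI)
  show "map_prod f f ` E \<subseteq> f ` S \<times> f ` S" using assms by (auto simp: edge_graphs_def)
  show "sym (map_prod f f ` E)"
    using assms by (fastforce simp: edge_graphs_def intro!: symI dest: symD)
  show "irrefl (map_prod f f ` E)"
    using assms by (fastforce simp: edge_graphs_def irrefl_def inj_on_def)
qed

lemma longcyc_image:
  assumes "E \<subseteq> S \<times> S" "inj_on f S" "longcyc (map_prod f f ` E)"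
  shows "longcyc E"
proof -
  obtain xs where xs: "cyc (map_prod f f ` E) xs" "5 \<le> length xs" using assms by (auto simp: longcyc_def)
  define g where "g = the_inv_into S f"
  have sub: "set xs \<subseteq> f ` S" using cyc_Field[OF xs(1), of "f ` S"] assms(1) by auto
  have E: "(g u, g v) \<in> E" if "(u, v) \<in> map_prod f f ` E" for u v
    using that assms by (auto simp: g_def the_inv_into_f_f)
  have "inj_on g (f ` S)" unfolding g_def by (rule inj_on_the_inv_into) fact
  then have "distinct (map g xs)"
    using xs sub by (auto simp: distinct_map cyc_def intro: inj_on_subset)
  moreover have "walk E (map g xs)"
    unfolding successively_map by (rule successively_mono[of "\<lambda>u v. (u, v) \<in> map_prod f f ` E"])
      (use xs E in \<open>auto simp: cyc_def\<close>)
  moreover have "(last (map g xs), hd (map g xs)) \<in> E"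
    using E xs by (auto simp: cyc_def last_map hd_map)
  ultimately have "cyc E (map g xs)" using xs by (auto simp: cyc_def)
  then show ?thesis using xs by (auto simp: longcyc_def)
qed

lemma inj_on_image_edges:
  assumes "inj_on f S"
  shows "inj_on (\<lambda>E. map_prod f f ` E) (edge_graphs S)"
proof -
  have "inj_on (map_prod f f) (S \<times> S)" using assms by (auto simp: inj_on_def)
  then show ?thesis
    using inj_on_image_eq_iff[of "map_prod f f" "S \<times> S"]
    by (intro inj_onI) (auto simp: edge_graphs_def)
qed

lemma conn_graphs_image:
  assumes "E \<in> conn_graphs S" "inj_on f S"
  shows "map_prod f f ` E \<in> conn_graphs (f ` S)"
  using assms longcyc_image[of E S f] edge_graphs_image[of E S f] conn_image[of E S f]
  by (auto simp: conn_graphs_def edge_graphs_def)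

lemma conn_Diff_image:
  assumes "inj_on f S" "x \<in> S" "conn E (S - {x})"
  shows "conn (map_prod f f ` E) (f ` S - {f x})"
proof -
  have "f ` S - {f x} = f ` (S - {x})" using assms by (auto simp: inj_on_def)
  then show ?thesis using conn_image[OF assms(3)] by metis
qed

text \<open>Stated as an inequality so that only relabelling forwards has to be checked; equality of
  counts follows by exchanging \<open>S\<close> and \<open>S'\<close>.\<close>

lemma card_le_by_image:
  assumes "finite S" "card S = card S'" "finite S'"
    "\<And>f. inj_on f S \<Longrightarrow> f ` S = S' \<Longrightarrow> (\<lambda>E. map_prod f f ` E) ` P \<subseteq> Q"
    "P \<subseteq> edge_graphs S" "finite Q"
  shows "card P \<le> card Q"
proof -
  obtain f where f: "bij_betw f S S'" using finite_same_card_bij[OF assms(1,3,2)] by blast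
  then have "inj_on (\<lambda>E. map_prod f f ` E) P"
    using inj_on_image_edges[of f S] assms(5) by (auto simp: bij_betw_def intro: inj_on_subset)
  moreover have "(\<lambda>E. map_prod f f ` E) ` P \<subseteq> Q"
    using assms(4)[of f] f by (simp add: bij_betw_def)
  ultimately show ?thesis
    using card_inj_on_le assms(6) by blast
qed

lemma card_conn_graphs_le:
  assumes "finite S" "finite S'" "card S = card S'"
  shows "card (conn_graphs S) \<le> card (conn_graphs S')"
  by (rule card_le_by_image[of S S'])
     (use assms conn_graphs_image finite_conn_graphs in \<open>auto simp: conn_graphs_def\<close>)

lemma card_conn_graphs_eq:
  assumes "finite S" "finite S'" "card S = card S'"
  shows "card (conn_graphs S) = card (conn_graphs S')"
  using card_conn_graphs_le assms by (metis order_antisym)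

lemma card_block_graphs_le:
  assumes "finite S" "finite S'" "card S = card S'"
  shows "card (block_graphs S) \<le> card (block_graphs S')"
proof (rule card_le_by_image[of S S'])
  fix f :: "'a \<Rightarrow> 'b" assume f: "inj_on f S" "f ` S = S'"
  show "(\<lambda>E. map_prod f f ` E) ` block_graphs S \<subseteq> block_graphs S'"
    using conn_graphs_image[of _ S f] conn_Diff_image[of f S] f assms
    by (auto simp: block_graphs_def)
qed (use assms finite_block_graphs in \<open>auto simp: conn_graphs_def block_graphs_def\<close>)

lemma card_block_graphs_eq:
  assumes "finite S" "finite S'" "card S = card S'"
  shows "card (block_graphs S) = card (block_graphs S')"
  using card_block_graphs_le assms by (metis order_antisym)

subsection \<open>Splitting off one block at the root\<close>

text \<open>An edge of \<open>E2\<close> inside \<open>S1\<close> would have both ends in the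
  overlap and so be a loop at \<open>w\<close>.\<close>

lemma induced_Un_overlap:
  assumes "E1 \<subseteq> S1 \<times> S1" "E2 \<subseteq> S2 \<times> S2" "irrefl E2" "S1 \<inter> S2 \<subseteq> {w}"
  shows "induced (E1 \<union> E2) S1 = E1"
proof -
  have False if "(u, v) \<in> E2" "u \<in> S1" "v \<in> S1" for u v
  proof -
    have "u = w" "v = w" using that assms by blast+
    then show False using that assms(3) by (auto simp: irrefl_def)
  qed
  then show ?thesis using assms(1) by (auto simp: induced_def)
qed

lemma edge_closed_Int: "edge_closed E U T \<Longrightarrow> X \<subseteq> U \<Longrightarrow> edge_closed E X (X \<inter> T)"
  by (auto simp: edge_closed_def)

lemma edge_closed_trans: "edge_closed E U X \<Longrightarrow> edge_closed E X T \<Longrightarrow> edge_closed E U T"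
  by (auto simp: edge_closed_def)

lemma edge_closed_Diff:
  assumes "edge_closed E U X" "edge_closed E X T" "sym E"
  shows "edge_closed E U (X - T)"
proof (rule edge_closedI)
  show "X - T \<subseteq> U" using assms by (auto simp: edge_closed_def)
  fix a b assume ab: "a \<in> X - T" "b \<in> U" "(a, b) \<in> E"
  then have "b \<in> X" using assms by (auto simp: edge_closed_def)
  moreover have "(b, a) \<in> E" using ab assms by (auto dest: symD)
  ultimately show "b \<in> X - T" using ab assms by (auto simp: edge_closed_def)
qed

text \<open>The gluing direction of A' = B'' A. Being closed and connected, \<open>X\<close> is a
  component of the glued graph without \<open>r\<close>; together with the two induced subgraphs
  this lets both ingredients be recovered, which makes gluing injective.\<close>

lemma block_Un_core:
  assumes E1: "E1 \<in> block_graphs (insert r X)" and E2: "E2 \<in> core_graphs r (insert r Y)"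
    and disj: "X \<inter> Y = {}" "r \<notin> X" "r \<notin> Y"
  shows "E1 \<union> E2 \<in> core_graphs r (insert r (X \<union> Y))"
    and "edge_closed (E1 \<union> E2) (X \<union> Y) X" and "conn (E1 \<union> E2) X"
    and "induced (E1 \<union> E2) (insert r X) = E1" and "induced (E1 \<union> E2) (insert r Y) = E2"
proof -
  let ?E = "E1 \<union> E2" let ?S1 = "insert r X" let ?S2 = "insert r Y"
  have g: "E1 \<in> edge_graphs ?S1" "E2 \<in> edge_graphs ?S2"
    using E1 E2 by (auto simp: block_graphs_def core_graphs_def conn_graphs_def)
  then have s: "E1 \<subseteq> ?S1 \<times> ?S1" "E2 \<subseteq> ?S2 \<times> ?S2" "irrefl E1" "irrefl E2"
    by (auto simp: edge_graphs_def)
  have i: "?S1 \<inter> ?S2 \<subseteq> {r}" using disj by auto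
  have c1: "conn ?E ?S1" "\<And>x. x \<in> ?S1 \<Longrightarrow> conn ?E (?S1 - {x})"
    using E1 conn_mono[of E1 _ ?E] by (auto simp: block_graphs_def conn_graphs_def)
  have c2: "conn ?E ?S2" "\<And>x. x \<in> Y \<Longrightarrow> conn ?E (?S2 - {x})"
    using E2 conn_mono[of E2 _ ?E] disj by (auto simp: core_graphs_def conn_graphs_def)
  have S: "insert r (X \<union> Y) = ?S1 \<union> ?S2" by auto
  have "?E \<in> edge_graphs (?S1 \<union> ?S2)" using g by (rule edge_graphs_Un)
  moreover have "conn ?E (?S1 \<union> ?S2)" using conn_Un[OF c1(1) c2(1), of r] by simp
  moreover have "\<not> longcyc ?E"
    using longcyc_Un[OF g i] E1 E2 by (auto simp: block_graphs_def core_graphs_def conn_graphs_def)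
  moreover have "conn ?E (?S1 \<union> ?S2 - {x})" if "x \<in> X \<union> Y" for x
  proof (cases "x \<in> X")
    case True
    have "?S1 \<union> ?S2 - {x} = (?S1 - {x}) \<union> ?S2" using True disj by auto
    then show ?thesis using conn_Un[OF c1(2)[of x] c2(1), of r] True disj by (metis Diff_iff insertCI singletonD)
  next
    case False
    have "?S1 \<union> ?S2 - {x} = ?S1 \<union> (?S2 - {x})" using False that disj by auto
    then show ?thesis using conn_Un[OF c1(1) c2(2)[of x], of r] False that disj by (metis Diff_iff UnE insertCI singletonD)
  qed
  ultimately show "?E \<in> core_graphs r (insert r (X \<union> Y))"
    unfolding S core_graphs_def conn_graphs_def by blast
  show "edge_closed ?E (X \<union> Y) X" using s disj by (intro edge_closedI) auto
  have "?S1 - {r} = X" using disj by auto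
  then show "conn ?E X" using c1(2)[of r] by simp
  show "induced ?E ?S1 = E1" by (rule induced_Un_overlap[OF s(1,2,4) i])
  show "induced ?E ?S2 = E2" using induced_Un_overlap[OF s(2,1,3), of r] i by (simp add: Un_commute Int_commute)
qed

text \<open>\<open>Y\<close> meets the rest of the graph only through \<open>r\<close>. A closed
  subset of the part that misses \<open>r\<close> is closed in the whole; for one that contains
  \<open>r\<close>, the same is true of its complement in the part. Taking \<open>Z\<close> empty
  gives connectivity, taking a singleton gives the absence of cutvertices.\<close>

lemma conn_attached_part:
  assumes con: "conn E (insert r U - Z)" and sym: "sym E" and r: "r \<notin> U"
    and Y: "edge_closed E U Y" and Z: "Z \<subseteq> Y"
  shows "conn E (insert r Y - Z)"
proof (rule connI)
  have YU: "Y \<subseteq> U" using Y by (simp add: edge_closed_def)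
  have nb: "b \<in> Y" if "a \<in> Y" "b \<in> U" "(a, b) \<in> E" for a b using Y that by (auto simp: edge_closed_def)
  show "insert r Y - Z \<noteq> {}" using Z r YU by auto
  fix T x assume T: "edge_closed E (insert r Y - Z) T" "x \<in> T"
  show "insert r Y - Z \<subseteq> T"
  proof (cases "r \<in> T")
    case True
    have cl: "edge_closed E (insert r U - Z) (insert r Y - Z - T)"
    proof (rule edge_closedI)
      fix a b assume ab: "a \<in> insert r Y - Z - T" "b \<in> insert r U - Z" "(a, b) \<in> E"
      then have "b \<in> insert r Y - Z" using nb[of a b] True by auto
      moreover have "b \<notin> T" using ab T sym by (auto simp: edge_closed_def dest: symD)
      ultimately show "b \<in> insert r Y - Z - T" by simp
    qed (use YU in auto)
    have "r \<in> insert r U - Z" using Z r YU by auto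
    then have "y \<notin> insert r Y - Z - T" for y using connD[OF con cl, of y] True by blast
    then show ?thesis by blast
  next
    case False
    have "edge_closed E (insert r U - Z) T"
    proof (rule edge_closedI)
      fix a b assume ab: "a \<in> T" "b \<in> insert r U - Z" "(a, b) \<in> E"
      then have "a \<in> Y" using T False by (auto simp: edge_closed_def)
      then have "b \<in> insert r Y - Z" using nb[of a b] ab by auto
      then show "b \<in> T" using T ab by (auto simp: edge_closed_def)
    qed (use YU T in \<open>auto simp: edge_closed_def\<close>)
    then have "insert r U - Z \<subseteq> T" using connD[OF con] T by blast
    then show ?thesis using False Z r YU by auto
  qed
qed

text \<open>The block of a core that contains \<open>u\<close> consists of \<open>r\<close> and the
  component of \<open>u\<close> after deletion of \<open>r\<close>: a cutvertex of it other than
  \<open>r\<close> would be one of the core, and deleting \<open>r\<close> leaves the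
  component.\<close>

lemma core_graph_split:
  assumes E: "E \<in> core_graphs r (insert r U)" and U: "finite U" "u \<in> U" "r \<notin> U"
  obtains X where "u \<in> X" "X \<subseteq> U"
    "induced E (insert r X) \<in> block_graphs (insert r X)"
    "induced E (insert r (U - X)) \<in> core_graphs r (insert r (U - X))"
    "E = induced E (insert r X) \<union> induced E (insert r (U - X))"
proof -
  let ?S = "insert r U"
  \<comment> \<open>The component of \<open>u\<close> without \<open>r\<close>, as the least closed
    set containing \<open>u\<close>.\<close>
  define X where "X = \<Inter>{T. edge_closed E U T \<and> u \<in> T}"
  have g: "E \<in> edge_graphs ?S" "\<not> longcyc E" and sym: "sym E"
    using E by (auto simp: core_graphs_def conn_graphs_def edge_graphs_def)
  have c: "conn E ?S" "\<And>x. x \<in> U \<Longrightarrow> conn E (?S - {x})"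
    using E U by (auto simp: core_graphs_def conn_graphs_def)
  have uX: "u \<in> X" and XU: "X \<subseteq> U" using U by (auto simp: X_def edge_closed_def)
  have Xc: "edge_closed E U X"
  proof (rule edge_closedI[OF XU])
    fix a b assume ab: "a \<in> X" "b \<in> U" "(a, b) \<in> E"
    have "b \<in> T" if "edge_closed E U T" "u \<in> T" for T
      using ab that unfolding X_def edge_closed_def by blast
    then show "b \<in> X" by (simp add: X_def)
  qed
  have Xmin: "X \<subseteq> T" if "edge_closed E U T" "u \<in> T" for T using that by (auto simp: X_def)
  have nbX: "b \<in> X \<or> b = r" if "a \<in> X" "(a, b) \<in> E" for a b
    using that Xc g by (auto simp: edge_closed_def edge_graphs_def)
  have nbX': "a \<in> X \<or> a = r" if "b \<in> X" "(a, b) \<in> E" for a b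
    using that nbX sym by (auto dest: symD)
  have conX: "conn E X"
  proof (rule connI)
    show "X \<noteq> {}" using uX by auto
    fix T x assume T: "edge_closed E X T" "x \<in> T"
    have T1: "edge_closed E U T" using edge_closed_trans[OF Xc T(1)] .
    have T2: "edge_closed E U (X - T)" using edge_closed_Diff[OF Xc T(1) sym] .
    \<comment> \<open>Otherwise \<open>X - T\<close> would be a smaller closed set containing
      \<open>u\<close>.\<close>
    have "u \<in> T"
    proof (rule ccontr)
      assume "u \<notin> T"
      then have "X \<subseteq> X - T" using T2 uX Xmin by blast
      then show False using T by (auto simp: edge_closed_def)
    qed
    then show "X \<subseteq> T" using Xmin T1 by blast
  qed
  have Yc: "edge_closed E U (U - X)"
    using edge_closed_Diff[OF _ Xc sym] by (auto simp: edge_closed_def)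
  have partX: "conn E (insert r X - Z)" if "conn E (?S - Z)" "Z \<subseteq> X" for Z
    by (rule conn_attached_part[OF that(1) sym U(3) Xc that(2)])
  have partY: "conn E (insert r (U - X) - Z)" if "conn E (?S - Z)" "Z \<subseteq> U - X" for Z
    by (rule conn_attached_part[OF that(1) sym U(3) Yc that(2)])
  have 1: "induced E (insert r X) \<in> block_graphs (insert r X)"
  proof -
    have "conn E (insert r X - {x})" if "x \<in> insert r X" for x
    proof (cases "x = r")
      case True
      then have "insert r X - {x} = X" using U XU by auto
      then show ?thesis using conX by simp
    next
      case False
      then show ?thesis using partX[of "{x}"] c that XU by auto
    qed
    moreover have "2 \<le> card (insert r X)"
    proof -
      have "card {r, u} \<le> card (insert r X)" using uX U XU finite_subset by (intro card_mono) auto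
      moreover have "card {r, u} = 2" using U by (metis card_2_iff)
      ultimately show ?thesis by linarith
    qed
    moreover have "conn E (insert r X)" using partX[of "{}"] c by auto
    ultimately show ?thesis
      using induced_conn_graphs[OF g, of "insert r X"] conn_induced[OF Diff_subset]
      unfolding block_graphs_def by blast
  qed
  have 2: "induced E (insert r (U - X)) \<in> core_graphs r (insert r (U - X))"
  proof (rule induced_core_graphs[OF g])
    show "conn E (insert r (U - X))" using partY[of "{}"] c by auto
    show "conn E (insert r (U - X) - {x})" if "x \<in> insert r (U - X) - {r}" for x
      using partY[of "{x}"] c that XU by auto
  qed
  have 3: "E = induced E (insert r X) \<union> induced E (insert r (U - X))"
    using g nbX nbX' by (auto simp: edge_graphs_def induced_def)
  show ?thesis using that[OF uX XU 1 2 3] .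
qed

text \<open>The combinatorial form of A' = B'' A. Fixing \<open>u\<close> makes each core arise
  exactly once, from the block containing \<open>u\<close>; \<open>X\<close> holds the further
  vertices of that block, and what remains is again a core.\<close>

lemma card_core_graphs_split:
  assumes U: "finite U" "u \<in> U" "r \<notin> U"
  shows "card (core_graphs r (insert r U)) =
    (\<Sum>X\<in>Pow (U - {u}). card (block_graphs (insert r (insert u X))) * card (core_graphs r (insert r (U - {u} - X))))"
proof -
  define T where "T = (SIGMA X:Pow (U - {u}). block_graphs (insert r (insert u X)) \<times> core_graphs r (insert r (U - {u} - X)))"
  define f where "f = (\<lambda>(X :: 'a set, E1 :: ('a \<times> 'a) set, E2). E1 \<union> E2)"
  have fin: "finite X" if "X \<subseteq> U" for X using that U finite_subset by auto
  have "card T = (\<Sum>X\<in>Pow (U - {u}). card (block_graphs (insert r (insert u X))) * card (core_graphs r (insert r (U - {u} - X))))"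
    unfolding T_def using U fin
    by (subst card_SigmaI) (auto simp: card_cartesian_product intro!: finite_cartesian_product finite_block_graphs finite_core_graphs)
  moreover have "bij_betw f T (core_graphs r (insert r U))"
    unfolding bij_betw_def
  proof (intro conjI subset_antisym)
    show "inj_on f T"
    proof (rule inj_onI)
      fix p q assume pq: "p \<in> T" "q \<in> T" "f p = f q"
      obtain X E1 E2 where p: "p = (X, E1, E2)" using prod_cases3 by blast
      obtain X' E1' E2' where q: "q = (X', E1', E2')" using prod_cases3 by blast
      have d: "insert u X \<union> (U - {u} - X) = U" "insert u X' \<union> (U - {u} - X') = U"
        "insert u X \<inter> (U - {u} - X) = {}" "insert u X' \<inter> (U - {u} - X') = {}"
        "r \<notin> insert u X" "r \<notin> U - {u} - X" "r \<notin> insert u X'" "r \<notin> U - {u} - X'"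
        "u \<notin> X" "u \<notin> X'"
        using pq U by (auto simp: p q T_def)
      have m: "E1 \<in> block_graphs (insert r (insert u X))" "E2 \<in> core_graphs r (insert r (U - {u} - X))"
        "E1' \<in> block_graphs (insert r (insert u X'))" "E2' \<in> core_graphs r (insert r (U - {u} - X'))"
        and e: "E1 \<union> E2 = E1' \<union> E2'"
        using pq by (auto simp: p q T_def f_def)
      note b = block_Un_core[OF m(1,2) d(3,5,6), unfolded d(1)]
      note b' = block_Un_core[OF m(3,4) d(4,7,8), unfolded d(2), folded e]
      \<comment> \<open>Each of the two sets is connected and each is closed, and both contain
        \<open>u\<close>, so they include one another.\<close>
      have "insert u X \<subseteq> insert u X'"
        using connD[OF b(3) edge_closed_Int[OF b'(2)], of u] pq by (auto simp: p q T_def U)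
      moreover have "insert u X' \<subseteq> insert u X"
        using connD[OF b'(3) edge_closed_Int[OF b(2)], of u] pq by (auto simp: p q T_def U)
      ultimately have XX: "X = X'" using d by blast
      then show "p = q" using b(4,5) b'(4,5) by (simp add: p q)
    qed
    show "f ` T \<subseteq> core_graphs r (insert r U)"
    proof
      fix E assume "E \<in> f ` T"
      then obtain X E1 E2 where X: "X \<subseteq> U - {u}" "E1 \<in> block_graphs (insert r (insert u X))"
        "E2 \<in> core_graphs r (insert r (U - {u} - X))" "E = E1 \<union> E2"
        by (auto simp: T_def f_def)
      have "insert u X \<union> (U - {u} - X) = U" using X U by auto
      then show "E \<in> core_graphs r (insert r U)"
        using block_Un_core(1)[OF X(2,3)] X U by auto
    qed
    show "core_graphs r (insert r U) \<subseteq> f ` T"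
    proof
      fix E assume "E \<in> core_graphs r (insert r U)"
      then obtain X where X: "u \<in> X" "X \<subseteq> U"
        "induced E (insert r X) \<in> block_graphs (insert r X)"
        "induced E (insert r (U - X)) \<in> core_graphs r (insert r (U - X))"
        "E = induced E (insert r X) \<union> induced E (insert r (U - X))"
        using core_graph_split[OF _ U] by blast
      have i: "insert u (X - {u}) = X" "U - {u} - (X - {u}) = U - X" using X by auto
      have "(X - {u}, induced E (insert r X), induced E (insert r (U - X))) \<in> T"
        unfolding T_def mem_Sigma_iff i using X by blast
      moreover have "E = f (X - {u}, induced E (insert r X), induced E (insert r (U - X)))"
        unfolding f_def prod.case by (rule X(5))
      ultimately show "E \<in> f ` T" by (rule rev_image_eqI)
    qed
  qed
  ultimately show ?thesis using bij_betw_same_card by metis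
qed

subsection \<open>The core of a rooted graph\<close>

text \<open>
  \<open>below\<close> collects the vertices that \<open>x\<close> separates from the root; the core, whose vertices no other
  vertex separates from the root, is the union of the blocks that contain the root.
\<close>

definition below :: "('a \<times> 'a) set \<Rightarrow> 'a set \<Rightarrow> 'a \<Rightarrow> 'a \<Rightarrow> 'a set" where
  "below E S r x = \<Union>{D. edge_closed E (S - {x}) D \<and> r \<notin> D}"

definition core_verts :: "('a \<times> 'a) set \<Rightarrow> 'a set \<Rightarrow> 'a \<Rightarrow> 'a set" where
  "core_verts E S r = {k \<in> S. \<forall>x\<in>S - {r}. k \<notin> below E S r x}"

lemma below_closed: "edge_closed E (S - {x}) (below E S r x)"
proof (rule edge_closedI)
  show "below E S r x \<subseteq> S - {x}" by (auto simp: below_def edge_closed_def)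
  fix u v assume "u \<in> below E S r x" "v \<in> S - {x}" "(u, v) \<in> E"
  then obtain D where "edge_closed E (S - {x}) D" "r \<notin> D" "u \<in> D" by (auto simp: below_def)
  moreover from this have "v \<in> D" using \<open>v \<in> S - {x}\<close> \<open>(u, v) \<in> E\<close> by (auto simp: edge_closed_def)
  ultimately show "v \<in> below E S r x" by (auto simp: below_def)
qed

lemma below_subset: "below E S r x \<subseteq> S - {x, r}"
  by (auto simp: below_def edge_closed_def)

lemma below_maximal: "edge_closed E (S - {x}) D \<Longrightarrow> r \<notin> D \<Longrightarrow> D \<subseteq> below E S r x"
  by (auto simp: below_def)

lemma below_nb:
  assumes "a \<in> below E S r x" "(a, b) \<in> E" "b \<in> S"
  shows "b = x \<or> b \<in> below E S r x"
  using below_closed[of E S x r] assms by (auto simp: edge_closed_def)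

context
  fixes E :: "('a \<times> 'a) set" and S :: "'a set" and r :: 'a
  assumes E: "E \<in> edge_graphs S" and con: "conn E S" and r: "r \<in> S" and fin: "finite S"
begin

lemma edges_in: "(a, b) \<in> E \<Longrightarrow> a \<in> S \<and> b \<in> S"
  using E by (auto simp: edge_graphs_def)

lemma edges_sym: "(a, b) \<in> E \<Longrightarrow> (b, a) \<in> E"
  using E by (auto simp: edge_graphs_def dest: symD)

lemma closed_no_root: "edge_closed E S D \<Longrightarrow> r \<notin> D \<Longrightarrow> D = {}"
  using connD[OF con, of D] r by blast

lemma root_in_core: "r \<in> core_verts E S r"
  using r below_subset[of E S r] by (auto simp: core_verts_def)

lemma core_subset: "core_verts E S r \<subseteq> S"
  by (auto simp: core_verts_def)

lemma core_not_below: "k \<in> core_verts E S r \<Longrightarrow> x \<in> S \<Longrightarrow> x \<noteq> r \<Longrightarrow> k \<notin> below E S r x"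
  by (auto simp: core_verts_def)

text \<open>Among the vertices that separate \<open>u\<close> from the root, take one with the
  largest set below it. A vertex separating it from the root in turn would have a still larger set
  below it.\<close>

lemma below_core_exists:
  assumes "u \<in> S - core_verts E S r"
  shows "\<exists>w\<in>core_verts E S r - {r}. u \<in> below E S r w"
proof -
  define Z where "Z = {x \<in> S - {r}. u \<in> below E S r x}"
  have "Z \<noteq> {}" "finite Z" using assms fin by (auto simp: Z_def core_verts_def)
  then have "Max ((\<lambda>z. card (below E S r z)) ` Z) \<in> (\<lambda>z. card (below E S r z)) ` Z"
    by (intro Max_in) auto
  then obtain x where x: "x \<in> Z" and xm: "Max ((\<lambda>z. card (below E S r z)) ` Z) = card (below E S r x)" by blast
  have mx: "card (below E S r z) \<le> card (below E S r x)" if "z \<in> Z" for z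
    unfolding xm[symmetric] using that \<open>finite Z\<close> by (intro Max_ge) auto
  have xS: "x \<in> S" "x \<noteq> r" "u \<in> below E S r x" using x by (auto simp: Z_def)
  have "x \<in> core_verts E S r"
  proof (rule ccontr)
    assume "x \<notin> core_verts E S r"
    then obtain z where z: "z \<in> S" "z \<noteq> r" "x \<in> below E S r z" using xS by (auto simp: core_verts_def)
    let ?D = "below E S r x \<union> below E S r z"
    have sub: "?D \<subseteq> S - {r}" using below_subset[of E S r x] below_subset[of E S r z] by blast
    show False
    proof (cases "z \<in> below E S r x")
      \<comment> \<open>Here \<open>x\<close> and \<open>z\<close> lie below each other, so no edge
        leaves the union and the root cannot be reached.\<close>
      case True
      have "edge_closed E S ?D"
      proof (rule edge_closedI)
        fix a b assume "a \<in> ?D" "b \<in> S" "(a, b) \<in> E"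
        then show "b \<in> ?D" using below_nb[of a E S r x b] below_nb[of a E S r z b] True z by blast
      qed (use sub in blast)
      then show False using closed_no_root sub z by blast
    next
      case False
      \<comment> \<open>Whatever is below \<open>x\<close> is below \<open>z\<close> too, and so is
        \<open>x\<close> itself; this contradicts the choice of \<open>x\<close>.\<close>
      have "edge_closed E (S - {z}) ?D"
      proof (rule edge_closedI)
        fix a b assume "a \<in> ?D" "b \<in> S - {z}" "(a, b) \<in> E"
        then show "b \<in> ?D" using below_nb[of a E S r x b] below_nb[of a E S r z b] z by blast
      qed (use sub False below_subset[of E S r z] in blast)
      then have s: "?D \<subseteq> below E S r z" using sub by (intro below_maximal) auto
      then have "below E S r x \<subset> below E S r z" using z below_subset[of E S r x] by blast
      then have "card (below E S r x) < card (below E S r z)"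
        using below_subset[of E S r z] fin by (meson finite_Diff finite_subset psubset_card_mono)
      moreover have "z \<in> Z" using s xS z by (auto simp: Z_def)
      ultimately show False using mx by fastforce
    qed
  qed
  then show ?thesis using xS by blast
qed

text \<open>The intersection of the two sets could be left only through \<open>w\<close> or
  \<open>w'\<close>. An edge to \<open>w\<close> would place \<open>w\<close> below
  \<open>w'\<close>, which is impossible in the core, and conversely. So the intersection is closed,
  misses the root and is empty.\<close>

lemma below_core_unique:
  assumes "w \<in> core_verts E S r - {r}" "w' \<in> core_verts E S r - {r}"
    "u \<in> below E S r w" "u \<in> below E S r w'"
  shows "w = w'"
proof (rule ccontr)
  assume ne: "w \<noteq> w'"
  let ?D = "below E S r w \<inter> below E S r w'"
  have n: "w \<notin> below E S r w'" "w' \<notin> below E S r w"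
    using core_not_below[of w w'] core_not_below[of w' w] assms core_subset by auto
  have "edge_closed E S ?D"
  proof (rule edge_closedI)
    fix a b assume "a \<in> ?D" "b \<in> S" "(a, b) \<in> E"
    then show "b \<in> ?D" using below_nb[of a E S r w b] below_nb[of a E S r w' b] n ne by blast
  qed (use below_subset[of E S r w] in blast)
  moreover have "r \<notin> ?D" using below_subset[of E S r w] by blast
  ultimately have "?D = {}" by (rule closed_no_root)
  then show False using assms by blast
qed

lemma conn_insert_below:
  assumes "w \<in> S"
  shows "conn E (insert w (below E S r w))"
proof -
  have "sym E" using E by (simp add: edge_graphs_def)
  moreover have "conn E (insert w (S - {w}) - {})" using con assms by (simp add: insert_absorb)
  ultimately show ?thesis
    using conn_attached_part[of E w "S - {w}" "{}", OF _ _ _ below_closed] by simp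
qed

text \<open>Lifts a closed set of core vertices to the whole graph by adding all that hangs below
  them, which transfers connectivity from \<open>S\<close> to the core, also after deletion of
  \<open>R\<close>. The root is exempt from the union because \<open>below E S r r\<close> is all of
  \<open>S - {r}\<close>.\<close>

lemma core_closed_extend:
  assumes T: "edge_closed E (core_verts E S r - R) T" and R: "R \<subseteq> core_verts E S r"
  defines "T' \<equiv> T \<union> (\<Union>w\<in>T - {r}. below E S r w)"
  shows "edge_closed E (S - R) T'" "T' \<inter> core_verts E S r = T"
proof -
  let ?K = "core_verts E S r"
  have TK: "T \<subseteq> ?K - R" using T by (auto simp: edge_closed_def)
  have nbk: "below E S r w \<inter> ?K = {}" if "w \<in> T - {r}" for w
    using that TK core_subset core_not_below by blast
  then show "T' \<inter> ?K = T" using TK by (auto simp: T'_def)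
  show "edge_closed E (S - R) T'"
  proof (rule edge_closedI)
    have "below E S r w \<subseteq> S - R" if "w \<in> T - {r}" for w
      using nbk[OF that] R below_subset[of E S r w] by blast
    then show "T' \<subseteq> S - R" using TK core_subset unfolding T'_def by blast
    fix a b assume ab: "a \<in> T'" "b \<in> S - R" "(a, b) \<in> E"
    consider "a \<in> T" | w where "w \<in> T - {r}" "a \<in> below E S r w" using ab by (auto simp: T'_def)
    then show "b \<in> T'"
    proof cases
      case 1
      show ?thesis
      proof (cases "b \<in> ?K")
        case True
        then show ?thesis using 1 ab T by (auto simp: edge_closed_def T'_def)
      next
        case False
        then obtain w where w: "w \<in> ?K - {r}" "b \<in> below E S r w"
          using below_core_exists[of b] ab by blast
        have "a = w"
        proof -
          have "a = w \<or> a \<in> below E S r w"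
            using below_nb[OF w(2) edges_sym[OF ab(3)]] edges_in[OF ab(3)] by blast
          then show ?thesis using core_not_below[of a w] 1 TK w core_subset by blast
        qed
        then show ?thesis using w 1 by (auto simp: T'_def)
      qed
    next
      case 2
      then have "b = w \<or> b \<in> below E S r w" using below_nb[OF 2(2) ab(3)] ab by blast
      then show ?thesis using 2 by (auto simp: T'_def)
    qed
  qed
qed

lemma conn_core: "conn E (core_verts E S r)"
proof (rule connI)
  show "core_verts E S r \<noteq> {}" using root_in_core by blast
  fix T x assume T: "edge_closed E (core_verts E S r) T" "x \<in> T"
  then have T0: "edge_closed E (core_verts E S r - {}) T" by simp
  note e = core_closed_extend[OF T0, simplified]
  have "S \<subseteq> T \<union> (\<Union>w\<in>T - {r}. below E S r w)" using connD[OF con e(1), of x] T by blast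
  then show "core_verts E S r \<subseteq> T" using e(2) core_subset by blast
qed

text \<open>Lift a closed set, or its complement, whichever misses the root. The lift is closed
  without \<open>x\<close>, hence lies below \<open>x\<close>, where there are no core
  vertices.\<close>

lemma conn_core_Diff:
  assumes x: "x \<in> core_verts E S r - {r}"
  shows "conn E (core_verts E S r - {x})"
proof (rule connI)
  let ?K = "core_verts E S r"
  show "?K - {x} \<noteq> {}" using root_in_core x by blast
  fix T t assume T: "edge_closed E (?K - {x}) T" "t \<in> T"
  let ?T = "T \<union> (\<Union>w\<in>T - {r}. below E S r w)"
  have "{x} \<subseteq> ?K" using x by blast
  note e = core_closed_extend[OF T(1) this]
  have TK: "T \<subseteq> ?K - {x}" using T by (auto simp: edge_closed_def)
  have kx: "?K \<inter> below E S r x = {}" using core_not_below x core_subset by blast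
  show "?K - {x} \<subseteq> T"
  proof (cases "r \<in> T")
    case True
    have "edge_closed E (S - {x}) ((S - {x}) - ?T)"
      by (rule edge_closed_Diff[OF _ e(1)]) (use E in \<open>auto simp: edge_closed_def edge_graphs_def\<close>)
    then have "(S - {x}) - ?T \<subseteq> below E S r x" using True by (intro below_maximal) auto
    then show ?thesis using kx e(2) core_subset by blast
  next
    case False
    then have "r \<notin> ?T" using below_subset[of E S r] by blast
    then have "?T \<subseteq> below E S r x" using below_maximal[OF e(1)] by blast
    then show ?thesis using kx T TK by blast
  qed
qed

text \<open>Recognises the decomposition of a graph glued from parts. No vertex of \<open>K\<close>
  lies below \<open>w\<close>, since \<open>K - {w}\<close> is connected and contains the root; a
  part attached at another vertex is joined to \<open>K\<close> and so is not below \<open>w\<close>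
  either.\<close>

lemma core_unique:
  assumes K: "r \<in> K" "K \<subseteq> S" and g: "\<And>v. v \<in> S - K \<Longrightarrow> g v \<in> K - {r}"
    and nb: "\<And>v z. v \<in> S - K \<Longrightarrow> (v, z) \<in> E \<Longrightarrow> z = g v \<or> (z \<in> S - K \<and> g z = g v)"
    and cK: "conn E K" "\<And>x. x \<in> K - {r} \<Longrightarrow> conn E (K - {x})"
    and cD: "\<And>w. w \<in> K - {r} \<Longrightarrow> conn E (insert w {v \<in> S - K. g v = w})"
  shows "core_verts E S r = K" "w \<in> K - {r} \<Longrightarrow> below E S r w = {v \<in> S - K. g v = w}"
proof -
  have b: "below E S r w = {v \<in> S - K. g v = w}" (is "_ = ?D w") if w: "w \<in> K - {r}" for w
  proof
    have "edge_closed E (S - {w}) (?D w)"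
      by (rule edge_closedI) (use nb w in auto)
    then show "?D w \<subseteq> below E S r w" using K by (intro below_maximal) auto
    show "below E S r w \<subseteq> ?D w"
    proof
      fix v assume v: "v \<in> below E S r w"
      have cl: "edge_closed E (S - {w}) (below E S r w)" by (rule below_closed)
      have rb: "r \<notin> below E S r w" "w \<notin> below E S r w" using below_subset[of E S r w] by blast+
      have "edge_closed E (K - {w}) ((K - {w}) \<inter> below E S r w)"
        by (rule edge_closed_Int[OF cl]) (use K in blast)
      then have nK: "y \<notin> below E S r w" if "y \<in> K" for y
        using connD[OF cK(2)[OF w], of _ y] rb that K w by blast
      then have vK: "v \<in> S - K" using v below_subset[of E S r w] by blast
      show "v \<in> ?D w"
      proof (rule ccontr)
        assume "v \<notin> ?D w"
        then have gv: "g v \<noteq> w" using vK by blast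
        let ?w = "g v"
        have w': "?w \<in> K - {r}" using g vK by blast
        have "edge_closed E (insert ?w (?D ?w)) (insert ?w (?D ?w) \<inter> below E S r w)"
          by (rule edge_closed_Int[OF cl]) (use w' gv w K in auto)
        then show False using connD[OF cD[OF w'], of _ v] v vK nK w' by blast
      qed
    qed
  qed
  then show "w \<in> K - {r} \<Longrightarrow> below E S r w = {v \<in> S - K. g v = w}" .
  show "core_verts E S r = K"
  proof
    show "core_verts E S r \<subseteq> K"
    proof
      fix k assume k: "k \<in> core_verts E S r"
      show "k \<in> K"
      proof (rule ccontr)
        assume "k \<notin> K"
        then have kk: "k \<in> S - K" using k core_subset by blast
        then have "k \<in> below E S r (g k)" using b[OF g[OF kk]] by blast
        then show False using core_not_below[OF k, of "g k"] g[OF kk] K by blast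
      qed
    qed
    show "K \<subseteq> core_verts E S r"
    proof
      fix k assume k: "k \<in> K"
      have "k \<notin> below E S r x" if x: "x \<in> S - {r}" for x
      proof (cases "x \<in> K")
        case True
        then show ?thesis using b[of x] x k by blast
      next
        case False
        have "edge_closed E K (K \<inter> below E S r x)"
          by (rule edge_closed_Int[OF below_closed]) (use K False in blast)
        then show ?thesis using connD[OF cK(1), of _ k] k K below_subset[of E S r x] by blast
      qed
      then show "k \<in> core_verts E S r" using k K by (auto simp: core_verts_def)
    qed
  qed
qed

end

section \<open>Gluing connected graphs onto a core\<close>

lemma cyc_induced: "cyc E xs \<Longrightarrow> set xs \<subseteq> S \<Longrightarrow> cyc (induced E S) xs"
  by (erule cyc_mono) (auto simp: induced_def)

abbreviation fibre :: "'a set \<Rightarrow> 'a set \<Rightarrow> ('a \<Rightarrow> 'a) \<Rightarrow> 'a \<Rightarrow> 'a set" where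
  "fibre U W g w \<equiv> {v \<in> U - W. g v = w}"

text \<open>\<open>G w\<close> includes its attachment vertex \<open>w\<close>, so it shares exactly
  that vertex with the core. Nothing is attached at the root, as all blocks containing the root
  belong to the core.\<close>

definition glued :: "'a set \<Rightarrow> ('a \<times> 'a) set \<Rightarrow> ('a \<Rightarrow> ('a \<times> 'a) set) \<Rightarrow> ('a \<times> 'a) set" where
  "glued W H G = H \<union> (\<Union>w\<in>W. G w)"

context
  fixes U W :: "'a set" and r :: 'a and g :: "'a \<Rightarrow> 'a" and H :: "('a \<times> 'a) set" and G :: "'a \<Rightarrow> ('a \<times> 'a) set"
  assumes U: "finite U" "r \<notin> U" and W: "W \<subseteq> U" and g: "g \<in> (U - W) \<rightarrow>\<^sub>E W"
    and H: "H \<in> core_graphs r (insert r W)"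
    and G: "G \<in> (\<Pi>\<^sub>E w\<in>W. conn_graphs (insert w (fibre U W g w)))"
begin

lemma G_conn: "w \<in> W \<Longrightarrow> G w \<in> conn_graphs (insert w (fibre U W g w))"
  using G by (auto simp: PiE_def)

lemma g_in: "v \<in> U \<Longrightarrow> v \<notin> W \<Longrightarrow> g v \<in> W"
  using g by (auto simp: PiE_def)

lemma G_edge:
  assumes "w \<in> W" "(a, b) \<in> G w"
  shows "a = w \<or> a \<in> U - W \<and> g a = w" "b = w \<or> b \<in> U - W \<and> g b = w" "a \<noteq> b" "(b, a) \<in> G w"
  using G_conn[OF assms(1)] assms(2) by (auto simp: conn_graphs_def edge_graphs_def irrefl_def dest: symD)

lemma H_edge:
  assumes "(a, b) \<in> H"
  shows "a \<in> insert r W" "b \<in> insert r W" "a \<noteq> b" "(b, a) \<in> H"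
  using H assms by (auto simp: core_graphs_def conn_graphs_def edge_graphs_def irrefl_def dest: symD)

lemma glued_edge_graphs: "(glued W H G) \<in> edge_graphs (insert r U)"
proof -
  have "a \<in> insert r U \<and> b \<in> insert r U \<and> a \<noteq> b \<and> (b, a) \<in> (glued W H G)" if "(a, b) \<in> (glued W H G)" for a b
  proof (cases "(a, b) \<in> H")
    case True
    then show ?thesis using H_edge[OF True] W by (auto simp: glued_def)
  next
    case False
    then obtain w where w: "w \<in> W" "(a, b) \<in> G w" using \<open>(a, b) \<in> (glued W H G)\<close> by (auto simp: glued_def)
    then show ?thesis using G_edge[OF w] W by (auto simp: glued_def)
  qed
  then show ?thesis unfolding edge_graphs_def sym_def irrefl_def by auto
qed

lemma induced_glued_H: "induced (glued W H G) (insert r W) = H"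
proof -
  have "(a, b) \<in> H" if "(a, b) \<in> (glued W H G)" "a \<in> insert r W" "b \<in> insert r W" for a b
  proof (rule ccontr)
    assume "(a, b) \<notin> H"
    then obtain w where w: "w \<in> W" "(a, b) \<in> G w" using \<open>(a, b) \<in> (glued W H G)\<close> by (auto simp: glued_def)
    then show False using G_edge[OF w] that U by auto
  qed
  moreover have "(a, b) \<in> (glued W H G) \<and> a \<in> insert r W \<and> b \<in> insert r W" if "(a, b) \<in> H" for a b
    using H_edge[OF that] that by (auto simp: glued_def)
  ultimately show ?thesis unfolding induced_def by blast
qed

lemma glued_nb:
  assumes "v \<in> U - W" "(v, z) \<in> (glued W H G)"
  shows "z = g v \<or> (z \<in> U - W \<and> g z = g v)" "(v, z) \<in> G (g v)"
proof -
  have "(v, z) \<notin> H" using H_edge[of v z] assms U by auto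
  then obtain w where w: "w \<in> W" "(v, z) \<in> G w" using assms by (auto simp: glued_def)
  then have "g v = w" using G_edge[OF w] assms by auto
  then show "z = g v \<or> (z \<in> U - W \<and> g z = g v)" "(v, z) \<in> G (g v)" using G_edge[OF w] w by auto
qed

lemma induced_glued_G:
  assumes "w \<in> W"
  shows "induced (glued W H G) (insert w (fibre U W g w)) = G w"
proof -
  let ?B = "insert w (fibre U W g w)"
  have "(a, b) \<in> G w" if "(a, b) \<in> (glued W H G)" "a \<in> ?B" "b \<in> ?B" for a b
  proof -
    have ne: "a \<noteq> b" "(b, a) \<in> (glued W H G)"
      using glued_edge_graphs that by (auto simp: edge_graphs_def irrefl_def dest: symD)
    show ?thesis
    proof (cases "a = w")
      case False
      then show ?thesis using glued_nb(2)[of a b] that by auto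
    next
      case True
      then have "(b, a) \<in> G w" using glued_nb(2)[of b a] that ne by auto
      then show ?thesis using G_edge assms by blast
    qed
  qed
  moreover have "(a, b) \<in> (glued W H G) \<and> a \<in> ?B \<and> b \<in> ?B" if "(a, b) \<in> G w" for a b
    using G_edge[OF assms that] that assms by (auto simp: glued_def)
  ultimately show ?thesis unfolding induced_def by blast
qed

lemma glued_conn_parts:
  "conn (glued W H G) (insert r W)" "x \<in> insert r W - {r} \<Longrightarrow> conn (glued W H G) (insert r W - {x})"
  "w \<in> W \<Longrightarrow> conn (glued W H G) (insert w (fibre U W g w))"
proof -
  have h: "H \<subseteq> (glued W H G)" by (auto simp: glued_def)
  show "conn (glued W H G) (insert r W)"
    using conn_mono[OF _ h] H by (auto simp: core_graphs_def conn_graphs_def)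
  show "conn (glued W H G) (insert r W - {x})" if "x \<in> insert r W - {r}"
    using conn_mono[OF _ h, of "insert r W - {x}"] H that unfolding core_graphs_def by blast
  show "conn (glued W H G) (insert w (fibre U W g w))" if "w \<in> W"
    using conn_mono[of "G w" _ "glued W H G"] G_conn[OF that] that by (auto simp: conn_graphs_def glued_def)
qed

lemma glued_conn: "conn (glued W H G) (insert r U)"
proof (rule connI)
  fix T x assume T: "edge_closed (glued W H G) (insert r U) T" "x \<in> T"
  have cK: "insert r W \<subseteq> T" if "y \<in> T" "y \<in> insert r W" for y
    using connD[OF glued_conn_parts(1) edge_closed_Int[OF T(1)], of y] that W by blast
  have cB: "insert w (fibre U W g w) \<subseteq> T" if "w \<in> W" "y \<in> T" "y \<in> insert w (fibre U W g w)" for w y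
    using connD[OF glued_conn_parts(3)[OF that(1)] edge_closed_Int[OF T(1)], of y] that W by blast
  have "x \<in> insert r U" using T by (auto simp: edge_closed_def)
  then have K: "insert r W \<subseteq> T"
    using cK[of x] cK[of "g x"] cB[of "g x" x] g_in[of x] T(2) by blast
  show "insert r U \<subseteq> T"
  proof
    fix v assume "v \<in> insert r U"
    then show "v \<in> T" using K cB[of "g v" "g v"] g_in[of v] by blast
  qed
qed simp

text \<open>A cycle with a vertex \<open>v\<close> outside the core is confined by
  \<open>cyc_in_closed\<close>, with gate \<open>g v\<close>, to the part attached there.\<close>

lemma glued_not_longcyc: "\<not> longcyc (glued W H G)"
proof
  assume "longcyc (glued W H G)"
  then obtain xs where xs: "cyc (glued W H G) xs" "5 \<le> length xs" by (auto simp: longcyc_def)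
  have sy: "sym (glued W H G)" using glued_edge_graphs by (auto simp: edge_graphs_def)
  have sub: "set xs \<subseteq> insert r U" using cyc_Field[OF xs(1)] glued_edge_graphs by (auto simp: edge_graphs_def)
  show False
  proof (cases "set xs \<subseteq> insert r W")
    case True
    then have "cyc H xs" using cyc_induced[OF xs(1) True] induced_glued_H by simp
    then show False using xs H by (auto simp: core_graphs_def conn_graphs_def longcyc_def)
  next
    case False
    then obtain v where v: "v \<in> set xs" "v \<in> U - W" using sub by blast
    let ?w = "g v"
    have w: "?w \<in> W" using g_in v by blast
    have "set xs \<subseteq> insert ?w {v' \<in> U - W. g v' = ?w}"
    proof (rule cyc_in_closed[OF xs(1) sy])
      fix a b assume "a \<in> {v' \<in> U - W. g v' = ?w}" "(a, b) \<in> (glued W H G)"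
      then show "b \<in> {v' \<in> U - W. g v' = ?w} \<or> b = ?w" using glued_nb(1)[of a b] by auto
    qed (use v w in auto)
    then have "cyc (G ?w) xs" using cyc_induced[OF xs(1)] induced_glued_G[OF w] by metis
    then show False using xs G_conn[OF w] by (auto simp: conn_graphs_def longcyc_def)
  qed
qed

lemma glued_in: "(glued W H G) \<in> conn_graphs (insert r U)"
  using glued_edge_graphs glued_conn glued_not_longcyc by (simp add: conn_graphs_def)

text \<open>All ingredients can be read off the glued graph, so gluing is injective.\<close>

lemma glued_core:
  "core_verts (glued W H G) (insert r U) r = insert r W"
  "w \<in> W \<Longrightarrow> below (glued W H G) (insert r U) r w = fibre U W g w"
proof -
  have d: "insert r U - insert r W = U - W" "insert r W - {r} = W" using U W by auto
  have a: "core_verts (glued W H G) (insert r U) r = insert r W \<and>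
    (w \<in> insert r W - {r} \<longrightarrow> below (glued W H G) (insert r U) r w = {v \<in> insert r U - insert r W. g v = w})" for w
    by (intro conjI impI core_unique[OF glued_edge_graphs glued_conn _ _, where g = g])
       (use U W g_in glued_nb(1) glued_conn_parts in \<open>auto simp: d\<close>)
  show "core_verts (glued W H G) (insert r U) r = insert r W"
    "w \<in> W \<Longrightarrow> below (glued W H G) (insert r U) r w = fibre U W g w"
    using a[of w] unfolding d by auto
qed

end

text \<open>The combinatorial form of C' = A(z C'): \<open>W\<close> is the core without the root,
  and \<open>g\<close> sends every other vertex to the core vertex below which it hangs. Extensional
  functions keep \<open>g\<close> and the family of attached graphs unique.\<close>

lemma card_conn_graphs_core:
  assumes U: "finite U" "r \<notin> U"
  shows "card (conn_graphs (insert r U)) = (\<Sum>W\<in>Pow U. \<Sum>g\<in>(U - W) \<rightarrow>\<^sub>E W.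
    card (core_graphs r (insert r W)) * (\<Prod>w\<in>W. card (conn_graphs (insert w (fibre U W g w)))))"
proof -
  define T where "T = (SIGMA W:Pow U. SIGMA g:(U - W) \<rightarrow>\<^sub>E W.
    core_graphs r (insert r W) \<times> (\<Pi>\<^sub>E w\<in>W. conn_graphs (insert w (fibre U W g w))))"
  define f where "f = (\<lambda>(W :: 'a set, g :: 'a \<Rightarrow> 'a, H :: ('a \<times> 'a) set, G). glued W H G)"
  have fin: "finite W" if "W \<subseteq> U" for W using that U finite_subset by auto
  have fin2: "finite (\<Pi>\<^sub>E w\<in>W. conn_graphs (insert w (fibre U W g w)))" if "W \<subseteq> U" for W g
    using fin[OF that] U by (intro finite_PiE finite_conn_graphs) auto
  have "card T = (\<Sum>W\<in>Pow U. card (SIGMA g:(U - W) \<rightarrow>\<^sub>E W.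
    core_graphs r (insert r W) \<times> (\<Pi>\<^sub>E w\<in>W. conn_graphs (insert w (fibre U W g w)))))"
    unfolding T_def
  proof (rule card_SigmaI)
    show "finite (Pow U)" using U by simp
    show "\<forall>W\<in>Pow U. finite (SIGMA g:(U - W) \<rightarrow>\<^sub>E W.
      core_graphs r (insert r W) \<times> (\<Pi>\<^sub>E w\<in>W. conn_graphs (insert w (fibre U W g w))))"
    proof (intro ballI finite_SigmaI)
      fix W assume "W \<in> Pow U"
      then have W: "W \<subseteq> U" by simp
      show "finite ((U - W) \<rightarrow>\<^sub>E W)" using U fin[OF W] by (intro finite_PiE) auto
      show "finite (core_graphs r (insert r W))" using fin[OF W] by (intro finite_core_graphs) simp
      show "finite (\<Pi>\<^sub>E w\<in>W. conn_graphs (insert w (fibre U W g w)))" for g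
        by (rule fin2[OF W])
    qed
  qed
  also have "\<dots> = (\<Sum>W\<in>Pow U. \<Sum>g\<in>(U - W) \<rightarrow>\<^sub>E W.
    card (core_graphs r (insert r W)) * (\<Prod>w\<in>W. card (conn_graphs (insert w (fibre U W g w)))))"
  proof (rule sum.cong[OF refl])
    fix W assume "W \<in> Pow U"
    then have W: "W \<subseteq> U" by simp
    have "card (SIGMA g:(U - W) \<rightarrow>\<^sub>E W.
      core_graphs r (insert r W) \<times> (\<Pi>\<^sub>E w\<in>W. conn_graphs (insert w (fibre U W g w)))) =
      (\<Sum>g\<in>(U - W) \<rightarrow>\<^sub>E W. card (core_graphs r (insert r W) \<times> (\<Pi>\<^sub>E w\<in>W. conn_graphs (insert w (fibre U W g w)))))"
    proof (rule card_SigmaI)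
      show "finite ((U - W) \<rightarrow>\<^sub>E W)" using U fin[OF W] by (intro finite_PiE) auto
      have "finite (core_graphs r (insert r W))" using fin[OF W] by (intro finite_core_graphs) simp
      then show "\<forall>g\<in>(U - W) \<rightarrow>\<^sub>E W. finite (core_graphs r (insert r W) \<times>
        (\<Pi>\<^sub>E w\<in>W. conn_graphs (insert w (fibre U W g w))))"
        using fin2[OF W] by blast
    qed
    also have "\<dots> = (\<Sum>g\<in>(U - W) \<rightarrow>\<^sub>E W.
      card (core_graphs r (insert r W)) * (\<Prod>w\<in>W. card (conn_graphs (insert w (fibre U W g w)))))"
      by (intro sum.cong refl) (simp add: card_cartesian_product card_PiE[OF fin[OF W]])
    finally show "card (SIGMA g:(U - W) \<rightarrow>\<^sub>E W.
      core_graphs r (insert r W) \<times> (\<Pi>\<^sub>E w\<in>W. conn_graphs (insert w (fibre U W g w)))) =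
      (\<Sum>g\<in>(U - W) \<rightarrow>\<^sub>E W.
      card (core_graphs r (insert r W)) * (\<Prod>w\<in>W. card (conn_graphs (insert w (fibre U W g w)))))" .
  qed
  finally have cT: "card T = \<dots>" .
  have "bij_betw f T (conn_graphs (insert r U))"
    unfolding bij_betw_def
  proof (intro conjI subset_antisym)
    show "inj_on f T"
    proof (rule inj_onI)
      fix p q assume pq: "p \<in> T" "q \<in> T" "f p = f q"
      obtain W g H G where p: "p = (W, g, H, G)" using prod_cases4 by blast
      obtain W' g' H' G' where q: "q = (W', g', H', G')" using prod_cases4 by blast
      have m: "W \<subseteq> U" "g \<in> (U - W) \<rightarrow>\<^sub>E W" "H \<in> core_graphs r (insert r W)"
          "G \<in> (\<Pi>\<^sub>E w\<in>W. conn_graphs (insert w (fibre U W g w)))"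
        and m': "W' \<subseteq> U" "g' \<in> (U - W') \<rightarrow>\<^sub>E W'" "H' \<in> core_graphs r (insert r W')"
          "G' \<in> (\<Pi>\<^sub>E w\<in>W'. conn_graphs (insert w {v \<in> U - W'. g' v = w}))"
        and e: "glued W H G = glued W' H' G'"
        using pq by (auto simp: p q T_def f_def)
      have "insert r W = insert r W'" using glued_core(1)[OF U m] glued_core(1)[OF U m'] e by simp
      then have WW: "W = W'" using m(1) m'(1) U by (metis insert_ident subsetD)
      note n = m'[folded WW] and e' = e[folded WW]
      have HH: "H = H'" using induced_glued_H[OF U m] induced_glued_H[OF U n] unfolding e' by simp
      have bel: "fibre U W g w = {v \<in> U - W. g' v = w}" if "w \<in> W" for w
        using glued_core(2)[OF U m that] glued_core(2)[OF U n that] unfolding e' by simp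
      have gg: "g = g'"
      proof (rule PiE_ext[OF m(2) n(2)])
        fix v assume v: "v \<in> U - W"
        then have gv: "g v \<in> W" using m(2) by (auto simp: PiE_def)
        have "v \<in> {x \<in> U - W. g x = g v}" using v by simp
        then have "v \<in> {x \<in> U - W. g' x = g v}" unfolding bel[OF gv] .
        then show "g v = g' v" by simp
      qed
      note n' = n[folded gg]
      have GG: "G = G'"
      proof (rule PiE_ext[OF m(4) n'(4)])
        fix w assume w: "w \<in> W"
        show "G w = G' w"
          using induced_glued_G[OF U m w] induced_glued_G[OF U n' w] unfolding e' by simp
      qed
      show "p = q" using WW HH gg GG by (simp add: p q)
    qed
    show "f ` T \<subseteq> conn_graphs (insert r U)"
      using glued_in[OF U] by (auto simp: T_def f_def)
    show "conn_graphs (insert r U) \<subseteq> f ` T"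
    proof
      fix E assume E: "E \<in> conn_graphs (insert r U)"
      let ?S = "insert r U"
      have a: "E \<in> edge_graphs ?S" "conn E ?S" "r \<in> ?S" "finite ?S" "\<not> longcyc E"
        using E U by (auto simp: conn_graphs_def)
      note c = a(1-4)
      define W where "W = core_verts E ?S r - {r}"
      have K: "core_verts E ?S r = insert r W" using root_in_core[OF c] by (auto simp: W_def)
      have WU: "W \<subseteq> U" using core_subset[OF c] by (auto simp: W_def)
      \<comment> \<open>\<open>below_core_exists\<close> provides such a \<open>w\<close>, and
        \<open>below_core_unique\<close> makes the choice immaterial.\<close>
      define g where "g = (\<lambda>v\<in>U - W. SOME w. w \<in> W \<and> v \<in> below E ?S r w)"
      have gs: "g v \<in> W \<and> v \<in> below E ?S r (g v)" if "v \<in> U - W" for v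
      proof -
        have "v \<in> ?S - core_verts E ?S r" using that U K by auto
        then have "\<exists>w. w \<in> W \<and> v \<in> below E ?S r w" using below_core_exists[OF c] unfolding W_def by blast
        from someI_ex[OF this] show ?thesis using that by (simp add: g_def)
      qed
      have gm: "g \<in> (U - W) \<rightarrow>\<^sub>E W" using gs by (auto simp: g_def)
      have bel: "below E ?S r w = fibre U W g w" if w: "w \<in> W" for w
      proof
        show "fibre U W g w \<subseteq> below E ?S r w" using gs by auto
        show "below E ?S r w \<subseteq> fibre U W g w"
        proof
          fix v assume v: "v \<in> below E ?S r w"
          have wr: "w \<in> ?S" "w \<noteq> r" using w WU U by auto
          have "v \<notin> core_verts E ?S r" using core_not_below[OF c _ wr] v by blast
          then have vU: "v \<in> U - W" using v below_subset[of E ?S r w] K by auto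
          have "g v = w" using below_core_unique[OF c, of "g v" w v] gs[OF vU] v w unfolding W_def by blast
          then show "v \<in> fibre U W g w" using vU by simp
        qed
      qed
      define H where "H = induced E (insert r W)"
      define G where "G = (\<lambda>w\<in>W. induced E (insert w (fibre U W g w)))"
      have Hm: "H \<in> core_graphs r (insert r W)"
        unfolding H_def K[symmetric]
        by (rule induced_core_graphs[OF a(1,5) conn_core[OF c] conn_core_Diff[OF c]])
      have Gm: "G \<in> (\<Pi>\<^sub>E w\<in>W. conn_graphs (insert w (fibre U W g w)))"
      proof (rule PiE_I)
        fix w assume w: "w \<in> W"
        have "conn E (insert w (fibre U W g w))"
          using conn_insert_below[OF c, of w] bel[OF w] w WU U by auto
        then show "G w \<in> conn_graphs (insert w (fibre U W g w))"
          using w induced_conn_graphs[OF a(1,5)] by (simp add: G_def)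
      qed (simp add: G_def)
      have "E \<subseteq> glued W H G"
      proof
        fix e assume eE: "e \<in> E"
        obtain x y where xy: "e = (x, y)" by (cases e)
        have xyE: "(x, y) \<in> E" "(y, x) \<in> E" "x \<in> ?S" "y \<in> ?S"
          using eE edges_in[OF c] edges_sym[OF c] xy by blast+
        \<comment> \<open>An edge with an end outside the core stays within the part of that
          end.\<close>
        have *: "(x, y) \<in> glued W H G" if v: "v \<in> U - W" "v = x \<or> v = y" for v
        proof -
          let ?w = "g v"
          have w: "?w \<in> W" "v \<in> below E ?S r ?w" using gs v by auto
          have "x \<in> insert ?w (below E ?S r ?w)" "y \<in> insert ?w (below E ?S r ?w)"
            using below_nb[of x E ?S r ?w y] below_nb[of y E ?S r ?w x] v w xyE by auto
          then have "(x, y) \<in> G ?w" using w xyE unfolding G_def bel[OF w(1)] by (simp add: induced_def)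
          then show ?thesis using w by (auto simp: glued_def)
        qed
        show "e \<in> glued W H G"
        proof (cases "x \<in> insert r W \<and> y \<in> insert r W")
          case True
          then show ?thesis using xy xyE by (auto simp: glued_def H_def induced_def)
        next
          case False
          then show ?thesis using * xy xyE by blast
        qed
      qed
      moreover have "glued W H G \<subseteq> E" by (auto simp: glued_def H_def G_def induced_def)
      ultimately have "E = f (W, g, H, G)" by (auto simp: f_def)
      moreover have "(W, g, H, G) \<in> T"
        unfolding T_def mem_Sigma_iff using WU gm Hm Gm by blast
      ultimately show "E \<in> f ` T" by (rule rev_image_eqI[rotated])
    qed
  qed
  then show ?thesis using cT bij_betw_same_card by metis
qed

subsection \<open>Equations for the generating functions\<close>

definition conn_num :: "nat \<Rightarrow> nat" where "conn_num n = card (conn_graphs {1..n})"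
definition block_num :: "nat \<Rightarrow> nat" where "block_num n = card (block_graphs {1..n})"
text \<open>Here \<open>n\<close> leaves out the root, whereas \<open>conn_num\<close> and
  \<open>block_num\<close> count all vertices; hence the index shifts in \<open>conn_fps\<close> and
  \<open>block_fps\<close>.\<close>

definition core_num :: "nat \<Rightarrow> nat" where "core_num n = card (core_graphs 0 (insert 0 {1..n}))"

lemma card_conn_graphs: "finite (S :: nat set) \<Longrightarrow> card (conn_graphs S) = conn_num (card S)"
  unfolding conn_num_def by (rule card_conn_graphs_eq) auto

lemma card_block_graphs: "finite (S :: nat set) \<Longrightarrow> card (block_graphs S) = block_num (card S)"
  unfolding block_num_def by (rule card_block_graphs_eq) auto

lemma sum_Pow_card:
  fixes f :: "nat \<Rightarrow> 'b :: comm_semiring_1"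
  assumes "finite V"
  shows "(\<Sum>X\<in>Pow V. f (card X)) = (\<Sum>k\<le>card V. of_nat (card V choose k) * f k)"
proof -
  have "(\<Sum>X\<in>Pow V. f (card X)) = (\<Sum>k\<le>card V. \<Sum>X\<in>{X\<in>Pow V. card X = k}. f (card X))"
    by (rule sum.group[symmetric]) (use assms in \<open>auto intro: card_mono\<close>)
  also have "\<dots> = (\<Sum>k\<le>card V. of_nat (card V choose k) * f k)"
  proof (rule sum.cong[OF refl])
    fix k
    have "{X\<in>Pow V. card X = k} = {X. X \<subseteq> V \<and> card X = k}" by auto
    then show "(\<Sum>X\<in>{X\<in>Pow V. card X = k}. f (card X)) = of_nat (card V choose k) * f k"
      using n_subsets[OF assms, of k] by simp
  qed
  finally show ?thesis .
qed

lemma core_graphs_singleton: "core_graphs r {r} = {{}}"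
proof -
  have "\<not> longcyc ({} :: ('a \<times> 'a) set)" by (auto simp: longcyc_def cyc_def)
  moreover have "E = {}" if "E \<in> edge_graphs {r}" for E
    using that by (auto simp: edge_graphs_def irrefl_def)
  moreover have "{} \<in> edge_graphs {r}" by (auto simp: edge_graphs_def irrefl_def sym_def)
  ultimately show ?thesis by (auto simp: core_graphs_def conn_graphs_def)
qed

text \<open>The count \<open>a\<close> on smaller sets is left abstract, so that the lemma serves
  twice: by induction it shows that the count depends only on the size, and afterwards it gives the
  recurrence.\<close>

lemma card_core_graphs_rec:
  fixes U :: "nat set"
  assumes "finite U" "r \<notin> U" "card U = Suc n"
    and "\<And>Y :: nat set. finite Y \<Longrightarrow> r \<notin> Y \<Longrightarrow> card Y \<le> n \<Longrightarrow> card (core_graphs r (insert r Y)) = a (card Y)"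
  shows "card (core_graphs r (insert r U)) = (\<Sum>k\<le>n. (n choose k) * (block_num (k + 2) * a (n - k)))"
proof -
  obtain u where u: "u \<in> U" using assms by fastforce
  have cV: "card (U - {u}) = n" and fV: "finite (U - {u})" using assms u by auto
  have "card (core_graphs r (insert r U)) = (\<Sum>X\<in>Pow (U - {u}).
      card (block_graphs (insert r (insert u X))) * card (core_graphs r (insert r (U - {u} - X))))"
    by (rule card_core_graphs_split) (use assms u in auto)
  also have "\<dots> = (\<Sum>X\<in>Pow (U - {u}). block_num (card X + 2) * a (n - card X))"
  proof (rule sum.cong[OF refl])
    fix X assume "X \<in> Pow (U - {u})"
    then have X: "X \<subseteq> U - {u}" by simp
    have fX: "finite X" using X fV finite_subset by blast
    have "card (insert r (insert u X)) = card X + 2"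
      using X assms u fX by (subst card_insert_disjoint; auto)+
    moreover have "card (U - {u} - X) = n - card X" using card_Diff_subset[OF fX X] cV by simp
    ultimately show "card (block_graphs (insert r (insert u X))) * card (core_graphs r (insert r (U - {u} - X)))
      = block_num (card X + 2) * a (n - card X)"
      using assms fX by (simp add: card_block_graphs)
  qed
  also have "\<dots> = (\<Sum>k\<le>n. (n choose k) * (block_num (k + 2) * a (n - k)))"
    using sum_Pow_card[OF fV, of "\<lambda>k. block_num (k + 2) * a (n - k)"] cV by simp
  finally show ?thesis .
qed

lemma card_core_graphs:
  fixes U :: "nat set"
  assumes "finite U" "r \<notin> U"
  shows "card (core_graphs r (insert r U)) = core_num (card U)"
  using assms
proof (induction "card U" arbitrary: U r rule: less_induct)
  case less
  show ?case
  proof (cases "card U")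
    case 0
    then show ?thesis using less.prems by (simp add: core_num_def core_graphs_singleton)
  next
    case (Suc n)
    have "card (core_graphs r (insert r U)) = (\<Sum>k\<le>n. (n choose k) * (block_num (k + 2) * core_num (n - k)))"
      by (rule card_core_graphs_rec) (use less Suc in auto)
    moreover have "core_num (Suc n) = (\<Sum>k\<le>n. (n choose k) * (block_num (k + 2) * core_num (n - k)))"
      unfolding core_num_def[of "Suc n"] by (rule card_core_graphs_rec) (use less Suc in auto)
    ultimately show ?thesis using Suc by simp
  qed
qed

lemma core_num_0: "core_num 0 = 1"
  by (simp add: core_num_def core_graphs_singleton)

lemma core_num_Suc: "core_num (Suc n) = (\<Sum>k\<le>n. (n choose k) * (block_num (k + 2) * core_num (n - k)))"
  unfolding core_num_def[of "Suc n"] by (rule card_core_graphs_rec) (auto intro: card_core_graphs)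

text \<open>The coefficient of a product of \<open>card W\<close> exponential generating functions:
  a map into \<open>W\<close> distributes the labels over the factors. The induction splits off the
  fibre of one element.\<close>

lemma sum_prod_fibres:
  fixes h :: "nat \<Rightarrow> real"
  assumes "finite W" "finite V"
  shows "(\<Sum>g\<in>V \<rightarrow>\<^sub>E W. \<Prod>w\<in>W. h (card {v \<in> V. g v = w})) =
    fact (card V) * fps_nth (Abs_fps (\<lambda>n. h n / fact n) ^ card W) (card V)"
  using assms
proof (induction W arbitrary: V rule: finite_induct)
  case empty
  then show ?case by (auto simp: PiE_empty_range)
next
  case (insert w W)
  let ?F = "Abs_fps (\<lambda>n. h n / fact n)" let ?n = "card V"
  define T where "T = (SIGMA X:Pow V. (V - X) \<rightarrow>\<^sub>E W)"
  have "(\<Sum>g\<in>V \<rightarrow>\<^sub>E insert w W. \<Prod>w'\<in>insert w W. h (card {v \<in> V. g v = w'})) =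
    (\<Sum>(X, g)\<in>T. h (card X) * (\<Prod>w'\<in>W. h (card {v \<in> V - X. g v = w'})))"
  proof (rule sum.reindex_bij_witness[where
        j = "\<lambda>g. ({v \<in> V. g v = w}, restrict g {v \<in> V. g v \<noteq> w})" and
        i = "\<lambda>(X, g). (\<lambda>v\<in>V. if v \<in> X then w else g v)"])
    fix g assume g: "g \<in> V \<rightarrow>\<^sub>E insert w W"
    have d: "V - {v \<in> V. g v = w} = {v \<in> V. g v \<noteq> w}" by auto
    show "(case ({v \<in> V. g v = w}, restrict g {v \<in> V. g v \<noteq> w}) of (X, g) \<Rightarrow> \<lambda>v\<in>V. if v \<in> X then w else g v) = g"
      using g by (auto simp: PiE_def extensional_def fun_eq_iff)
    show "({v \<in> V. g v = w}, restrict g {v \<in> V. g v \<noteq> w}) \<in> T"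
      using g by (auto simp: T_def d PiE_def)
    have "(\<Prod>w'\<in>W. h (card {v \<in> V - {v \<in> V. g v = w}. restrict g {v \<in> V. g v \<noteq> w} v = w'})) =
      (\<Prod>w'\<in>W. h (card {v \<in> V. g v = w'}))"
    proof (rule prod.cong[OF refl])
      fix w' assume "w' \<in> W"
      then have "{v \<in> V - {v \<in> V. g v = w}. restrict g {v \<in> V. g v \<noteq> w} v = w'} = {v \<in> V. g v = w'}"
        using insert.hyps by auto
      then show "h (card {v \<in> V - {v \<in> V. g v = w}. restrict g {v \<in> V. g v \<noteq> w} v = w'}) = h (card {v \<in> V. g v = w'})"
        by simp
    qed
    then show "(case ({v \<in> V. g v = w}, restrict g {v \<in> V. g v \<noteq> w}) of
        (X, g) \<Rightarrow> h (card X) * (\<Prod>w'\<in>W. h (card {v \<in> V - X. g v = w'}))) =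
      (\<Prod>w'\<in>insert w W. h (card {v \<in> V. g v = w'}))"
      using insert.hyps by simp
  next
    fix p assume p: "p \<in> T"
    obtain X g where pe: "p = (X, g)" by (cases p)
    have X: "X \<subseteq> V" and g: "g \<in> (V - X) \<rightarrow>\<^sub>E W" using p by (auto simp: T_def pe)
    have gw: "g v \<noteq> w" if "v \<in> V" "v \<notin> X" for v using g that insert.hyps by (auto simp: PiE_def)
    show "(case p of (X, g) \<Rightarrow> \<lambda>v\<in>V. if v \<in> X then w else g v) \<in> V \<rightarrow>\<^sub>E insert w W"
      using X g by (auto simp: pe PiE_def Pi_iff)
    have x: "{v \<in> V. (\<lambda>v\<in>V. if v \<in> X then w else g v) v = w} = X" using X gw by auto
    have "{v \<in> V. (\<lambda>v\<in>V. if v \<in> X then w else g v) v \<noteq> w} = V - X" using X gw by auto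
    moreover have "restrict (\<lambda>v\<in>V. if v \<in> X then w else g v) (V - X) = g"
      using g by (auto simp: PiE_def extensional_def fun_eq_iff)
    ultimately show "({v \<in> V. (case p of (X, g) \<Rightarrow> \<lambda>v\<in>V. if v \<in> X then w else g v) v = w},
        restrict (case p of (X, g) \<Rightarrow> \<lambda>v\<in>V. if v \<in> X then w else g v)
          {v \<in> V. (case p of (X, g) \<Rightarrow> \<lambda>v\<in>V. if v \<in> X then w else g v) v \<noteq> w}) = p"
      unfolding pe prod.case x by simp
  qed
  also have "\<dots> = (\<Sum>X\<in>Pow V. \<Sum>g\<in>(V - X) \<rightarrow>\<^sub>E W. h (card X) * (\<Prod>w'\<in>W. h (card {v \<in> V - X. g v = w'})))"
    unfolding T_def
    by (rule sum.Sigma[symmetric])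
      (use insert in \<open>auto intro!: finite_PiE intro: finite_subset\<close>)
  also have "\<dots> = (\<Sum>X\<in>Pow V. h (card X) * (fact (?n - card X) * fps_nth (?F ^ card W) (?n - card X)))"
  proof (rule sum.cong[OF refl])
    fix X assume "X \<in> Pow V"
    then have X: "X \<subseteq> V" by simp
    then have "card (V - X) = ?n - card X"
      using insert.prems by (meson card_Diff_subset finite_subset)
    then show "(\<Sum>g\<in>(V - X) \<rightarrow>\<^sub>E W. h (card X) * (\<Prod>w'\<in>W. h (card {v \<in> V - X. g v = w'})))
      = h (card X) * (fact (?n - card X) * fps_nth (?F ^ card W) (?n - card X))"
      using insert.IH[of "V - X"] insert.prems by (simp add: sum_distrib_left[symmetric])
  qed
  also have "\<dots> = (\<Sum>k\<le>?n. real (?n choose k) * (h k * (fact (?n - k) * fps_nth (?F ^ card W) (?n - k))))"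
    by (rule sum_Pow_card) fact
  also have "\<dots> = (\<Sum>k\<le>?n. fact ?n * (h k / fact k * fps_nth (?F ^ card W) (?n - k)))"
    by (rule sum.cong) (auto simp: binomial_fact field_simps)
  also have "\<dots> = fact ?n * fps_nth (?F * ?F ^ card W) ?n"
    by (simp add: fps_mult_nth sum_distrib_left atMost_atLeast0)
  also have "?F * ?F ^ card W = ?F ^ card (insert w W)" using insert.hyps by simp
  finally show ?case .
qed

text \<open>These are \<open>A\<close>, \<open>C'\<close> and \<open>B''\<close>.\<close>

definition core_fps :: "real fps" where
  "core_fps = Abs_fps (\<lambda>n. real (core_num n) / fact n)"

definition conn_fps :: "real fps" where
  "conn_fps = Abs_fps (\<lambda>n. real (conn_num (Suc n)) / fact n)"

definition block_fps :: "real fps" where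
  "block_fps = Abs_fps (\<lambda>n. real (block_num (n + 2)) / fact n)"

lemma core_fps_deriv: "fps_deriv core_fps = block_fps * core_fps"
proof (rule fps_ext)
  fix n
  have "fps_nth (fps_deriv core_fps) n = real (core_num (Suc n)) / fact n"
    by (simp add: core_fps_def del: of_nat_Suc)
  also have "\<dots> = (\<Sum>k\<le>n. real (n choose k) * (real (block_num (k + 2)) * real (core_num (n - k)))) / fact n"
    by (simp add: core_num_Suc)
  also have "\<dots> = (\<Sum>k\<le>n. real (block_num (k + 2)) / fact k * (real (core_num (n - k)) / fact (n - k)))"
    unfolding sum_divide_distrib by (rule sum.cong) (auto simp: binomial_fact field_simps)
  also have "\<dots> = fps_nth (block_fps * core_fps) n"
    by (simp add: fps_mult_nth core_fps_def block_fps_def atMost_atLeast0)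
  finally show "fps_nth (fps_deriv core_fps) n = fps_nth (block_fps * core_fps) n" .
qed

text \<open>The part hanging at \<open>w\<close> has one vertex more than the fibre over
  \<open>w\<close>, which is why powers of C' appear rather than of C.\<close>

lemma conn_num_rec:
  "real (conn_num (Suc n)) =
    (\<Sum>k\<le>n. real (n choose k) * (real (core_num k) * (fact (n - k) * fps_nth (conn_fps ^ k) (n - k))))"
proof -
  let ?U = "{1..n}"
  have "real (conn_num (Suc n)) = real (card (conn_graphs (insert 0 ?U)))"
    by (subst card_conn_graphs) auto
  also have "\<dots> = (\<Sum>W\<in>Pow ?U. \<Sum>g\<in>(?U - W) \<rightarrow>\<^sub>E W. real (card (core_graphs 0 (insert 0 W))) *
      (\<Prod>w\<in>W. real (card (conn_graphs (insert w {v \<in> ?U - W. g v = w})))))"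
    by (subst card_conn_graphs_core) auto
  also have "\<dots> = (\<Sum>W\<in>Pow ?U. real (core_num (card W)) * (fact (n - card W) * fps_nth (conn_fps ^ card W) (n - card W)))"
  proof (rule sum.cong[OF refl])
    fix W assume "W \<in> Pow ?U"
    then have W: "W \<subseteq> ?U" "finite W" "0 \<notin> W" using finite_subset[of W ?U] by auto
    have "(\<Sum>g\<in>(?U - W) \<rightarrow>\<^sub>E W. real (card (core_graphs 0 (insert 0 W))) *
      (\<Prod>w\<in>W. real (card (conn_graphs (insert w {v \<in> ?U - W. g v = w}))))) =
      (\<Sum>g\<in>(?U - W) \<rightarrow>\<^sub>E W. real (core_num (card W)) *
      (\<Prod>w\<in>W. real (conn_num (Suc (card {v \<in> ?U - W. g v = w})))))"
      using W by (intro sum.cong prod.cong refl arg_cong2[where f = "(*)"] arg_cong[where f = real])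
        (auto simp: card_core_graphs card_conn_graphs)
    also have "\<dots> = real (core_num (card W)) *
      (fact (card (?U - W)) * fps_nth (conn_fps ^ card W) (card (?U - W)))"
      unfolding sum_distrib_left[symmetric] conn_fps_def
      using sum_prod_fibres[of W "?U - W" "\<lambda>k. real (conn_num (Suc k))"] W by simp
    also have "card (?U - W) = n - card W" using card_Diff_subset[OF W(2,1)] by simp
    finally show "(\<Sum>g\<in>(?U - W) \<rightarrow>\<^sub>E W. real (card (core_graphs 0 (insert 0 W))) *
      (\<Prod>w\<in>W. real (card (conn_graphs (insert w {v \<in> ?U - W. g v = w}))))) =
      real (core_num (card W)) * (fact (n - card W) * fps_nth (conn_fps ^ card W) (n - card W))" .
  qed
  also have "\<dots> = (\<Sum>k\<le>n. real (n choose k) * (real (core_num k) * (fact (n - k) * fps_nth (conn_fps ^ k) (n - k))))"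
    using sum_Pow_card[of ?U "\<lambda>k. real (core_num k) * (fact (n - k) * fps_nth (conn_fps ^ k) (n - k))"] by simp
  finally show ?thesis .
qed

lemma conn_fps_compose: "conn_fps = core_fps oo (fps_X * conn_fps)"
proof (rule fps_ext)
  fix n
  have "fps_nth conn_fps n = (\<Sum>k\<le>n. real (core_num k) / fact k * fps_nth (conn_fps ^ k) (n - k))"
    unfolding conn_fps_def[THEN arg_cong[where f = fps_nth]] fps_nth_Abs_fps conn_num_rec sum_divide_distrib
    by (rule sum.cong) (auto simp: binomial_fact field_simps)
  also have "\<dots> = fps_nth (core_fps oo (fps_X * conn_fps)) n"
    unfolding fps_compose_nth atMost_atLeast0
    by (rule sum.cong) (auto simp: core_fps_def power_mult_distrib fps_X_power_mult_nth)
  finally show "fps_nth conn_fps n = fps_nth (core_fps oo (fps_X * conn_fps)) n" .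
qed

subsection \<open>Blocks without long cycles\<close>

text \<open>The complete bipartite graph with small side \<open>{a, b}\<close>.\<close>

definition k2 :: "'a \<Rightarrow> 'a \<Rightarrow> 'a set \<Rightarrow> ('a \<times> 'a) set" where
  "k2 a b S = {a, b} \<times> (S - {a, b}) \<union> (S - {a, b}) \<times> {a, b}"

definition k2_edge :: "'a \<Rightarrow> 'a \<Rightarrow> 'a set \<Rightarrow> ('a \<times> 'a) set" where
  "k2_edge a b S = k2 a b S \<union> {(a, b), (b, a)}"

lemma conn_path:
  assumes "conn E T" "u \<in> T" "v \<in> T"
  obtains xs where "xs \<noteq> []" "hd xs = u" "last xs = v" "distinct xs" "set xs \<subseteq> T"
    "walk E xs"
proof -
  define P where "P = (\<lambda>v xs. xs \<noteq> [] \<and> hd xs = u \<and> last xs = v \<and> distinct xs \<and> set xs \<subseteq> T \<and>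
    walk E xs)"
  have "edge_closed E T {v. \<exists>xs. P v xs}"
  proof (rule edge_closedI)
    show "{v. \<exists>xs. P v xs} \<subseteq> T" using last_in_set by (fastforce simp: P_def)
    fix p q assume "p \<in> {v. \<exists>xs. P v xs}" and q: "q \<in> T" "(p, q) \<in> E"
    then obtain xs where xs: "P p xs" by blast
    show "q \<in> {v. \<exists>xs. P v xs}"
    proof (cases "q \<in> set xs")
      case True
      then obtain as bs where "xs = as @ q # bs" by (meson split_list)
      then have "P q (as @ [q])"
        using xs by (cases as) (auto simp: P_def successively_append_iff successively_Cons hd_append)
      then show ?thesis by blast
    next
      case False
      then have "P q (xs @ [q])" using xs q by (auto simp: P_def successively_append_iff)
      then show ?thesis by blast
    qed
  qed
  moreover have "P u [u]" using assms by (simp add: P_def)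
  ultimately have "\<exists>xs. P v xs" using connD[OF assms(1), of _ u] assms by blast
  then show ?thesis using that by (auto simp: P_def)
qed

text \<open>As \<open>s\<close> is no cutvertex, a path leads from \<open>v\<close> back to
  \<open>Z\<close> while avoiding \<open>s\<close>; it is cut at its first vertex in
  \<open>Z\<close>. Preceded by an edge from \<open>s\<close> to \<open>v\<close>, it becomes an ear
  with two different ends.\<close>

lemma ear:
  assumes con: "conn E (S - {s})" and Z: "s \<in> Z" "t0 \<in> Z" "t0 \<noteq> s" "Z \<subseteq> S" and v: "v \<in> S - Z"
  obtains t ys where "t \<in> Z" "t \<noteq> s" "ys \<noteq> []" "hd ys = v" "distinct ys" "set ys \<subseteq> S - Z"
    "walk E ys" "(last ys, t) \<in> E"
proof -
  obtain xs where xs: "xs \<noteq> []" "hd xs = v" "last xs = t0" "distinct xs" "set xs \<subseteq> S - {s}"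
    "walk E xs"
    using conn_path[OF con, of v t0] v Z by blast
  have "\<exists>x\<in>set xs. x \<in> Z" using last_in_set[OF xs(1)] xs(3) Z(2) by auto
  then obtain ys t zs where sp: "xs = ys @ t # zs" "t \<in> Z" "\<forall>y\<in>set ys. y \<notin> Z"
    using split_list_first_prop[of xs "\<lambda>x. x \<in> Z"] by blast
  have "ys \<noteq> []" using sp xs v by (cases ys) auto
  moreover have "walk E ys" "(last ys, t) \<in> E"
    using xs(6) calculation unfolding sp(1) by (simp_all add: successively_append_iff)
  ultimately show ?thesis
    using xs sp by (intro that[of t ys]) auto
qed

lemma cyc_append:
  assumes "ps \<noteq> []" "distinct ps" "walk E ps" "set ps \<inter> set ys = {}"
    "ys \<noteq> []" "distinct ys" "walk E ys"
    "(last ps, hd ys) \<in> E" "(last ys, hd ps) \<in> E"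
  shows "cyc E (ps @ ys)"
  using assms by (auto simp: cyc_def successively_append_iff hd_append)

lemma not_longcycD: "\<not> longcyc E \<Longrightarrow> cyc E xs \<Longrightarrow> length xs < 5"
  by (force simp: longcyc_def)

lemma finite_card_ex:
  assumes "finite A" "card A < card S"
  obtains v where "v \<in> S" "v \<notin> A"
  using assms by (metis card_mono linorder_not_less subsetI)

context
  fixes E :: "('a \<times> 'a) set" and S :: "'a set"
  assumes E: "E \<in> block_graphs S"
begin

lemma sym_E: "(u, v) \<in> E \<Longrightarrow> (v, u) \<in> E"
  using E by (auto simp: block_graphs_def conn_graphs_def edge_graphs_def dest: symD)

lemma in_S: "(u, v) \<in> E \<Longrightarrow> u \<in> S \<and> v \<in> S \<and> u \<noteq> v"
  using E by (auto simp: block_graphs_def conn_graphs_def edge_graphs_def irrefl_def)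

lemma con_S: "conn E S" and con_Diff: "x \<in> S \<Longrightarrow> conn E (S - {x})" and no_long: "\<not> longcyc E"
  and card_S: "2 \<le> card S"
  using E by (auto simp: block_graphs_def conn_graphs_def)

lemma leaving_edge:
  assumes "Z \<subseteq> S" "z \<in> Z" "v \<in> S" "v \<notin> Z"
  obtains s w where "s \<in> Z" "w \<in> S - Z" "(s, w) \<in> E"
proof -
  have "\<not> edge_closed E S Z" using connD[OF con_S, of Z z] assms by blast
  then show ?thesis using that assms by (auto simp: edge_closed_def)
qed

text \<open>An edge together with an ear between its two ends is a cycle.\<close>

lemma triangle_or_longer:
  assumes "3 \<le> card S"
  obtains xs where "cyc E xs" "3 \<le> length xs"
proof -
  obtain s0 where s0: "s0 \<in> S" using con_S conn_nonempty by fast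
  obtain t0 where "t0 \<in> S" "t0 \<notin> {s0}" using finite_card_ex[of "{s0}" S] assms by auto
  then obtain s t where st: "(s, t) \<in> E" using leaving_edge[of "{s0}" s0 t0] s0 by blast
  have ne: "s \<noteq> t" "s \<in> S" "t \<in> S" using in_S[OF st] by auto
  obtain v0 where "v0 \<in> S" "v0 \<notin> {s, t}" using finite_card_ex[of "{s, t}" S] assms ne by auto
  then obtain s' v where sv: "s' \<in> {s, t}" "v \<in> S - {s, t}" "(s', v) \<in> E"
    using leaving_edge[of "{s, t}" s v0] ne by auto
  define t' where "t' = (if s' = s then t else s)"
  obtain t'' ys where y: "t'' \<in> {s, t}" "t'' \<noteq> s'" "ys \<noteq> []" "hd ys = v" "distinct ys" "set ys \<subseteq> S - {s, t}"
    "walk E ys" "(last ys, t'') \<in> E"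
    by (rule ear[OF con_Diff[of s'], of "{s, t}" t' v]) (use sv ne in \<open>auto simp: t'_def\<close>)
  have "cyc E ([t'', s'] @ ys)"
    by (rule cyc_append) (use y sv st sym_E[OF st] ne in auto)
  then show ?thesis using y by (intro that) (auto simp: Suc_le_eq)
qed

text \<open>An ear on a triangle is closed through the third vertex rather than along the edge
  between its ends. The cycle has length at least 4, and no long cycle exists.\<close>

lemma four_cycle:
  assumes "4 \<le> card S"
  obtains a x b y where "cyc E [a, x, b, y]"
proof -
  obtain xs where xs: "cyc E xs" "3 \<le> length xs" using triangle_or_longer assms by auto
  have l: "length xs < 5" using not_longcycD no_long xs by blast
  have four: thesis if "cyc E zs" "length zs = 4" for zs
  proof -
    from \<open>length zs = 4\<close> obtain a x b y where "zs = [a, x, b, y]"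
      by (auto simp: numeral_eq_Suc length_Suc_conv)
    then show thesis using \<open>cyc E zs\<close> \<open>\<And>a x b y. cyc E [a, x, b, y] \<Longrightarrow> thesis\<close> by blast
  qed
  show thesis
  proof (cases "length xs = 4")
    case True
    then show ?thesis using four xs by blast
  next
    case False
    then have "length xs = 3" using l xs by linarith
    then obtain p q w where pq: "xs = [p, q, w]" by (auto simp: numeral_eq_Suc length_Suc_conv)
    have e: "(p, q) \<in> E" "(q, w) \<in> E" "(w, p) \<in> E" "distinct [p, q, w]" using xs pq by (auto simp: cyc_def)
    then have e': "(q, p) \<in> E" "(w, q) \<in> E" "(p, w) \<in> E" using sym_E by blast+
    have sub: "{p, q, w} \<subseteq> S" using in_S e by blast
    obtain v0 where "v0 \<in> S" "v0 \<notin> {p, q, w}"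
      using finite_card_ex[of "{p, q, w}" S] assms card_insert_le_m1[of 3 "{q, w}" p] e by auto
    then obtain s v where sv: "s \<in> {p, q, w}" "v \<in> S - {p, q, w}" "(s, v) \<in> E"
      using leaving_edge[of "{p, q, w}" p v0] sub by blast
    obtain t0 where t0: "t0 \<in> {p, q, w}" "t0 \<noteq> s" using e sv by auto
    have sS: "s \<in> S" using sv sub by blast
    obtain t ys where y: "t \<in> {p, q, w}" "t \<noteq> s" "ys \<noteq> []" "hd ys = v" "distinct ys" "set ys \<subseteq> S - {p, q, w}"
      "walk E ys" "(last ys, t) \<in> E"
      by (rule ear[OF con_Diff[OF sS] sv(1) t0 sub sv(2)])
    obtain z where z: "z \<in> {p, q, w}" "z \<noteq> s" "z \<noteq> t" using e sv y by auto
    have "(t, z) \<in> E" "(z, s) \<in> E" using e e' z sv y by auto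
    then have c: "cyc E ([t, z, s] @ ys)"
      by (intro cyc_append) (use y z sv in auto)
    then have "length ([t, z, s] @ ys) < 5" using not_longcycD no_long by blast
    then have "length ([t, z, s] @ ys) = 4" using y by (cases ys) auto
    then show ?thesis using four c by blast
  qed
qed

text \<open>If an ear starting with \<open>a\<close>, \<open>v\<close> returned at a neighbour of
  \<open>a\<close> on the cycle, going round through all four cycle vertices would give a cycle of
  length at least 5. So it returns at \<open>b\<close>, and closing it through \<open>x\<close>
  shows that \<open>v\<close> is its only inner vertex.\<close>

lemma four_cycle_opposite:
  assumes c: "cyc E [a, x, b, y]" and v: "v \<notin> {a, x, b, y}" "(a, v) \<in> E"
  shows "(v, b) \<in> E"
proof -
  have e: "(a, x) \<in> E" "(x, b) \<in> E" "(b, y) \<in> E" "(y, a) \<in> E" "distinct [a, x, b, y]"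
    using c by (auto simp: cyc_def)
  then have e': "(x, a) \<in> E" "(b, x) \<in> E" "(y, b) \<in> E" "(a, y) \<in> E" using sym_E by blast+
  have sub: "{a, x, b, y} \<subseteq> S" "a \<in> S" using in_S e by blast+
  have vS: "v \<in> S - {a, x, b, y}" using in_S v by blast
  obtain t ys where y: "t \<in> {a, x, b, y}" "t \<noteq> a" "ys \<noteq> []" "hd ys = v" "distinct ys"
    "set ys \<subseteq> S - {a, x, b, y}" "walk E ys" "(last ys, t) \<in> E"
    by (rule ear[OF con_Diff[OF sub(2)], of "{a, x, b, y}" x v]) (use e sub vS in auto)
  have len: "length zs < 5" if "cyc E zs" for zs using not_longcycD no_long that by blast
  consider "t = x" | "t = y" | "t = b" using y by blast
  then show ?thesis
  proof cases
    case 1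
    have "cyc E ([x, b, y, a] @ ys)" by (rule cyc_append) (use y v e e' 1 in auto)
    from len[OF this] show ?thesis using y by (cases ys) auto
  next
    case 2
    have "cyc E ([y, b, x, a] @ ys)" by (rule cyc_append) (use y v e e' 2 in auto)
    from len[OF this] show ?thesis using y by (cases ys) auto
  next
    case 3
    have "cyc E ([b, x, a] @ ys)" by (rule cyc_append) (use y v e e' 3 in auto)
    from len[OF this] have "length ys = 1" using y by (cases ys) auto
    then have "ys = [v]" using y by (cases ys) auto
    then show ?thesis using y 3 by simp
  qed
qed

text \<open>\<open>N\<close> collects the common neighbours of \<open>a\<close> and
  \<open>b\<close>. It has three elements, so a spare one is always available for closing a cycle:
  an edge inside \<open>N\<close> gives a 5-cycle, and an edge from \<open>N\<close> to a vertex
  outside gives a 6-cycle after \<open>four_cycle_opposite\<close>. That lemma also puts every other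
  neighbour of \<open>a\<close> or \<open>b\<close> into \<open>N\<close>.\<close>

lemma block_is_k2:
  assumes card: "5 \<le> card S"
  obtains a b where "a \<in> S" "b \<in> S" "a \<noteq> b" "E = k2 a b S \<or> E = k2_edge a b S"
proof -
  have len: "length zs < 5" if "cyc E zs" for zs using not_longcycD no_long that by blast
  have ex: "\<exists>a x b y v. cyc E [a, x, b, y] \<and> v \<notin> {a, x, b, y} \<and> (a, v) \<in> E"
  proof -
    have "4 \<le> card S" using card by simp
    then obtain a x b y where c: "cyc E [a, x, b, y]" by (rule four_cycle)
    have e: "(a, x) \<in> E" "(x, b) \<in> E" "(b, y) \<in> E" "(y, a) \<in> E" "distinct [a, x, b, y]"
      using c by (auto simp: cyc_def)
    have sub: "{a, x, b, y} \<subseteq> S" using in_S e by blast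
    have "card {a, x, b, y} < card S" using card e(5) by simp
    then obtain v0 where "v0 \<in> S" "v0 \<notin> {a, x, b, y}" using finite_card_ex[of "{a, x, b, y}" S] by blast
    then obtain s v where sv: "s \<in> {a, x, b, y}" "v \<in> S - {a, x, b, y}" "(s, v) \<in> E"
      using leaving_edge[of "{a, x, b, y}" a v0] sub by blast
    \<comment> \<open>Rotation brings the vertex with an outside neighbour to the front.\<close>
    have "cyc E [x, b, y, a]" "cyc E [b, y, a, x]" "cyc E [y, a, x, b]" using c by (auto simp: cyc_def)
    then show ?thesis using c sv by blast
  qed
  then obtain a x b y v where c: "cyc E [a, x, b, y]" and v: "v \<notin> {a, x, b, y}" "(a, v) \<in> E" by blast
  have vb: "(v, b) \<in> E" using four_cycle_opposite[OF c v] .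
  define N where "N = {w \<in> S - {a, b}. (w, a) \<in> E \<and> (w, b) \<in> E}"
  have e: "(a, x) \<in> E" "(x, b) \<in> E" "(b, y) \<in> E" "(y, a) \<in> E" "distinct [a, x, b, y]"
    using c by (auto simp: cyc_def)
  have ab: "a \<in> S" "b \<in> S" "a \<noteq> b" using e in_S by auto
  have N3: "x \<in> N" "y \<in> N" "v \<in> N" "x \<noteq> y" "v \<noteq> x" "v \<noteq> y"
    using e v vb sym_E in_S by (auto simp: N_def)
  have two: "\<exists>n m. n \<in> N \<and> m \<in> N \<and> n \<noteq> m \<and> n \<noteq> z \<and> m \<noteq> z" for z using N3 by metis
  have one: "\<exists>k. k \<in> N \<and> k \<noteq> p \<and> k \<noteq> q" for p q using N3 by metis
  have nN: "n \<in> S" "n \<noteq> a" "n \<noteq> b" "(n, a) \<in> E" "(n, b) \<in> E" "(a, n) \<in> E" "(b, n) \<in> E" if "n \<in> N" for n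
    using that sym_E by (auto simp: N_def)
  have "edge_closed E S (N \<union> {a, b})"
  proof (rule edge_closedI)
    show "N \<union> {a, b} \<subseteq> S" using ab by (auto simp: N_def)
    fix w z assume w: "w \<in> N \<union> {a, b}" and z: "z \<in> S" "(w, z) \<in> E"
    show "z \<in> N \<union> {a, b}"
    proof (rule ccontr)
      assume zN: "z \<notin> N \<union> {a, b}"
      consider "w = a" | "w = b" | "w \<in> N" using w by blast
      then show False
      proof cases
        case 1
        obtain n m where nm: "n \<in> N" "m \<in> N" "n \<noteq> m" using two by blast
        have "cyc E [a, n, b, m]" using nm nN ab by (auto simp: cyc_def)
        from four_cycle_opposite[OF this, of z] have "(z, b) \<in> E" using z zN nm 1 by auto
        then show False using zN z 1 sym_E in_S by (auto simp: N_def)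
      next
        case 2
        obtain n m where nm: "n \<in> N" "m \<in> N" "n \<noteq> m" using two by blast
        have "cyc E [b, n, a, m]" using nm nN ab by (auto simp: cyc_def)
        from four_cycle_opposite[OF this, of z] have "(z, a) \<in> E" using z zN nm 2 by auto
        then show False using zN z 2 sym_E in_S by (auto simp: N_def)
      next
        case 3
        obtain m where m: "m \<in> N" "m \<noteq> w" using two by blast
        obtain k where k: "k \<in> N" "k \<noteq> w" "k \<noteq> m" using one by blast
        have "cyc E [w, a, m, b]" using 3 m nN ab by (auto simp: cyc_def)
        from four_cycle_opposite[OF this, of z] have "(z, m) \<in> E" using z zN m 3 by auto
        then have "cyc E [a, w, z, m, b, k]"
          using 3 m k nN ab z zN by (auto simp: cyc_def)
        from len[OF this] show False by simp
      qed
    qed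
  qed
  then have S: "S = N \<union> {a, b}" using connD[OF con_S, of "N \<union> {a, b}" a] ab by (auto simp: N_def)
  have ind: "(w, z) \<notin> E" if "w \<in> N" "z \<in> N" for w z
  proof
    assume wz: "(w, z) \<in> E"
    obtain k where k: "k \<in> N" "k \<noteq> w" "k \<noteq> z" using one by blast
    have "cyc E [a, w, z, b, k]" using k that nN ab wz in_S[OF wz] by (auto simp: cyc_def)
    from len[OF this] show False by simp
  qed
  have aa: "(a, a) \<notin> E" "(b, b) \<notin> E" using in_S by blast+
  have NS: "S - {a, b} = N" using S N_def by auto
  have sub: "p \<in> {a, b} \<and> q \<in> N \<or> p \<in> N \<and> q \<in> {a, b} \<or> p = a \<and> q = b \<or> p = b \<and> q = a"
    if "(p, q) \<in> E" for p q
  proof -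
    have "p \<in> N \<union> {a, b}" "q \<in> N \<union> {a, b}" "p \<noteq> q" using in_S[OF that] S by blast+
    then show ?thesis using ind[of p q] that by blast
  qed
  have sup: "k2 a b S \<subseteq> E" unfolding k2_def NS using nN by blast
  have "E = k2 a b S \<or> E = k2_edge a b S"
  proof (cases "(a, b) \<in> E")
    case True
    have "E \<subseteq> k2_edge a b S" unfolding k2_edge_def k2_def NS using sub by fast
    then show ?thesis using True sym_E[OF True] sup unfolding k2_edge_def by blast
  next
    case False
    then have "(b, a) \<notin> E" using sym_E by blast
    then have "E \<subseteq> k2 a b S" unfolding k2_def NS using sub False by fast
    then show ?thesis using sup by blast
  qed
  then show thesis using that ab by blast
qed

text \<open>Otherwise \<open>w\<close> would separate \<open>v\<close> from the remaining
  vertices.\<close>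

lemma block_two_neighbours:
  assumes "3 \<le> card S" "v \<in> S" "w \<in> S" "w \<noteq> v"
  shows "\<exists>u\<in>S. u \<noteq> w \<and> (v, u) \<in> E"
proof (rule ccontr)
  assume a: "\<not> ?thesis"
  have "edge_closed E (S - {w}) {v}"
    by (rule edge_closedI) (use a assms in auto)
  then have "S - {w} \<subseteq> {v}" using connD[OF con_Diff[OF assms(3)], of "{v}" v] by blast
  then have "S \<subseteq> {v, w}" by blast
  then have "card S \<le> card {v, w}" by (intro card_mono) auto
  then show False using assms by (simp add: card_insert_if split: if_splits)
qed

end

section \<open>Converse constructions and small blocks\<close>

lemma conn_star:
  assumes "c \<in> T" "\<And>v. v \<in> T \<Longrightarrow> v \<noteq> c \<Longrightarrow> (c, v) \<in> E \<and> (v, c) \<in> E"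
  shows "conn E T"
proof (rule connI)
  fix X x assume X: "edge_closed E T X" "x \<in> X"
  then have "c \<in> X" using assms by (cases "x = c") (auto simp: edge_closed_def)
  then show "T \<subseteq> X" using assms X by (auto simp: edge_closed_def)
qed (use assms in auto)

text \<open>The two vertices \<open>a\<close> and \<open>b\<close> cover all edges, but covering the
  edges of a cycle of length at least 5 takes three vertices.\<close>

lemma k2_not_longcyc: "a \<noteq> b \<Longrightarrow> \<not> longcyc (k2_edge a b S)"
proof
  assume ab: "a \<noteq> b" and "longcyc (k2_edge a b S)"
  then obtain xs where xs: "cyc (k2_edge a b S) xs" "5 \<le> length xs" by (auto simp: longcyc_def)
  then obtain p0 p1 p2 p3 p4 ps where x: "xs = p0 # p1 # p2 # p3 # p4 # ps"
    by (auto simp: numeral_eq_Suc Suc_le_length_iff)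
  have hit: "p = a \<or> p = b \<or> q = a \<or> q = b" if "(p, q) \<in> k2_edge a b S" for p q
    using that by (auto simp: k2_edge_def k2_def)
  have d: "distinct (p0 # p1 # p2 # p3 # p4 # ps)" using xs x by (simp add: cyc_def)
  have h: "p0 \<in> {a, b} \<or> p1 \<in> {a, b}" "p1 \<in> {a, b} \<or> p2 \<in> {a, b}" "p2 \<in> {a, b} \<or> p3 \<in> {a, b}"
    "p3 \<in> {a, b} \<or> p4 \<in> {a, b}" "last (p4 # ps) \<in> {a, b} \<or> p0 \<in> {a, b}"
    using xs hit[of p0 p1] hit[of p1 p2] hit[of p2 p3] hit[of p3 p4] hit[of "last (p4 # ps)" p0]
    by (auto simp: cyc_def x)
  have l: "last (p4 # ps) \<in> set (p4 # ps)" by (rule last_in_set) simp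
  have "last (p4 # ps) \<notin> {p0, p1, p2, p3}" using d l by (auto simp del: last.simps)
  then show False using h d by (auto simp del: last.simps)
qed

lemma k2_conn:
  assumes "a \<in> T" "b \<in> T" "a \<noteq> b" "c \<in> T" "c \<noteq> a" "c \<noteq> b" "T \<subseteq> S"
  shows "conn (k2 a b S) T"
proof -
  have "conn (k2 a b S) (T - {b})"
    by (rule conn_star[of a]) (use assms in \<open>auto simp: k2_def\<close>)
  moreover have "conn (k2 a b S) (T - {a})"
    by (rule conn_star[of b]) (use assms in \<open>auto simp: k2_def\<close>)
  ultimately have "conn (k2 a b S) ((T - {b}) \<union> (T - {a}))" by (rule conn_Un[of _ _ _ c]) (use assms in auto)
  moreover have "(T - {b}) \<union> (T - {a}) = T" using assms by auto
  ultimately show ?thesis by simp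
qed

lemma cyc_length_le: "cyc E xs \<Longrightarrow> E \<subseteq> S \<times> S \<Longrightarrow> finite S \<Longrightarrow> length xs \<le> card S"
  using cyc_Field[of E xs S] card_mono[of S "set xs"] distinct_card[of xs] by (simp add: cyc_def)

lemma not_longcyc_small: "E \<in> edge_graphs S \<Longrightarrow> finite S \<Longrightarrow> card S < 5 \<Longrightarrow> \<not> longcyc E"
proof
  assume E: "E \<in> edge_graphs S" and S: "finite S" "card S < 5" and "longcyc E"
  then obtain xs where xs: "cyc E xs" "5 \<le> length xs" by (auto simp: longcyc_def)
  have "E \<subseteq> S \<times> S" using E by (simp add: edge_graphs_def)
  then have "length xs \<le> card S" by (rule cyc_length_le[OF xs(1) _ S(1)])
  then show False using xs S by linarith
qed

text \<open>After deleting one vertex, two or three remain and each still has a neighbour among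
  them, which forces connectivity. The resulting local test can be evaluated by enumeration.\<close>

lemma small_block_graphs:
  assumes S: "finite S" "card S = 3 \<or> card S = 4"
  shows "block_graphs S = {E \<in> edge_graphs S. \<forall>v\<in>S. \<forall>w\<in>S. w \<noteq> v \<longrightarrow> (\<exists>u\<in>S. u \<noteq> w \<and> (v, u) \<in> E)}"
    (is "_ = ?R")
proof
  show "block_graphs S \<subseteq> ?R"
    using block_two_neighbours[of _ S] S by (auto simp: block_graphs_def conn_graphs_def)
  show "?R \<subseteq> block_graphs S"
  proof
    fix E assume E: "E \<in> ?R"
    have sy: "(q, p) \<in> E" "p \<noteq> q" if "(p, q) \<in> E" for p q
      using E that by (auto simp: edge_graphs_def irrefl_def dest: symD)
    have nb: "\<exists>u\<in>S. u \<noteq> w \<and> (v, u) \<in> E" if "v \<in> S" "w \<in> S" "w \<noteq> v" for v w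
      using E that by auto
    have cD: "conn E (S - {x})" if x: "x \<in> S" for x
    proof (rule connI)
      have cx: "card (S - {x}) \<le> 3" "0 < card (S - {x})" using S x by auto
      then show "S - {x} \<noteq> {}" by force
      fix T y assume T: "edge_closed E (S - {x}) T" "y \<in> T"
      have y: "y \<in> S - {x}" using T by (auto simp: edge_closed_def)
      then obtain u where u: "u \<in> S" "u \<noteq> x" "(y, u) \<in> E" using nb[of y x] x by auto
      then have uT: "u \<in> T" "u \<noteq> y" using T sy by (auto simp: edge_closed_def)
      show "S - {x} \<subseteq> T"
      proof
        fix z assume z: "z \<in> S - {x}"
        show "z \<in> T"
        proof (rule ccontr)
          assume zT: "z \<notin> T"
          then have d: "z \<noteq> y" "z \<noteq> u" using T uT by auto
          have eq: "{y, u, z} = S - {x}"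
            by (rule card_subset_eq) (use S y u z cx d uT card_mono[of "S - {x}" "{y, u, z}"] in auto)
          obtain u' where u': "u' \<in> S" "u' \<noteq> x" "(z, u') \<in> E" using nb[of z x] x z by auto
          then have "u' \<in> {y, u, z}" unfolding eq by simp
          then have "u' \<in> T" "(u', z) \<in> E" using sy[OF u'(3)] uT T(2) by auto
          then show False using T z zT by (auto simp: edge_closed_def)
        qed
      qed
    qed
    obtain x where x: "x \<in> S" using S by fastforce
    have "card {x} < card S" using S by auto
    then obtain y where y: "y \<in> S" "y \<notin> {x}" using finite_card_ex[of "{x}" S] by blast
    have "card {x, y} < card S" using S y by auto
    then obtain z where z: "z \<in> S" "z \<notin> {x, y}" using finite_card_ex[of "{x, y}" S] by blast
    have "conn E ((S - {x}) \<union> (S - {y}))" using conn_Un[OF cD[OF x] cD[OF y(1)], of z] z by blast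
    moreover have "(S - {x}) \<union> (S - {y}) = S" using y by auto
    ultimately have "conn E S" by simp
    then show "E \<in> block_graphs S"
      using E cD S not_longcyc_small[of E S] by (auto simp: block_graphs_def conn_graphs_def)
  qed
qed

text \<open>Blocks of every size have diameter at most 2, so adjacency alone determines the
  distances.\<close>

lemma block_common_neighbour:
  assumes E: "E \<in> block_graphs S" "finite S" and uv: "u \<in> S" "v \<in> S" "u \<noteq> v" "(u, v) \<notin> E"
  shows "\<exists>w. (u, w) \<in> E \<and> (w, v) \<in> E"
proof -
  have vu: "(v, u) \<notin> E" using sym_E[OF E(1)] uv by blast
  consider "card S = 2" | "card S = 3 \<or> card S = 4" | "5 \<le> card S"
    using card_S[OF E(1)] by linarith
  then show ?thesis
  proof cases
    case 1
    then have "{u, v} = S" using uv E by (intro card_subset_eq) auto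
    moreover obtain w where "w \<in> S - {u}" "(u, w) \<in> E" using leaving_edge[OF E(1), of "{u}" u v] uv by blast
    ultimately show ?thesis using uv by auto
  next
    case 2
    then have c3: "3 \<le> card S" by auto
    obtain p where p: "p \<in> S" "p \<noteq> v" "(u, p) \<in> E" using block_two_neighbours[OF E(1) c3, of u v] uv by blast
    have pu: "p \<noteq> u" using in_S[OF E(1) p(3)] by blast
    obtain p' where p': "p' \<in> S" "p' \<noteq> u" "(v, p') \<in> E" using block_two_neighbours[OF E(1) c3, of v u] uv by blast
    have pv': "p' \<noteq> v" using in_S[OF E(1) p'(3)] by blast
    show ?thesis
    proof (cases "p = p'")
      case True
      then show ?thesis using p p' sym_E[OF E(1)] by blast
    next
      case False
      then have S4: "{u, v, p, p'} = S"
        by (intro card_seteq) (use E uv p p' pu pv' 2 in auto)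
      \<comment> \<open>With \<open>p\<close> and \<open>p'\<close> different there are exactly four
        vertices, and a second neighbour of \<open>u\<close> can only be \<open>p'\<close>.\<close>
      obtain q where q: "q \<in> S" "q \<noteq> p" "(u, q) \<in> E" using block_two_neighbours[OF E(1) c3, of u p] p pu uv by blast
      then have "q \<noteq> u" "q \<noteq> v" "q \<in> {u, v, p, p'}" using S4 uv in_S[OF E(1) q(3)] by auto
      then have "q = p'" using q by simp
      then show ?thesis using q p' sym_E[OF E(1)] by blast
    qed
  next
    case 3
    then obtain a b where ab: "a \<in> S" "b \<in> S" "a \<noteq> b" "E = k2 a b S \<or> E = k2_edge a b S"
      by (rule block_is_k2[OF E(1)])
    obtain c where c: "c \<in> S" "c \<notin> {a, b}" using finite_card_ex[of "{a, b}" S] 3 ab by auto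
    have sub: "k2 a b S \<subseteq> E" using ab by (auto simp: k2_edge_def)
    consider "u \<in> {a, b}" "v \<in> {a, b}" | "u \<notin> {a, b}" "v \<notin> {a, b}" | "u \<in> {a, b} \<longleftrightarrow> v \<notin> {a, b}" by blast
    then show ?thesis
    proof cases
      case 1
      then have "(u, c) \<in> k2 a b S" "(c, v) \<in> k2 a b S" using c by (auto simp: k2_def)
      then show ?thesis using sub by blast
    next
      case 2
      then have "(u, a) \<in> k2 a b S" "(a, v) \<in> k2 a b S" using uv by (auto simp: k2_def)
      then show ?thesis using sub by blast
    next
      case 3
      then have "(u, v) \<in> k2 a b S" using uv by (auto simp: k2_def)
      then show ?thesis using sub uv by blast
    qed
  qed
qed

text \<open>On three vertices \<open>k2\<close> would be a path with a cutvertex in the middle,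
  hence the bound 4.\<close>

lemma k2_block_graphs:
  assumes S: "finite S" "4 \<le> card S" "a \<in> S" "b \<in> S" "a \<noteq> b"
  shows "k2 a b S \<in> block_graphs S" "k2_edge a b S \<in> block_graphs S"
proof -
  have sub: "k2 a b S \<subseteq> k2_edge a b S" by (auto simp: k2_edge_def)
  have g: "k2_edge a b S \<in> edge_graphs S" "k2 a b S \<in> edge_graphs S"
    using S by (auto simp: edge_graphs_def k2_edge_def k2_def sym_def irrefl_def)
  have "card {a, b} < card S" using S by simp
  then obtain c where c: "c \<in> S" "c \<notin> {a, b}" using finite_card_ex[of "{a, b}" S] by blast
  have "conn (k2 a b S) S" by (rule k2_conn[of a _ b c]) (use S c in auto)
  moreover have "conn (k2 a b S) (S - {x})" if x: "x \<in> S" for x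
  proof -
    consider "x = a" | "x = b" | "x \<noteq> a" "x \<noteq> b" by blast
    then show ?thesis
    proof cases
      case 1
      show ?thesis by (rule conn_star[of b]) (use S 1 in \<open>auto simp: k2_def\<close>)
    next
      case 2
      show ?thesis by (rule conn_star[of a]) (use S 2 in \<open>auto simp: k2_def\<close>)
    next
      case 3
      have "card {a, b, x} < card S" using S 3 by simp
      then obtain d where d: "d \<in> S" "d \<notin> {a, b, x}" using finite_card_ex[of "{a, b, x}" S] by blast
      show ?thesis by (rule k2_conn[of a _ b d]) (use S d 3 in auto)
    qed
  qed
  ultimately show "k2 a b S \<in> block_graphs S" "k2_edge a b S \<in> block_graphs S"
    using g S k2_not_longcyc[OF S(5), of S] longcyc_mono[OF _ sub] conn_mono[OF _ sub]
    by (auto simp: block_graphs_def conn_graphs_def)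
qed

text \<open>An unordered pair together with the choice whether to join it is encoded as an ordered pair.\<close>

definition k2_of :: "nat set \<Rightarrow> nat \<times> nat \<Rightarrow> (nat \<times> nat) set" where
  "k2_of S p = (if fst p < snd p then k2 (fst p) (snd p) S else k2_edge (fst p) (snd p) S)"

lemma k2_commute: "k2 a b S = k2 b a S" "k2_edge a b S = k2_edge b a S"
  by (auto simp: k2_def k2_edge_def)

text \<open>A vertex of the small side is adjacent to the entire large side, while any vertex
  outside \<open>{a, b}\<close> has no neighbours but \<open>a\<close> and \<open>b\<close>. Five
  vertices leave one outside both pairs to tell the two apart.\<close>

lemma k2_pair_unique:
  assumes "5 \<le> card S" "a \<in> S" "b \<in> S" "a' \<in> S" "b' \<in> S" "a \<noteq> b" "a' \<noteq> b'"
    "k2 a b S \<subseteq> E" "E \<subseteq> k2_edge a b S" "k2 a' b' S \<subseteq> E" "E \<subseteq> k2_edge a' b' S"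
  shows "{a, b} = {a', b'}"
proof -
  have "x \<in> {a, b}" if "x \<in> {a', b'}" for x
  proof (rule ccontr)
    assume x: "x \<notin> {a, b}"
    have "card {a', b', a, b} < card S"
      using assms(1) card_insert_le_m1[of 4 "{b', a, b}" a'] card_insert_le_m1[of 3 "{a, b}" b'] assms by auto
    then obtain v where v: "v \<in> S" "v \<notin> {a', b', a, b}" using finite_card_ex[of "{a', b', a, b}" S] by blast
    have "(x, v) \<in> k2 a' b' S" using that v by (auto simp: k2_def)
    then have "(x, v) \<in> k2_edge a b S" using assms by blast
    then show False using x v by (auto simp: k2_edge_def k2_def)
  qed
  then show ?thesis using assms by auto
qed

text \<open>For five or more vertices the graph determines the unordered pair; whether its two
  vertices are adjacent then determines the order.\<close>

lemma bij_betw_k2_of: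
  assumes S: "finite S" "5 \<le> card S"
  shows "bij_betw (k2_of S) {(a, b) \<in> S \<times> S. a \<noteq> b} (block_graphs S)"
  unfolding bij_betw_def
proof (intro conjI subset_antisym)
  have k: "k2 a b S \<subseteq> k2_of S (a, b)" "k2_of S (a, b) \<subseteq> k2_edge a b S" for a b
    by (auto simp: k2_of_def k2_edge_def)
  have ab: "(a, b) \<in> k2_of S (a, b) \<longleftrightarrow> b < a" if "a \<noteq> b" for a b
    using that by (auto simp: k2_of_def k2_edge_def k2_def)
  have ba: "(b, a) \<in> k2_of S (a, b) \<longleftrightarrow> b < a" if "a \<noteq> b" for a b
    using that by (auto simp: k2_of_def k2_edge_def k2_def)
  show "inj_on (k2_of S) {(a, b) \<in> S \<times> S. a \<noteq> b}"
  proof (rule inj_onI, clarify)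
    fix a b a' b' assume m: "a \<in> S" "b \<in> S" "a \<noteq> b" "a' \<in> S" "b' \<in> S" "a' \<noteq> b'"
      and e: "k2_of S (a, b) = k2_of S (a', b')"
    have "{a, b} = {a', b'}"
      by (rule k2_pair_unique[OF S(2), where E = "k2_of S (a, b)"]) (use m k[of a b] k[of a' b'] e in auto)
    then have "a = a' \<and> b = b' \<or> a = b' \<and> b = a'" using m by auto
    then show "a = a' \<and> b = b'"
      using ab[of a b] ba[of a' b'] e m by (metis linorder_neqE_nat not_less_iff_gr_or_eq)
  qed
  show "k2_of S ` {(a, b) \<in> S \<times> S. a \<noteq> b} \<subseteq> block_graphs S"
    using k2_block_graphs[OF S(1)] S by (auto simp: k2_of_def)
  show "block_graphs S \<subseteq> k2_of S ` {(a, b) \<in> S \<times> S. a \<noteq> b}"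
  proof
    fix E assume "E \<in> block_graphs S"
    then obtain a b where ab: "a \<in> S" "b \<in> S" "a \<noteq> b" "E = k2 a b S \<or> E = k2_edge a b S"
      by (rule block_is_k2[OF _ S(2)])
    have "E = k2_of S (a, b) \<or> E = k2_of S (b, a)"
    proof (cases "a < b")
      case True
      then show ?thesis using ab(4) k2_commute(2)[of a b S] by (simp add: k2_of_def)
    next
      case False
      then have "b < a" using ab(3) by simp
      then show ?thesis using ab(4) k2_commute(1)[of a b S] by (auto simp: k2_of_def)
    qed
    then show "E \<in> k2_of S ` {(a, b) \<in> S \<times> S. a \<noteq> b}"
      using ab(1-3) by auto
  qed
qed

section \<open>Counting blocks and the degrees of the vertex 0\<close>

lemma card_distinct_pairs: "finite S \<Longrightarrow> card {(a, b) \<in> S \<times> S. a \<noteq> b} = card S * (card S - 1)"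
proof -
  assume S: "finite S"
  have "{(a, b) \<in> S \<times> S. a \<noteq> b} = (SIGMA a:S. S - {a})" by auto
  then show ?thesis using S by (simp add: card_SigmaI)
qed

lemma block_num_large: "5 \<le> n \<Longrightarrow> block_num n = n * (n - 1)"
  unfolding block_num_def
  using bij_betw_same_card[OF bij_betw_k2_of[of "{1..n}"]] card_distinct_pairs[of "{1..n}"] by simp

text \<open>The number of objects of size \<open>m\<close> whose root is adjacent to
  \<open>0\<close>, that is, at distance 1.\<close>

definition degree_sum :: "nat \<Rightarrow> nat" where
  "degree_sum m = (\<Sum>E\<in>block_graphs {0..m}. card {v. (0, v) \<in> E})"

text \<open>With \<open>0\<close> on the small side, the \<open>m\<close> unjoined graphs give
  degree \<open>m - 1\<close> and the \<open>m\<close> joined ones degree \<open>m\<close>; the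
  other \<open>m * (m - 1)\<close> ordered pairs give degree 2.\<close>

lemma degree_sum_large:
  assumes m: "4 \<le> m"
  shows "real (degree_sum m) = 4 * real m ^ 2 - 3 * real m"
proof -
  let ?S = "{0..m}" let ?P = "{(a, b) \<in> ?S \<times> ?S. a \<noteq> b}"
  define d where "d = (\<lambda>p. real (card {v. (0, v) \<in> k2_of ?S p}))"
  have "degree_sum m = (\<Sum>p\<in>?P. card {v. (0, v) \<in> k2_of ?S p})"
    unfolding degree_sum_def using sum.reindex_bij_betw[OF bij_betw_k2_of[of ?S], of "\<lambda>E. card {v. (0, v) \<in> E}"] m
    by simp
  then have "real (degree_sum m) = (\<Sum>p\<in>?P. d p)" by (simp add: d_def)
  also have "?P = Pair 0 ` {1..m} \<union> (\<lambda>a. (a, 0)) ` {1..m} \<union> {(a, b) \<in> {1..m} \<times> {1..m}. a \<noteq> b}" by force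
  also have "(\<Sum>p\<in>\<dots>. d p) = (\<Sum>p\<in>Pair 0 ` {1..m}. d p) + (\<Sum>p\<in>(\<lambda>a. (a, 0)) ` {1..m}. d p) +
      (\<Sum>p\<in>{(a, b) \<in> {1..m} \<times> {1..m}. a \<noteq> b}. d p)"
    by (subst sum.union_disjoint; (subst sum.union_disjoint)?) (auto intro: finite_subset[of _ "{1..m} \<times> {1..m}"])
  also have "(\<Sum>p\<in>Pair 0 ` {1..m}. d p) = (\<Sum>b\<in>{1..m}. real (m - 1))"
  proof (subst sum.reindex)
    have "d (0, b) = real (m - 1)" if "b \<in> {1..m}" for b
    proof -
      have "{v. (0, v) \<in> k2_of ?S (0, b)} = {1..m} - {b}" using that by (auto simp: k2_of_def k2_def)
      then show ?thesis using that by (simp add: d_def)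
    qed
    then show "(\<Sum>b\<in>{1..m}. (d \<circ> Pair 0) b) = (\<Sum>b\<in>{1..m}. real (m - 1))" by simp
  qed (auto simp: inj_on_def)
  also have "(\<Sum>p\<in>(\<lambda>a. (a, 0)) ` {1..m}. d p) = (\<Sum>a\<in>{1..m}. real m)"
  proof (subst sum.reindex)
    have "d (a, 0) = real m" if "a \<in> {1..m}" for a
    proof -
      have "{v. (0, v) \<in> k2_of ?S (a, 0)} = {1..m}" using that by (auto simp: k2_of_def k2_def k2_edge_def)
      then show ?thesis by (simp add: d_def)
    qed
    then show "(\<Sum>a\<in>{1..m}. (d \<circ> (\<lambda>a. (a, 0))) a) = (\<Sum>a\<in>{1..m}. real m)" by simp
  qed (auto simp: inj_on_def)
  also have "(\<Sum>p\<in>{(a, b) \<in> {1..m} \<times> {1..m}. a \<noteq> b}. d p) = (\<Sum>p\<in>{(a, b) \<in> {1..m} \<times> {1..m}. a \<noteq> b}. 2)"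
  proof (rule sum.cong[OF refl], clarify)
    fix a b assume ab: "a \<in> {1..m}" "b \<in> {1..m}" "a \<noteq> b"
    then have "{v. (0, v) \<in> k2_of ?S (a, b)} = {a, b}" by (auto simp: k2_of_def k2_def k2_edge_def)
    then show "d (a, b) = 2" using ab by (simp add: d_def)
  qed
  finally show ?thesis
    using card_distinct_pairs[of "{1..m}"] m by (simp add: of_nat_diff algebra_simps power2_eq_square)
qed

section \<open>Blocks on four vertices by enumeration\<close>

definition und :: "(nat \<times> nat) set \<Rightarrow> (nat \<times> nat) set" where "und P = P \<union> P\<inverse>"

text \<open>The criterion of \<open>small_block_graphs\<close> with explicit vertices. Accepting
  either orientation lets it be evaluated on \<open>P\<close> directly instead of on
  \<open>und P\<close>.\<close>

definition min_deg2 :: "(nat \<times> nat) set \<Rightarrow> bool" where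
  "min_deg2 P \<longleftrightarrow> (\<forall>v\<in>{0, 1, 2, 3}. \<forall>w\<in>{0, 1, 2, 3}. w \<noteq> v \<longrightarrow>
    (\<exists>u\<in>{0, 1, 2, 3}. u \<noteq> w \<and> ((v, u) \<in> P \<or> (u, v) \<in> P)))"

text \<open>Each possible edge is listed once, smaller end first, so only 64 candidates have to be
  tested.\<close>

definition six_pairs :: "(nat \<times> nat) set" where
  "six_pairs = {(0, 1), (0, 2), (0, 3), (1, 2), (1, 3), (2, 3)}"

lemma atLeast0_3: "{0..3::nat} = {0, 1, 2, 3}" by auto

lemma bij_betw_und: "bij_betw und ({P \<in> Pow six_pairs. min_deg2 P}) (block_graphs {0..3})"
proof -
  have lt: "P = {(u, v) \<in> und P. u < v}" if "P \<subseteq> six_pairs" for P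
    using that by (fastforce simp: und_def six_pairs_def)
  have blk: "block_graphs {0..3} = {E \<in> edge_graphs {0..3}. min_deg2 E}"
  proof -
    have "min_deg2 E \<longleftrightarrow> (\<forall>v\<in>{0..3}. \<forall>w\<in>{0..3}. w \<noteq> v \<longrightarrow> (\<exists>u\<in>{0..3}. u \<noteq> w \<and> (v, u) \<in> E))"
      if "E \<in> edge_graphs {0..3}" for E
    proof -
      have "((v, u) \<in> E \<or> (u, v) \<in> E) = ((v, u) \<in> E)" for u v
        using that by (auto simp: edge_graphs_def dest: symD)
      then show ?thesis unfolding min_deg2_def atLeast0_3 by (simp only:)
    qed
    moreover have "block_graphs {0..3::nat} = {E \<in> edge_graphs {0..3}.
        \<forall>v\<in>{0..3}. \<forall>w\<in>{0..3}. w \<noteq> v \<longrightarrow> (\<exists>u\<in>{0..3}. u \<noteq> w \<and> (v, u) \<in> E)}"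
      by (rule small_block_graphs) auto
    ultimately show ?thesis by blast
  qed
  have md: "min_deg2 (und P) \<longleftrightarrow> min_deg2 P" for P by (simp add: min_deg2_def und_def disj_commute)
  show ?thesis
    unfolding bij_betw_def
  proof (intro conjI subset_antisym)
    show "inj_on und ({P \<in> Pow six_pairs. min_deg2 P})"
    proof (rule inj_onI)
      fix P Q assume "P \<in> {P \<in> Pow six_pairs. min_deg2 P}" "Q \<in> {P \<in> Pow six_pairs. min_deg2 P}" "und P = und Q"
      then show "P = Q" using lt[of P] lt[of Q] by simp
    qed
    show "und ` {P \<in> Pow six_pairs. min_deg2 P} \<subseteq> block_graphs {0..3}"
    proof
      fix E assume "E \<in> und ` {P \<in> Pow six_pairs. min_deg2 P}"
      then obtain P where P: "P \<subseteq> six_pairs" "min_deg2 P" "E = und P" by auto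
      have "six_pairs \<subseteq> {0..3} \<times> {0..3}" "\<And>u v. (u, v) \<in> six_pairs \<Longrightarrow> u \<noteq> v" by (auto simp: six_pairs_def)
      then have "und P \<in> edge_graphs {0..3}" using P(1)
        unfolding edge_graphs_def und_def sym_def irrefl_def by blast
      then show "E \<in> block_graphs {0..3}" using P md blk by simp
    qed
    show "block_graphs {0..3} \<subseteq> und ` {P \<in> Pow six_pairs. min_deg2 P}"
    proof
      fix E :: "(nat \<times> nat) set" assume "E \<in> block_graphs {0..3}"
      then have E: "E \<in> edge_graphs {0..3}" "min_deg2 E" using blk by auto
      define P where "P = {(u, v) \<in> E. u < v}"
      have "und P = E"
      proof -
        have sy: "(v, u) \<in> E" "u \<noteq> v" if "(u, v) \<in> E" for u v
          using E that by (auto simp: edge_graphs_def irrefl_def dest: symD)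
        have "(u, v) \<in> und P" if "(u, v) \<in> E" for u v
          using sy[OF that] that by (cases "u < v") (auto simp: P_def und_def)
        moreover have "(u, v) \<in> E" if "(u, v) \<in> und P" for u v
          using that sy by (auto simp: P_def und_def)
        ultimately show ?thesis by auto
      qed
      moreover have "P \<subseteq> six_pairs"
      proof
        fix e assume e: "e \<in> P"
        obtain u v where uv: "e = (u, v)" by (cases e)
        have "(u, v) \<in> E" "u < v" using e uv by (auto simp: P_def)
        moreover have "E \<subseteq> {0..3} \<times> {0..3}" using E(1) by (simp add: edge_graphs_def)
        ultimately have "u \<in> {0, 1, 2, 3}" "v \<in> {0, 1, 2, 3}" "u < v" unfolding atLeast0_3 by blast+
        then show "e \<in> six_pairs" unfolding uv by (auto simp: six_pairs_def)
      qed
      ultimately have "E = und P" "P \<in> {P \<in> Pow six_pairs. min_deg2 P}"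
        using E(2) md[of P] by simp_all
      then show "E \<in> und ` {P \<in> Pow six_pairs. min_deg2 P}" by (rule image_eqI)
    qed
  qed
qed

text \<open>Three 4-cycles, six complete graphs with one edge removed, and the complete
  graph.\<close>

lemma card_min_deg2: "card ({P \<in> Pow six_pairs. min_deg2 P}) = 10"
  by code_simp

text \<open>The ten graphs have 3 * 4 + 6 * 5 + 6 = 48 edges in total; by symmetry the vertex 0
  receives a quarter of the degree total 96.\<close>

lemma sum_min_deg2: "(\<Sum>P\<in>{P \<in> Pow six_pairs. min_deg2 P}. card ({e \<in> P. fst e = 0})) = 24"
  by code_simp

lemma block_num_4: "block_num 4 = 10"
proof -
  have "block_num 4 = card (block_graphs {0..3::nat})" by (subst card_block_graphs) auto
  then show ?thesis using bij_betw_same_card[OF bij_betw_und] card_min_deg2 by simp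
qed

lemma degree_sum_3: "degree_sum 3 = 24"
proof -
  have "degree_sum 3 = (\<Sum>P\<in>{P \<in> Pow six_pairs. min_deg2 P}. card {v. (0, v) \<in> und P})"
    unfolding degree_sum_def using sum.reindex_bij_betw[OF bij_betw_und, of "\<lambda>E. card {v. (0, v) \<in> E}"] by simp
  also have "\<dots> = (\<Sum>P\<in>{P \<in> Pow six_pairs. min_deg2 P}. card ({e \<in> P. fst e = 0}))"
  proof (rule sum.cong[OF refl])
    fix P assume "P \<in> {P \<in> Pow six_pairs. min_deg2 P}"
    then have P: "P \<subseteq> six_pairs" by simp
    \<comment> \<open>The smallest label always comes first, so the pairs starting with 0 are all
      the edges at 0.\<close>
    have "(v, 0) \<notin> P" for v using P by (auto simp: six_pairs_def)
    then have "bij_betw (Pair 0) {v. (0, v) \<in> und P} ({e \<in> P. fst e = 0})"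
      by (intro bij_betwI[where g = snd]) (auto simp: und_def)
    then show "card {v. (0, v) \<in> und P} = card ({e \<in> P. fst e = 0})"
      by (rule bij_betw_same_card)
  qed
  finally show ?thesis using sum_min_deg2 by simp
qed

lemma block_graphs_3: "block_graphs {0..2::nat} = {{(u, v). u \<in> {0..2} \<and> v \<in> {0..2} \<and> u \<noteq> v}}"
proof -
  let ?S = "{0..2::nat}" let ?K = "{(u, v). u \<in> ?S \<and> v \<in> ?S \<and> u \<noteq> v}"
  have S: "?S = {0, 1, 2}" by auto
  have "E = ?K" if "E \<in> block_graphs ?S" for E
  proof -
    have e: "E \<in> edge_graphs ?S" "\<And>v w. v \<in> ?S \<Longrightarrow> w \<in> ?S \<Longrightarrow> w \<noteq> v \<Longrightarrow> \<exists>u\<in>?S. u \<noteq> w \<and> (v, u) \<in> E"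
      using that block_two_neighbours[OF that] by (auto simp: block_graphs_def conn_graphs_def)
    have "(u, v) \<in> E" if uv: "u \<in> ?S" "v \<in> ?S" "u \<noteq> v" for u v
    proof -
      obtain t where t: "t \<in> ?S" "t \<noteq> u" and all: "\<forall>x\<in>?S. x = u \<or> x = v \<or> x = t"
      proof
        \<comment> \<open>The three labels sum to 3, so this is the remaining one; since
          \<open>u + v\<close> is at most 3, natural subtraction is exact.\<close>
        show "3 - u - v \<in> ?S" "3 - u - v \<noteq> u" "\<forall>x\<in>?S. x = u \<or> x = v \<or> x = 3 - u - v"
          using uv unfolding S by auto
      qed
      obtain x where x: "x \<in> ?S" "x \<noteq> t" "(u, x) \<in> E" using e(2)[OF uv(1) t] by blast
      have "x \<noteq> u" using e(1) x(3) by (auto simp: edge_graphs_def irrefl_def)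
      then have "x = v" using all x by blast
      then show ?thesis using x by simp
    qed
    then show ?thesis using e(1) by (auto simp: edge_graphs_def irrefl_def)
  qed
  moreover have "?K \<in> block_graphs ?S"
  proof -
    have "?K \<in> edge_graphs ?S" by (auto simp: edge_graphs_def sym_def irrefl_def)
    moreover have "\<exists>u\<in>?S. u \<noteq> w \<and> (v, u) \<in> ?K" if "v \<in> ?S" "w \<in> ?S" "w \<noteq> v" for v w
      using that unfolding S by (intro bexI[of _ "3 - v - w"]) auto
    moreover have "block_graphs ?S = {E \<in> edge_graphs ?S.
        \<forall>v\<in>?S. \<forall>w\<in>?S. w \<noteq> v \<longrightarrow> (\<exists>u\<in>?S. u \<noteq> w \<and> (v, u) \<in> E)}"
      by (rule small_block_graphs) auto
    ultimately show ?thesis by blast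
  qed
  ultimately show ?thesis by blast
qed

lemma block_num_3: "block_num 3 = 1"
proof -
  have "block_num 3 = card (block_graphs {0..2::nat})" by (subst card_block_graphs) auto
  then show ?thesis by (simp add: block_graphs_3)
qed

lemma degree_sum_2: "degree_sum 2 = 2"
proof -
  have "{v. v \<le> 2 \<and> (0::nat) \<noteq> v} = {1, 2}" by auto
  then show ?thesis by (simp add: degree_sum_def block_graphs_3)
qed

lemma block_graphs_2: "block_graphs {0..1::nat} = {{(0, 1), (1, 0)}}"
proof -
  let ?S = "{0..1::nat}"
  have S: "?S = {0, 1}" by auto
  have "E = {(0, 1), (1, 0)}" if E: "E \<in> block_graphs ?S" for E
  proof -
    have "0 \<in> ?S" "1 \<in> ?S" by auto
    then obtain w where "w \<in> ?S - {0}" "(0, w) \<in> E" using leaving_edge[OF E, of "{0}" 0 1] by auto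
    moreover from this have "w = 1" by auto
    ultimately have "(0, 1) \<in> E" by simp
    then show ?thesis using in_S[OF that] sym_E[OF that] unfolding S by auto
  qed
  moreover have "{(0, 1), (1, 0)} \<in> block_graphs ?S" (is "?E \<in> _")
  proof -
    have g: "?E \<in> edge_graphs ?S" by (auto simp: edge_graphs_def sym_def irrefl_def)
    moreover have "conn ?E ?S" by (rule conn_star[of 0]) auto
    moreover have "?S - {x} = {1 - x}" if "x \<in> ?S" for x using that unfolding S by auto
    ultimately show ?thesis using not_longcyc_small[OF g] by (auto simp: block_graphs_def conn_graphs_def)
  qed
  ultimately show ?thesis by blast
qed

lemma block_num_2: "block_num 2 = 1"
proof -
  have "block_num 2 = card (block_graphs {0..1::nat})"
    by (subst card_block_graphs) (auto simp: numeral_2_eq_2)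
  then show ?thesis unfolding block_graphs_2 by simp
qed

lemma degree_sum_1: "degree_sum 1 = 1"
  unfolding degree_sum_def block_graphs_2 by simp

subsection \<open>The dominant singularity\<close>

text \<open>
  With nonnegative coefficients, truncation is submultiplicative, and a product of truncations is
  bounded by a longer truncation of the product.  This evaluates \<open>R = z A(R)\<close> at every point where
  the partial sums of \<open>R\<close> are bounded, in particular on the boundary of the disc of convergence.
\<close>

definition psum :: "real fps \<Rightarrow> nat \<Rightarrow> real \<Rightarrow> real" where
  "psum f N x = (\<Sum>n\<le>N. fps_nth f n * x ^ n)"

definition nonneg_fps :: "real fps \<Rightarrow> bool" where
  "nonneg_fps f \<longleftrightarrow> (\<forall>n. 0 \<le> fps_nth f n)"

lemma nonneg_fps_mult: "nonneg_fps f \<Longrightarrow> nonneg_fps g \<Longrightarrow> nonneg_fps (f * g)"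
  by (auto simp: nonneg_fps_def fps_mult_nth intro!: sum_nonneg)

lemma nonneg_fps_power: "nonneg_fps f \<Longrightarrow> nonneg_fps (f ^ k)"
proof (induction k)
  case 0
  then show ?case by (simp add: nonneg_fps_def)
next
  case (Suc k)
  then show ?case by (simp add: nonneg_fps_mult)
qed

lemma psum_nonneg: "nonneg_fps f \<Longrightarrow> 0 \<le> x \<Longrightarrow> 0 \<le> psum f N x"
  by (auto simp: psum_def nonneg_fps_def intro!: sum_nonneg)

lemma psum_mono: "nonneg_fps f \<Longrightarrow> 0 \<le> x \<Longrightarrow> M \<le> N \<Longrightarrow> psum f M x \<le> psum f N x"
  unfolding psum_def nonneg_fps_def by (rule sum_mono2) auto

text \<open>A truncated product sums over a triangle, a product of truncations over a rectangle. For
  nonnegative terms, \<open>psum_mult_le\<close> and \<open>psum_mult_ge\<close> are inclusions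
  between these index sets.\<close>

lemma psum_Sigma:
  "psum (f * g) N x = (\<Sum>(i, j)\<in>{(i, j). i + j \<le> N}. (fps_nth f i * x ^ i) * (fps_nth g j * x ^ j))"
proof -
  have "psum (f * g) N x = (\<Sum>n\<le>N. \<Sum>i\<le>n. (fps_nth f i * x ^ i) * (fps_nth g (n - i) * x ^ (n - i)))"
    unfolding psum_def fps_mult_nth atMost_atLeast0 sum_distrib_right
    by (intro sum.cong refl) (simp add: power_add[symmetric] mult_ac flip: power_add)
  then show ?thesis by (simp add: sum.triangle_reindex_eq)
qed

lemma psum_product:
  "psum f N x * psum g M x = (\<Sum>(i, j)\<in>{..N} \<times> {..M}. (fps_nth f i * x ^ i) * (fps_nth g j * x ^ j))"
  by (simp add: psum_def sum_product sum.cartesian_product)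

lemma psum_mult_le:
  assumes "nonneg_fps f" "nonneg_fps g" "0 \<le> x"
  shows "psum (f * g) N x \<le> psum f N x * psum g N x"
  unfolding psum_Sigma psum_product
  by (rule sum_mono2) (use assms in \<open>auto simp: nonneg_fps_def\<close>)

lemma psum_mult_ge:
  assumes "nonneg_fps f" "nonneg_fps g" "0 \<le> x"
  shows "psum f N x * psum g M x \<le> psum (f * g) (N + M) x"
  unfolding psum_Sigma psum_product
proof (rule sum_mono2)
  show "finite {(i, j). i + j \<le> N + M}"
    by (rule finite_subset[of _ "{..N + M} \<times> {..N + M}"]) auto
qed (use assms in \<open>auto simp: nonneg_fps_def\<close>)

lemma psum_power_le:
  assumes "nonneg_fps f" "0 \<le> x"
  shows "psum (f ^ k) N x \<le> psum f N x ^ k"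
proof (induction k)
  case 0
  have "psum 1 N x = (\<Sum>n\<le>N. if n = 0 then 1 else 0)" unfolding psum_def by (rule sum.cong) auto
  then show ?case by simp
next
  case (Suc k)
  have "psum (f ^ Suc k) N x \<le> psum f N x * psum (f ^ k) N x"
    using psum_mult_le[OF assms(1) nonneg_fps_power[OF assms(1)] assms(2)] by simp
  also have "\<dots> \<le> psum f N x * psum f N x ^ k"
    by (rule mult_left_mono[OF Suc psum_nonneg[OF assms]])
  finally show ?case by simp
qed

lemma psum_power_ge:
  assumes "nonneg_fps f" "0 \<le> x"
  shows "psum f N x ^ k \<le> psum (f ^ k) (k * N) x"
proof (induction k)
  case 0
  then show ?case by (simp add: psum_def)
next
  case (Suc k)
  have "psum f N x ^ Suc k \<le> psum f N x * psum (f ^ k) (k * N) x"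
    using mult_left_mono[OF Suc psum_nonneg[OF assms]] by simp
  also have "\<dots> \<le> psum (f ^ Suc k) (Suc k * N) x"
    using psum_mult_ge[OF assms(1) nonneg_fps_power[OF assms(1)] assms(2)] by simp
  finally show ?case .
qed

lemma summable_psum_bound:
  assumes "nonneg_fps f" "0 \<le> x" "\<And>N. psum f N x \<le> c"
  shows "summable (\<lambda>n. fps_nth f n * x ^ n)"
proof (rule summableI_nonneg_bounded[where x = c])
  show "0 \<le> fps_nth f n * x ^ n" for n using assms by (simp add: nonneg_fps_def)
  show "(\<Sum>i<n. fps_nth f i * x ^ i) \<le> c" for n
  proof (cases n)
    case 0
    then show ?thesis using assms(3)[of 0] psum_nonneg[OF assms(1,2), of 0] by simp
  next
    case (Suc m)
    then show ?thesis using assms(3)[of m] by (simp add: psum_def lessThan_Suc_atMost)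
  qed
qed

lemma psum_tendsto:
  "summable (\<lambda>n. fps_nth f n * x ^ n) \<Longrightarrow> (\<lambda>N. psum f N x) \<longlonglongrightarrow> eval_fps f x"
  unfolding psum_def eval_fps_def by (rule summable_LIMSEQ')

lemma psum_le_eval:
  assumes "nonneg_fps f" "0 \<le> x" "summable (\<lambda>n. fps_nth f n * x ^ n)"
  shows "psum f N x \<le> eval_fps f x"
  unfolding psum_def eval_fps_def
  by (rule sum_le_suminf[OF assms(3)]) (use assms in \<open>auto simp: nonneg_fps_def\<close>)

lemma fps_entireI:
  assumes "nonneg_fps f" "\<And>x. 0 \<le> x \<Longrightarrow> summable (\<lambda>n. fps_nth f n * x ^ n)"
  shows "fps_conv_radius f = \<infinity>"
proof (rule ereal_top)
  fix x :: real
  have "ereal (max x 0) \<le> fps_conv_radius f"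
    using conv_radius_geI[OF assms(2)[of "max x 0"]] by (simp add: fps_conv_radius_def)
  moreover have "ereal x \<le> ereal (max x 0)" by simp
  ultimately show "ereal x \<le> fps_conv_radius f" by (rule order_trans[rotated])
qed

text \<open>Closed forms of \<open>B'\<close>, \<open>B''\<close> and \<open>B'''\<close>.\<close>

definition Bp :: "real \<Rightarrow> real" where
  "Bp z = z * (z + 2) * exp z - z * (15 * z + 2 * z ^ 2 + 6) / 6"

definition Bpp :: "real \<Rightarrow> real" where
  "Bpp z = (z ^ 2 + 4 * z + 2) * exp z - z ^ 2 - 5 * z - 1"

definition Bppp :: "real \<Rightarrow> real" where
  "Bppp z = (z ^ 2 + 6 * z + 6) * exp z - 2 * z - 5"

lemma Bp_deriv: "(Bp has_real_derivative Bpp z) (at z)"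
  unfolding Bp_def[abs_def] Bpp_def
  by (auto intro!: derivative_eq_intros simp: power2_eq_square field_simps)

lemma Bpp_deriv: "(Bpp has_real_derivative Bppp z) (at z)"
  unfolding Bpp_def[abs_def] Bppp_def
  by (auto intro!: derivative_eq_intros simp: power2_eq_square field_simps)

lemma Bppp_pos: "0 \<le> z \<Longrightarrow> 0 < Bppp z"
proof -
  assume z: "0 \<le> z"
  have "(z ^ 2 + 6 * z + 6) * 1 \<le> (z ^ 2 + 6 * z + 6) * exp z"
    by (rule mult_left_mono) (use z in auto)
  moreover have "2 * z + 5 < z ^ 2 + 6 * z + 6" using z zero_le_power2[of z] by linarith
  then have "2 * z + 5 < (z ^ 2 + 6 * z + 6) * 1" by simp
  ultimately have "2 * z + 5 < (z ^ 2 + 6 * z + 6) * exp z" by (rule less_le_trans[rotated])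
  then show ?thesis unfolding Bppp_def by linarith
qed

lemma Bpp_strict_mono: "0 \<le> u \<Longrightarrow> u < v \<Longrightarrow> Bpp u < Bpp v"
proof (rule DERIV_pos_imp_increasing[where f = Bpp])
  fix x assume "0 \<le> u" "u \<le> x"
  then have "0 < Bppp x" using Bppp_pos[of x] by linarith
  then show "\<exists>y. (Bpp has_real_derivative y) (at x) \<and> 0 < y" using Bpp_deriv by blast
qed

lemma Bpp_ge_1: "0 \<le> z \<Longrightarrow> 1 \<le> Bpp z"
  using Bpp_strict_mono[of 0 z] by (cases "z = 0") (auto simp: Bpp_def[of 0])

lemma Bp_mono: "0 \<le> u \<Longrightarrow> u \<le> v \<Longrightarrow> Bp u \<le> Bp v"
proof (rule DERIV_nonneg_imp_nondecreasing[where f = Bp])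
  fix x assume "0 \<le> u" "u \<le> x"
  then have "0 \<le> Bpp x" using Bpp_ge_1[of x] by linarith
  then show "\<exists>y. (Bp has_real_derivative y) (at x) \<and> 0 \<le> y" using Bp_deriv by blast
qed

lemma block_fps_nth: "fps_nth block_fps n = (if n = 0 then 1 else if n = 1 then 1 else if n = 2 then 5
    else real ((n + 2) * (n + 1)) / fact n)"
proof -
  consider "n = 0" | "n = 1" | "n = 2" | "3 \<le> n" by linarith
  then show ?thesis
  proof cases
    case 4
    then show ?thesis using block_num_large[of "n + 2"] by (simp add: block_fps_def)
  next
    case 1
    then have e: "n + 2 = 2" by simp
    show ?thesis unfolding block_fps_def fps_nth_Abs_fps e block_num_2 using 1 by simp
  next
    case 2
    then have e: "n + 2 = 3" by simp
    show ?thesis unfolding block_fps_def fps_nth_Abs_fps e block_num_3 using 2 by simp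
  next
    case 3
    then have e: "n + 2 = 4" by simp
    show ?thesis unfolding block_fps_def fps_nth_Abs_fps e block_num_4 using 3 by simp
  qed
qed

text \<open>Since (n + 2)(n + 1) = n(n - 1) + 4n + 2, the generic coefficients sum to the
  exponential part. That part has coefficients 2, 6, 6 in degrees 0, 1, 2, where the true ones are
  1, 1, 5.\<close>

lemma block_fps_eq:
  "block_fps = (fps_X ^ 2 + 4 * fps_X + 2) * fps_exp 1 - fps_X ^ 2 - 5 * fps_X - 1"
proof (rule fps_ext)
  fix n
  have e: "fps_nth ((fps_X ^ 2 + 4 * fps_X + 2) * fps_exp (1::real)) n =
    (if n < 2 then 0 else 1 / fact (n - 2)) + 4 * (if n = 0 then 0 else 1 / fact (n - 1)) + 2 / fact n"
    by (simp add: distrib_right fps_X_power_mult_nth mult.assoc fps_mult_numeral_left)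
  have "fps_nth (5 * fps_X :: real fps) n = (if n = 1 then 5 else 0)" by (simp add: numeral_fps_const)
  moreover have "fps_nth (fps_X ^ 2 :: real fps) n = (if n = 2 then 1 else 0)" by (simp add: fps_X_power_nth)
  moreover have "fps_nth (1 :: real fps) n = (if n = 0 then 1 else 0)" by simp
  ultimately have r: "fps_nth ((fps_X ^ 2 + 4 * fps_X + 2) * fps_exp 1 - fps_X ^ 2 - 5 * fps_X - 1) n =
    (if n < 2 then 0 else 1 / fact (n - 2)) + 4 * (if n = 0 then 0 else 1 / fact (n - 1)) + 2 / fact n -
    (if n = 2 then 1 else 0) - (if n = 1 then 5 else 0) - (if n = 0 then 1 else (0::real))"
    unfolding fps_sub_nth e by (simp only:)
  consider "n = 0" | "n = 1" | "n = 2" | "3 \<le> n" by linarith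
  then show "fps_nth block_fps n =
    fps_nth ((fps_X ^ 2 + 4 * fps_X + 2) * fps_exp 1 - fps_X ^ 2 - 5 * fps_X - 1) n"
  proof cases
    case 4
    then obtain k where k: "n = k + 3" by (metis add.commute le_Suc_ex)
    define F :: real where "F = fact (k + 1)"
    have F: "F \<noteq> 0" "real k + 3 \<noteq> 0" "real k + 2 \<noteq> 0" by (auto simp: F_def)
    have f: "fact n = (real k + 3) * (real k + 2) * F" "fact (n - 1) = (real k + 2) * F"
      by (simp_all add: k F_def eval_nat_numeral algebra_simps)
    have "(real k + 5) * (real k + 4) / ((real k + 3) * (real k + 2) * F) =
      1 / F + 4 / ((real k + 2) * F) + 2 / ((real k + 3) * (real k + 2) * F)"
      using F by (simp add: divide_simps) (simp add: algebra_simps)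
    moreover have "real ((n + 2) * (n + 1)) = (real k + 5) * (real k + 4)" by (simp add: k algebra_simps)
    ultimately have "real ((n + 2) * (n + 1)) / fact n = 1 / fact (k + 1) + 4 / fact (n - 1) + 2 / fact n"
      unfolding f F_def by simp
    moreover have "n - 2 = k + 1" by (simp add: k)
    ultimately show ?thesis using 4 unfolding r block_fps_nth by simp
  qed (unfold r block_fps_nth, simp_all)
qed

lemma conv_radius_infty_mult:
  "fps_conv_radius f = \<infinity> \<Longrightarrow> fps_conv_radius g = \<infinity> \<Longrightarrow> fps_conv_radius (f * g :: real fps) = \<infinity>"
  using fps_conv_radius_mult[of f g] by (simp add: min_def)

lemma conv_radius_infty_add:
  "fps_conv_radius f = \<infinity> \<Longrightarrow> fps_conv_radius g = \<infinity> \<Longrightarrow> fps_conv_radius (f + g :: real fps) = \<infinity>"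
  using fps_conv_radius_add[of f g] by (simp add: min_def)

lemma conv_radius_infty_diff:
  "fps_conv_radius f = \<infinity> \<Longrightarrow> fps_conv_radius g = \<infinity> \<Longrightarrow> fps_conv_radius (f - g :: real fps) = \<infinity>"
  using fps_conv_radius_diff[of f g] by (simp add: min_def)

lemmas conv_radius_infty = conv_radius_infty_mult conv_radius_infty_add conv_radius_infty_diff

lemma block_fps_radius [simp]: "fps_conv_radius block_fps = \<infinity>"
  unfolding block_fps_eq by (simp add: conv_radius_infty)

lemma block_fps_eval [simp]: "eval_fps block_fps z = Bpp z"
  unfolding block_fps_eq Bpp_def
  by (simp add: eval_fps_diff eval_fps_add eval_fps_mult conv_radius_infty)

lemma nonneg_block: "nonneg_fps block_fps" and nonneg_core: "nonneg_fps core_fps"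
  and nonneg_conn: "nonneg_fps conn_fps" and nonneg_X: "nonneg_fps fps_X"
  by (auto simp: nonneg_fps_def block_fps_def core_fps_def conn_fps_def fps_X_def)

lemma psum_has_derivative:
  "((\<lambda>x. psum f (Suc N) x) has_real_derivative psum (fps_deriv f) N x) (at x)"
proof -
  have e: "psum f (Suc N) = (\<lambda>x. fps_nth f 0 + (\<Sum>n\<le>N. fps_nth f (Suc n) * x ^ Suc n))"
    by (rule ext) (simp only: psum_def sum.atMost_Suc_shift power_0 mult_1_right)
  show ?thesis unfolding e psum_def
    by (auto intro!: derivative_eq_intros sum.cong simp del: power_Suc of_nat_Suc)
qed

text \<open>By \<open>A' = B'' A\<close>, the truncations of \<open>A\<close> satisfy a differential inequality.\<close>

lemma core_psum_le:
  assumes x: "0 \<le> x"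
  shows "psum core_fps N x \<le> exp (Bp x)"
proof -
  \<comment> \<open>\<open>exp (- Bp x)\<close> is the integrating factor of A' = B'' A; the
    inequality makes \<open>h\<close> nonincreasing, starting from \<open>h 0 = 1\<close>.\<close>
  define h where "h = (\<lambda>x. psum core_fps (Suc N) x * exp (- Bp x))"
  have "h x \<le> h 0"
  proof (rule DERIV_nonpos_imp_nonincreasing[OF x])
    fix t assume t: "0 \<le> t" "t \<le> x"
    have d: "(h has_real_derivative (psum (fps_deriv core_fps) N t - Bpp t * psum core_fps (Suc N) t) * exp (- Bp t)) (at t)"
      unfolding h_def by (auto intro!: derivative_eq_intros psum_has_derivative Bp_deriv simp: algebra_simps)
    have "psum (fps_deriv core_fps) N t \<le> psum block_fps N t * psum core_fps N t"
      unfolding core_fps_deriv by (rule psum_mult_le[OF nonneg_block nonneg_core t(1)])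
    also have "\<dots> \<le> Bpp t * psum core_fps (Suc N) t"
    proof (rule mult_mono)
      show "psum block_fps N t \<le> Bpp t"
        using psum_le_eval[OF nonneg_block t(1) summable_fps] by simp
      show "psum core_fps N t \<le> psum core_fps (Suc N) t" using psum_mono[OF nonneg_core t(1)] by simp
    qed (use psum_nonneg[OF nonneg_core t(1)] Bpp_ge_1[OF t(1)] in auto)
    finally have "(psum (fps_deriv core_fps) N t - Bpp t * psum core_fps (Suc N) t) * exp (- Bp t) \<le> 0"
      by (simp add: mult_nonpos_nonneg)
    then show "\<exists>D. (h has_real_derivative D) (at t) \<and> D \<le> 0" using d by blast
  qed
  moreover have "h 0 = 1"
    by (simp add: h_def psum_def Bp_def core_fps_def core_num_0 sum.atMost_Suc_shift del: sum.atMost_Suc)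
  ultimately have "psum core_fps (Suc N) x * exp (- Bp x) \<le> 1" by (simp add: h_def)
  then have "psum core_fps (Suc N) x \<le> exp (Bp x)" by (simp add: exp_minus field_simps)
  then show ?thesis using psum_mono[OF nonneg_core x, of N "Suc N"] by simp
qed

lemma core_fps_radius [simp]: "fps_conv_radius core_fps = \<infinity>"
  by (rule fps_entireI[OF nonneg_core summable_psum_bound[OF nonneg_core _ core_psum_le]])

text \<open>The integrating factor again, now with equality: the bound on truncations has shown A to
  be entire, so the series itself may be differentiated.\<close>

lemma core_fps_eval: "eval_fps core_fps x = exp (Bp x)"
proof -
  define h where "h = (\<lambda>x. eval_fps core_fps x * exp (- Bp x))"
  have "(h has_real_derivative 0) (at t)" for t
  proof -
    have "(eval_fps core_fps has_real_derivative eval_fps (fps_deriv core_fps) t) (at t)"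
      by (rule has_field_derivative_eval_fps) simp
    also have "eval_fps (fps_deriv core_fps) t = Bpp t * eval_fps core_fps t"
      unfolding core_fps_deriv by (simp add: eval_fps_mult)
    finally show ?thesis unfolding h_def
      by (auto intro!: derivative_eq_intros Bp_deriv simp: algebra_simps)
  qed
  then have "h x = h 0" using DERIV_isconst_all by blast
  then show ?thesis
    by (simp add: h_def eval_fps_at_0 Bp_def core_fps_def core_num_0 exp_minus field_simps)
qed

section \<open>The functional equation for rooted graphs\<close>

definition rooted_fps :: "real fps" where "rooted_fps = fps_X * conn_fps"

lemma nonneg_rooted: "nonneg_fps rooted_fps"
  unfolding rooted_fps_def by (rule nonneg_fps_mult[OF nonneg_X nonneg_conn])

lemma rooted_0: "fps_nth rooted_fps 0 = 0" by (simp add: rooted_fps_def)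

lemma conn_fps_nth: "fps_nth conn_fps n = (\<Sum>k\<le>n. fps_nth core_fps k * fps_nth (rooted_fps ^ k) n)"
proof -
  have "fps_nth conn_fps n = fps_nth (core_fps oo rooted_fps) n"
    unfolding rooted_fps_def using conn_fps_compose by (rule arg_cong)
  then show ?thesis by (simp add: fps_compose_nth atMost_atLeast0)
qed

lemma psum_rooted_Suc: "psum rooted_fps (Suc N) x = x * psum conn_fps N x"
  unfolding psum_def sum.atMost_Suc_shift by (simp add: rooted_fps_def sum_distrib_left mult_ac)

text \<open>Coefficients of C' up to degree \<open>N\<close> involve only the powers R^k with
  \<open>k \<le> N\<close>, and truncating a power gives at most the power of the truncation. The
  gain of one degree on the left drives the induction in \<open>psum_rooted_bound\<close>.\<close>

lemma psum_rooted_upper: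
  assumes x: "0 \<le> x"
  shows "psum rooted_fps (Suc N) x \<le> x * exp (Bp (psum rooted_fps N x))"
proof -
  let ?R = "psum rooted_fps N x"
  have R: "0 \<le> ?R" by (rule psum_nonneg[OF nonneg_rooted x])
  have a: "0 \<le> fps_nth core_fps k" for k using nonneg_core by (simp add: nonneg_fps_def)
  have p: "0 \<le> fps_nth (rooted_fps ^ k) n" for k n
    using nonneg_fps_power[OF nonneg_rooted] by (simp add: nonneg_fps_def)
  have "psum conn_fps N x = (\<Sum>n\<le>N. \<Sum>k\<le>n. fps_nth core_fps k * fps_nth (rooted_fps ^ k) n * x ^ n)"
    by (simp add: psum_def conn_fps_nth sum_distrib_right)
  also have "\<dots> \<le> (\<Sum>n\<le>N. \<Sum>k\<le>N. fps_nth core_fps k * fps_nth (rooted_fps ^ k) n * x ^ n)"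
    by (intro sum_mono sum_mono2) (use a p x in auto)
  also have "\<dots> = (\<Sum>k\<le>N. fps_nth core_fps k * psum (rooted_fps ^ k) N x)"
    by (subst sum.swap) (simp add: psum_def sum_distrib_left mult_ac)
  also have "\<dots> \<le> (\<Sum>k\<le>N. fps_nth core_fps k * ?R ^ k)"
    by (intro sum_mono mult_left_mono psum_power_le nonneg_rooted x a)
  also have "\<dots> = psum core_fps N ?R" by (simp add: psum_def)
  also have "\<dots> \<le> exp (Bp ?R)" by (rule core_psum_le[OF R])
  finally show ?thesis unfolding psum_rooted_Suc using x by (intro mult_left_mono)
qed

text \<open>Truncating A at \<open>K\<close> as well leaves finitely many powers of a polynomial, so
  a sufficiently long truncation of R contains all their terms.\<close>

lemma psum_rooted_lower:
  assumes x: "0 \<le> x"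
  shows "x * psum core_fps K (psum rooted_fps N x) \<le> psum rooted_fps (Suc (K * N + K)) x"
proof -
  let ?R = "psum rooted_fps N x" let ?M = "K * N + K"
  have a: "0 \<le> fps_nth core_fps k" for k using nonneg_core by (simp add: nonneg_fps_def)
  have p: "0 \<le> fps_nth (rooted_fps ^ k) n" for k n
    using nonneg_fps_power[OF nonneg_rooted] by (simp add: nonneg_fps_def)
  \<comment> \<open>R has no constant term, so R^k starts in degree \<open>k\<close>; hence the
    bound \<open>k \<le> K\<close> can be exchanged for \<open>k \<le> n\<close>.\<close>
  have z: "fps_nth (rooted_fps ^ k) n = 0" if "n < k" for k n
    using that by (simp add: rooted_fps_def power_mult_distrib fps_X_power_mult_nth)
  have "psum core_fps K ?R = (\<Sum>k\<le>K. fps_nth core_fps k * ?R ^ k)" by (simp add: psum_def)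
  also have "\<dots> \<le> (\<Sum>k\<le>K. fps_nth core_fps k * psum (rooted_fps ^ k) ?M x)"
  proof (intro sum_mono mult_left_mono a)
    fix k assume "k \<in> {..K}"
    then have "k * N \<le> ?M" by (simp add: trans_le_add1)
    then show "?R ^ k \<le> psum (rooted_fps ^ k) ?M x"
      using psum_power_ge[OF nonneg_rooted x, of N k]
        psum_mono[OF nonneg_fps_power[OF nonneg_rooted] x, of "k * N" ?M k] by linarith
  qed
  also have "\<dots> = (\<Sum>n\<le>?M. \<Sum>k\<le>K. fps_nth core_fps k * fps_nth (rooted_fps ^ k) n * x ^ n)"
    by (subst sum.swap) (simp add: psum_def sum_distrib_left mult_ac)
  also have "\<dots> \<le> (\<Sum>n\<le>?M. \<Sum>k\<le>n. fps_nth core_fps k * fps_nth (rooted_fps ^ k) n * x ^ n)"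
  proof (intro sum_mono)
    fix n
    have "(\<Sum>k\<le>K. fps_nth core_fps k * fps_nth (rooted_fps ^ k) n * x ^ n) =
      (\<Sum>k\<in>{..K} \<inter> {..n}. fps_nth core_fps k * fps_nth (rooted_fps ^ k) n * x ^ n)"
      by (rule sum.mono_neutral_right) (auto simp: z)
    also have "\<dots> \<le> (\<Sum>k\<le>n. fps_nth core_fps k * fps_nth (rooted_fps ^ k) n * x ^ n)"
      by (intro sum_mono2) (use a p x in auto)
    finally show "(\<Sum>k\<le>K. fps_nth core_fps k * fps_nth (rooted_fps ^ k) n * x ^ n) \<le>
      (\<Sum>k\<le>n. fps_nth core_fps k * fps_nth (rooted_fps ^ k) n * x ^ n)" .
  qed
  also have "\<dots> = psum conn_fps ?M x"
    by (simp add: psum_def conn_fps_nth sum_distrib_right)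
  finally show ?thesis unfolding psum_rooted_Suc using x by (intro mult_left_mono)
qed

lemma Bp_continuous: "continuous_on UNIV Bp"
  by (intro continuous_at_imp_continuous_on ballI DERIV_continuous[OF Bp_deriv])

text \<open>Convergence at the single point \<open>x\<close> is enough, so the radius of convergence
  itself is allowed. One inequality is the limit of \<open>psum_rooted_upper\<close>; for the other,
  \<open>N\<close> tends to infinity with \<open>K\<close> fixed, and then \<open>K\<close>
  does.\<close>

lemma rooted_functional_equation:
  assumes x: "0 \<le> x" and s: "summable (\<lambda>n. fps_nth rooted_fps n * x ^ n)"
  defines "T \<equiv> eval_fps rooted_fps x"
  shows "T = x * exp (Bp T)" "0 \<le> T"
proof -
  have lim: "(\<lambda>N. psum rooted_fps N x) \<longlonglongrightarrow> T" unfolding T_def by (rule psum_tendsto[OF s])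
  show T0: "0 \<le> T" using psum_le_eval[OF nonneg_rooted x s, of 0] psum_nonneg[OF nonneg_rooted x, of 0]
    by (simp add: T_def)
  have "(\<lambda>N. Bp (psum rooted_fps N x)) \<longlonglongrightarrow> Bp T"
    by (rule continuous_on_tendsto_compose[OF Bp_continuous lim]) auto
  then have "T \<le> x * exp (Bp T)"
    by (intro LIMSEQ_le[OF LIMSEQ_Suc[OF lim] tendsto_mult[OF tendsto_const tendsto_exp]])
      (use psum_rooted_upper[OF x] in auto)
  moreover have "x * psum core_fps K T \<le> T" for K
  proof -
    have "(\<lambda>N. x * psum core_fps K (psum rooted_fps N x)) \<longlonglongrightarrow> x * psum core_fps K T"
      unfolding psum_def[of core_fps] by (intro tendsto_intros lim)
    then show ?thesis
    proof (rule LIMSEQ_le_const2)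
      show "\<exists>N. \<forall>n\<ge>N. x * psum core_fps K (psum rooted_fps n x) \<le> T"
        using psum_rooted_lower[OF x] psum_le_eval[OF nonneg_rooted x s] unfolding T_def
        by (meson order_trans)
    qed
  qed
  then have "x * exp (Bp T) \<le> T"
    unfolding core_fps_eval[symmetric]
    by (intro LIMSEQ_le_const2[OF tendsto_mult[OF tendsto_const psum_tendsto]] summable_fps) auto
  ultimately show "T = x * exp (Bp T)" by simp
qed

section \<open>The inverse function and its maximum\<close>

definition inv_rooted :: "real \<Rightarrow> real" where "inv_rooted w = w * exp (- Bp w)"

lemma inv_rooted_deriv:
  "(inv_rooted has_real_derivative exp (- Bp w) * (1 - w * Bpp w)) (at w)"
  unfolding inv_rooted_def[abs_def]
  by (auto intro!: derivative_eq_intros Bp_deriv simp: algebra_simps)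

lemma w_Bpp_strict_mono: "0 \<le> u \<Longrightarrow> u < v \<Longrightarrow> u * Bpp u < v * Bpp v"
  using Bpp_strict_mono[of u v] Bpp_ge_1[of u] by (intro mult_strict_mono'[of u v "Bpp u" "Bpp v"]) auto

context
  fixes \<tau> :: real
  assumes tau: "0 < \<tau>" "\<tau> * Bpp \<tau> = 1"
begin

text \<open>The derivative has the sign of 1 - w B''(w), and w B''(w) increases strictly through 1
  at \<open>\<tau>\<close>.\<close>

lemma inv_rooted_less:
  assumes "0 \<le> w" "w \<noteq> \<tau>"
  shows "inv_rooted w < inv_rooted \<tau>"
proof (cases "w < \<tau>")
  case True
  show ?thesis
  proof (rule DERIV_pos_imp_increasing_open[OF True])
    fix t assume t: "w < t" "t < \<tau>"
    then have "0 < exp (- Bp t) * (1 - t * Bpp t)" using w_Bpp_strict_mono[of t \<tau>] assms tau by simp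
    then show "\<exists>D. (inv_rooted has_real_derivative D) (at t) \<and> 0 < D" using inv_rooted_deriv by blast
  qed (intro continuous_at_imp_continuous_on ballI DERIV_continuous[OF inv_rooted_deriv])
next
  case False
  then have w: "\<tau> < w" using assms by simp
  show ?thesis
  proof (rule DERIV_neg_imp_decreasing_open[OF w])
    fix t assume t: "\<tau> < t" "t < w"
    then have "exp (- Bp t) * (1 - t * Bpp t) < 0" using w_Bpp_strict_mono[of \<tau> t] tau by (simp add: mult_less_0_iff)
    then show "\<exists>D. (inv_rooted has_real_derivative D) (at t) \<and> D < 0" using inv_rooted_deriv by blast
  qed (intro continuous_at_imp_continuous_on ballI DERIV_continuous[OF inv_rooted_deriv])
qed

lemma inv_rooted_eval:
  assumes "0 \<le> x" "summable (\<lambda>n. fps_nth rooted_fps n * x ^ n)"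
  shows "inv_rooted (eval_fps rooted_fps x) = x"
proof -
  have "inv_rooted (eval_fps rooted_fps x) = (x * exp (Bp (eval_fps rooted_fps x))) * exp (- Bp (eval_fps rooted_fps x))"
    unfolding inv_rooted_def using rooted_functional_equation(1)[OF assms] by simp
  then show ?thesis by (simp add: exp_minus)
qed

lemma rho_pos: "0 < inv_rooted \<tau>"
  using tau by (simp add: inv_rooted_def)

text \<open>\<open>\<tau>\<close> is a fixed point of the map t -> rho exp(B'(t)) with rho =
  \<open>inv_rooted \<tau>\<close>. This map is increasing on the nonnegative reals, so an iteration
  that starts below the fixed point stays below it.\<close>

lemma psum_rooted_bound: "psum rooted_fps N (inv_rooted \<tau>) \<le> \<tau>"
proof (induction N)
  case 0
  then show ?case using tau rooted_0 by (simp add: psum_def)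
next
  case (Suc N)
  let ?x = "inv_rooted \<tau>"
  have "psum rooted_fps (Suc N) ?x \<le> ?x * exp (Bp (psum rooted_fps N ?x))"
    using psum_rooted_upper rho_pos by simp
  also have "\<dots> \<le> ?x * exp (Bp \<tau>)"
    using Bp_mono[OF psum_nonneg[OF nonneg_rooted] Suc] rho_pos by (intro mult_left_mono) auto
  also have "\<dots> = \<tau>" by (simp add: inv_rooted_def exp_minus)
  finally show ?case .
qed

lemma rooted_summable: "summable (\<lambda>n. fps_nth rooted_fps n * inv_rooted \<tau> ^ n)"
  by (rule summable_psum_bound[OF nonneg_rooted _ psum_rooted_bound]) (use rho_pos in simp)

text \<open>By the functional equation \<open>inv_rooted\<close> takes its maximum at this value,
  and the maximum is strict.\<close>

lemma rooted_eval: "eval_fps rooted_fps (inv_rooted \<tau>) = \<tau>"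
proof (rule ccontr)
  have x: "0 \<le> inv_rooted \<tau>" using rho_pos by simp
  assume "eval_fps rooted_fps (inv_rooted \<tau>) \<noteq> \<tau>"
  then have "inv_rooted (eval_fps rooted_fps (inv_rooted \<tau>)) < inv_rooted \<tau>"
    by (rule inv_rooted_less[OF rooted_functional_equation(2)[OF x rooted_summable]])
  then show False using inv_rooted_eval[OF x rooted_summable] by simp
qed

text \<open>If the series converged at some larger \<open>x\<close>, then \<open>inv_rooted\<close>
  would take the value \<open>x\<close>, which exceeds its maximum.\<close>

lemma rooted_radius: "fps_conv_radius rooted_fps = ereal (inv_rooted \<tau>)"
proof (rule antisym)
  show "ereal (inv_rooted \<tau>) \<le> fps_conv_radius rooted_fps"
    using conv_radius_geI[OF rooted_summable] rho_pos by (simp add: fps_conv_radius_def)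
  show "fps_conv_radius rooted_fps \<le> ereal (inv_rooted \<tau>)"
  proof (rule ccontr)
    assume "\<not> ?thesis"
    then have "ereal (inv_rooted \<tau>) < fps_conv_radius rooted_fps" by simp
    from ereal_dense2[OF this] obtain x where x: "inv_rooted \<tau> < x" "ereal x < fps_conv_radius rooted_fps"
      by auto
    have s: "summable (\<lambda>n. fps_nth rooted_fps n * x ^ n)"
      by (rule summable_fps) (use x rho_pos in simp)
    have "inv_rooted (eval_fps rooted_fps x) = x" using inv_rooted_eval[OF _ s] x rho_pos by simp
    moreover have "inv_rooted (eval_fps rooted_fps x) \<le> inv_rooted \<tau>"
      using inv_rooted_less[of "eval_fps rooted_fps x"] rooted_functional_equation(2)[OF _ s] x rho_pos
      by (cases "eval_fps rooted_fps x = \<tau>") auto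
    ultimately show False using x by simp
  qed
qed

end

subsection \<open>Topological minors\<close>

lemma conn_rtrancl_on:
  "conn E T \<longleftrightarrow> T \<noteq> {} \<and> (\<forall>u\<in>T. \<forall>v\<in>T. (u, v) \<in> rtrancl_on T E)"
proof (intro iffI conjI ballI)
  assume c: "conn E T"
  then show "T \<noteq> {}" by (rule conn_nonempty)
  fix u v assume uv: "u \<in> T" "v \<in> T"
  have "edge_closed E T {v \<in> T. (u, v) \<in> rtrancl_on T E}"
    by (rule edge_closedI) (auto intro: rtrancl_on_into_rtrancl_on)
  moreover have "u \<in> {v \<in> T. (u, v) \<in> rtrancl_on T E}" using uv by auto
  ultimately have "T \<subseteq> {v \<in> T. (u, v) \<in> rtrancl_on T E}" by (rule connD[OF c])
  then show "(u, v) \<in> rtrancl_on T E" using uv by blast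
next
  assume a: "T \<noteq> {} \<and> (\<forall>u\<in>T. \<forall>v\<in>T. (u, v) \<in> rtrancl_on T E)"
  show "conn E T"
  proof (rule connI)
    fix X x assume X: "edge_closed E T X" "x \<in> X"
    have "v \<in> X" if "(x, v) \<in> rtrancl_on T E" for v
      using that by (induction rule: rtrancl_on_induct) (use X in \<open>auto simp: edge_closed_def\<close>)
    then show "T \<subseteq> X" using a X by (auto simp: edge_closed_def)
  qed (use a in blast)
qed

lemma rtrancl_on_cong:
  assumes "\<And>u v. u \<in> T \<Longrightarrow> v \<in> T \<Longrightarrow> (u, v) \<in> E \<longleftrightarrow> (u, v) \<in> E'"
  shows "rtrancl_on T E = rtrancl_on T E'"
proof -
  have "(u, v) \<in> rtrancl_on T F'" if "(u, v) \<in> rtrancl_on T F"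
    "\<And>u v. u \<in> T \<Longrightarrow> v \<in> T \<Longrightarrow> (u, v) \<in> F \<Longrightarrow> (u, v) \<in> F'" for F F' :: "('a \<times> 'a) set" and u v
    using that(1) by (induction rule: rtrancl_on_induct) (use that(2) in \<open>auto intro: rtrancl_on_into_rtrancl_on\<close>)
  then show ?thesis using assms by (intro equalityI subrelI) blast+
qed

lemma pair_graph_iff:
  "pair_graph G \<longleftrightarrow> finite (pverts G) \<and> parcs G \<in> edge_graphs (pverts G)"
proof
  assume "pair_graph G"
  then interpret pair_graph G .
  have "(a, a) \<notin> parcs G" for a using no_loops' by blast
  then show "finite (pverts G) \<and> parcs G \<in> edge_graphs (pverts G)"
    using pair_finite_verts in_arcsD1 in_arcsD2 arcs_symmetric
    by (auto simp: edge_graphs_def sym_def irrefl_def)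
next
  assume a: "finite (pverts G) \<and> parcs G \<in> edge_graphs (pverts G)"
  then have "finite (parcs G)" by (auto simp: edge_graphs_def intro: finite_subset[of _ "pverts G \<times> pverts G"])
  then show "pair_graph G"
    using a by unfold_locales (auto simp: edge_graphs_def irrefl_def symmetric_def)
qed

lemma connected_iff_conn:
  assumes "parcs G \<in> edge_graphs (pverts G)"
  shows "Digraph_Component.connected (with_proj G) \<longleftrightarrow> conn (parcs G) (pverts G)"
proof -
  have "parcs (mk_symmetric (with_proj G)) = parcs G" "pverts (mk_symmetric (with_proj G)) = pverts G"
    using assms by (auto simp: mk_symmetric_def edge_graphs_def sym_def)
  then show ?thesis
    by (auto simp: Digraph_Component.connected_def strongly_connected_def reachable_def conn_rtrancl_on)
qed

text \<open>The vertex of a one-vertex graph is no cutvertex although \<open>conn\<close> fails on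
  the empty set, hence the nonemptiness condition.\<close>

lemma cutvertex_iff:
  assumes "conn (parcs G) (pverts G)"
  shows "cutvertex G v \<longleftrightarrow> v \<in> pverts G \<and> pverts G - {v} \<noteq> {} \<and> \<not> conn (parcs G) (pverts G - {v})"
proof -
  have "arcs_ends (pre_digraph.del_vert (with_proj G) v) = {a \<in> parcs G. fst a \<noteq> v \<and> snd a \<noteq> v}"
    by (auto simp: pre_digraph.del_vert_def arcs_ends_def arc_to_ends_def)
  moreover have "rtrancl_on (pverts G - {v}) {a \<in> parcs G. fst a \<noteq> v \<and> snd a \<noteq> v} =
    rtrancl_on (pverts G - {v}) (parcs G)"
    by (rule rtrancl_on_cong) auto
  moreover have "verts (pre_digraph.del_vert (with_proj G) v) = pverts G - {v}"
    by (simp add: pre_digraph.del_vert_def)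
  ultimately have "reachable (pre_digraph.del_vert (with_proj G) v) u w \<longleftrightarrow>
    (u, w) \<in> rtrancl_on (pverts G - {v}) (parcs G)" for u w
    by (simp add: reachable_def)
  moreover have "reachable (with_proj G) u w" if "u \<in> pverts G" "w \<in> pverts G" for u w
    using assms that by (simp add: reachable_def conn_rtrancl_on)
  ultimately show ?thesis unfolding cutvertex_def conn_rtrancl_on by blast
qed

lemma block_iff:
  assumes G: "parcs G \<in> edge_graphs (pverts G)" and fin: "finite (pverts G)"
    and con: "conn (parcs G) (pverts G)"
  shows "two_connected G \<or> single_edge G \<longleftrightarrow>
    2 \<le> card (pverts G) \<and> (\<forall>x\<in>pverts G. conn (parcs G) (pverts G - {x}))"
proof (intro iffI; (elim disjE)?)
  assume t: "two_connected G"
  have "pverts G - {x} \<noteq> {}" for x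
  proof
    assume "pverts G - {x} = {}"
    then have "card (pverts G) \<le> card {x}" by (intro card_mono) auto
    then show False using t by (simp add: two_connected_def)
  qed
  then show "2 \<le> card (pverts G) \<and> (\<forall>x\<in>pverts G. conn (parcs G) (pverts G - {x}))"
    using t by (auto simp: two_connected_def cutvertex_iff[OF con])
next
  assume "single_edge G"
  then obtain u v where uv: "u \<noteq> v" "pverts G = {u, v}" by (auto simp: single_edge_def)
  then have "pverts G - {u} = {v}" "pverts G - {v} = {u}" by auto
  then show "2 \<le> card (pverts G) \<and> (\<forall>x\<in>pverts G. conn (parcs G) (pverts G - {x}))"
    using uv by auto
next
  assume a: "2 \<le> card (pverts G) \<and> (\<forall>x\<in>pverts G. conn (parcs G) (pverts G - {x}))"
  show "two_connected G \<or> single_edge G"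
  proof (cases "card (pverts G) = 2")
    case True
    then obtain u v where uv: "pverts G = {u, v}" "u \<noteq> v" by (auto simp: card_2_iff)
    have E: "parcs G \<subseteq> {(u, v), (v, u)}" and sy: "sym (parcs G)"
      using G by (auto simp: uv(1) edge_graphs_def irrefl_def)
    have "(u, v) \<in> parcs G"
    proof (rule ccontr)
      assume n: "(u, v) \<notin> parcs G"
      have "edge_closed (parcs G) (pverts G) {u}"
        by (rule edge_closedI) (use n E uv in auto)
      then have "pverts G \<subseteq> {u}" using connD[OF con, of "{u}" u] by simp
      then show False using uv by auto
    qed
    then have "parcs G = {(u, v), (v, u)}" using E sy by (auto dest: symD)
    then show ?thesis using uv by (auto simp: single_edge_def)
  next
    case False
    then have "3 \<le> card (pverts G)" using a by linarith
    then show ?thesis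
      using a con cutvertex_iff[OF con] connected_iff_conn[OF G] by (auto simp: two_connected_def)
  qed
qed

text \<open>Either a walk avoids a forbidden kind of edge altogether, or it can be cut at
  one.\<close>

lemma successively_split:
  assumes "successively Q xs"
  shows "successively (\<lambda>a b. Q a b \<and> R a b) xs \<or> (\<exists>as p q bs. xs = as @ p # q # bs \<and> \<not> R p q)"
  using assms
proof (induction xs)
  case (Cons x xs)
  show ?case
  proof (cases xs)
    case (Cons y ys)
    have "successively Q xs" using Cons.prems Cons by simp
    from Cons.IH[OF this] show ?thesis
    proof
      assume s: "successively (\<lambda>a b. Q a b \<and> R a b) xs"
      show ?thesis
      proof (cases "R x y")
        case True
        then show ?thesis using s Cons.prems Cons by simp
      next
        case False
        then have "x # xs = [] @ x # y # ys \<and> \<not> R x y" using Cons by simp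
        then show ?thesis by blast
      qed
    next
      assume "\<exists>as p q bs. xs = as @ p # q # bs \<and> \<not> R p q"
      then obtain as p q bs where "x # xs = (x # as) @ p # q # bs \<and> \<not> R p q" by auto
      then show ?thesis by blast
    qed
  qed simp
qed simp

text \<open>If the cycle uses the edge \<open>u v\<close>, it is rotated until this is the closing
  edge, and \<open>w\<close> is appended. Otherwise it survives unchanged.\<close>

lemma longcyc_subdivide:
  assumes "longcyc E" and sy: "sym E" and E: "E \<subseteq> V \<times> V" and w: "w \<notin> V"
  shows "longcyc ((E - {(u, v), (v, u)}) \<union> {(u, w), (w, u), (w, v), (v, w)})" (is "longcyc ?E'")
proof -
  obtain xs where xs: "cyc E xs" "5 \<le> length xs" using assms by (auto simp: longcyc_def)
  have wx: "w \<notin> set zs" if "cyc E zs" for zs using cyc_Field[OF that E] w by blast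
  define R where "R = (\<lambda>a b. (a, b) \<noteq> (u, v) \<and> (a, b) \<noteq> (v, u))"
  have closing: "longcyc ?E'"
    if z: "cyc E zs" "5 \<le> length zs" "\<not> R (last zs) (hd zs)" for zs
  proof -
    have sz: "walk E zs" "distinct zs" "zs \<noteq> []" using z by (auto simp: cyc_def)
    have "successively (\<lambda>a b. (a, b) \<in> E \<and> R a b) zs"
    proof (rule ccontr)
      assume "\<not> ?thesis"
      then obtain as p q bs where s: "zs = as @ p # q # bs" "\<not> R p q"
        using successively_split[OF sz(1), of R] by blast
      have "{p, q} = {last zs, hd zs}" using s(2) z(3) by (auto simp: R_def)
      moreover have "p \<noteq> last zs" using s sz(2) by (auto split: if_splits)
      ultimately have pq: "p = hd zs" "q = last zs" by (auto simp: doubleton_eq_iff)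
      have "as = []" using pq(1) s(1) sz(2) by (cases as) auto
      moreover have "bs = []" using pq(2) s(1) sz(2) by (cases bs rule: rev_cases) auto
      ultimately show False using s z by simp
    qed
    then have "walk ?E' zs" by (rule successively_mono) (auto simp: R_def)
    then have "cyc ?E' (zs @ [w])"
      using z(3) sz wx[OF z(1)] unfolding cyc_def R_def successively_append_iff by auto
    then show ?thesis using z by (auto simp: longcyc_def)
  qed
  consider "\<not> R (last xs) (hd xs)" | as p q bs where "xs = as @ p # q # bs" "\<not> R p q"
    | "successively (\<lambda>a b. (a, b) \<in> E \<and> R a b) xs" "R (last xs) (hd xs)"
    using successively_split[of "\<lambda>a b. (a, b) \<in> E" xs R] xs(1) unfolding cyc_def by fast
  then show ?thesis
  proof cases
    case 1
    then show ?thesis using closing xs by blast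
  next
    case 2
    have "cyc E (q # bs @ as @ [p])" using cyc_rotate[of E "as @ [p]" q bs] xs 2 by simp
    then show ?thesis using closing[of "q # bs @ as @ [p]"] xs 2 by simp
  next
    case 3
    have "walk ?E' xs"
      using 3(1) by (rule successively_mono) (auto simp: R_def)
    then have "cyc ?E' xs" using xs 3(2) by (auto simp: cyc_def R_def)
    then show ?thesis using xs by (auto simp: longcyc_def)
  qed
qed

lemma parcs_cycle_graph_5:
  "parcs (cycle_graph 5) = {(0, 1), (1, 0), (1, 2), (2, 1), (2, 3), (3, 2), (3, 4), (4, 3), (4, 0), (0, 4)}"
proof -
  have "(i, j) \<in> {(0, 1), (1, 0), (1, 2), (2, 1), (2, 3), (3, 2), (3, 4), (4, 3), (4, 0), (0, 4)}"
    if "(i, j) \<in> parcs (cycle_graph 5)" for i j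
  proof -
    have "i < 5" "j < 5" "j = (i + 1) mod 5 \<or> i = (j + 1) mod 5" using that by (simp_all add: cycle_graph_def)
    moreover from this have "i = 0 \<or> i = 1 \<or> i = 2 \<or> i = 3 \<or> i = 4" "j = 0 \<or> j = 1 \<or> j = 2 \<or> j = 3 \<or> j = 4"
      by linarith+
    ultimately show ?thesis by (elim disjE; simp)
  qed
  then show ?thesis by (intro equalityI subrelI) (assumption, auto simp: cycle_graph_def)
qed

lemma iso_cycle_longcyc:
  assumes "digraph_iso (with_proj (cycle_graph 5)) (with_proj K')"
  shows "longcyc (parcs K')"
proof -
  obtain h where h: "pre_digraph.digraph_isomorphism (with_proj (cycle_graph 5)) h"
    "with_proj K' = app_iso h (with_proj (cycle_graph 5))"
    using assms by (auto simp: digraph_iso_def)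
  define f where "f = iso_verts h"
  \<comment> \<open>Tail and head in \<open>with_proj K'\<close> are \<open>fst\<close> and
    \<open>snd\<close>, so \<open>h\<close> acts on arcs through the images of their ends.\<close>
  have t: "iso_tail h = fst" "iso_head h = snd" and a: "parcs K' = iso_arcs h ` parcs (cycle_graph 5)"
    using arg_cong[OF h(2), of tail] arg_cong[OF h(2), of head] arg_cong[OF h(2), of arcs] by auto
  have inj: "inj_on f {0..<5}" and
    ia: "\<forall>a\<in>parcs (cycle_graph 5). f (fst a) = fst (iso_arcs h a) \<and> f (snd a) = snd (iso_arcs h a)"
    using h(1) unfolding pre_digraph.digraph_isomorphism_def f_def t by (auto simp: cycle_graph_def)
  have e: "(f i, f j) \<in> parcs K'" if "(i, j) \<in> parcs (cycle_graph 5)" for i j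
  proof -
    have "iso_arcs h (i, j) = (f i, f j)" using ia that by (metis fst_conv prod.collapse snd_conv)
    then show ?thesis using a that by (metis image_eqI)
  qed
  have "distinct (map f [0, 1, 2, 3, 4])"
    by (simp add: inj_on_eq_iff[OF inj])
  moreover have "(f 0, f 1) \<in> parcs K'" "(f 1, f 2) \<in> parcs K'" "(f 2, f 3) \<in> parcs K'"
    "(f 3, f 4) \<in> parcs K'" "(f 4, f 0) \<in> parcs K'"
    by (rule e; simp add: parcs_cycle_graph_5)+
  ultimately have "cyc (parcs K') [f 0, f 1, f 2, f 3, f 4]" by (simp add: cyc_def)
  then show ?thesis unfolding longcyc_def by (intro exI[of _ "[f 0, f 1, f 2, f 3, f 4]"]) simp
qed

lemma topological_minor_longcyc:
  assumes "topological_minor (cycle_graph 5) G"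
  shows "longcyc (parcs G)"
proof -
  obtain K' H where K: "digraph_iso (with_proj (cycle_graph 5)) (with_proj K')"
    "subdivision_pair K' H" "subgraph (with_proj H) (with_proj G)"
    using assms by (auto simp: topological_minor_def)
  have "longcyc (parcs H)"
    using K(2)
  proof (induction rule: subdivision_pair_induct)
    case base
    then show ?case using iso_cycle_longcyc[OF K(1)] by simp
  next
    case (divide e w H)
    interpret H: pair_bidirected_digraph H by (rule bidirected_digraphI_subdivision) fact
    obtain u v where e: "e = (u, v)" by (cases e)
    have "sym (parcs H)" using H.arcs_symmetric by (auto intro: symI)
    moreover have "parcs H \<subseteq> pverts H \<times> pverts H" using H.in_arcsD1 H.in_arcsD2 by auto
    ultimately show ?case
      using longcyc_subdivide[OF divide.IH, of "pverts H" w u v] divide.hyps by (simp add: e)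
  qed
  then show ?thesis using K(3) by (auto simp: subgraph_def intro: longcyc_mono)
qed

section \<open>Long cycles as subdivisions of C_5\<close>

definition cycle_edges :: "'a list \<Rightarrow> ('a \<times> 'a) set" where
  "cycle_edges ys = set (zip ys (tl ys)) \<union> (set (zip ys (tl ys)))\<inverse> \<union> {(last ys, hd ys), (hd ys, last ys)}"

definition list_cycle :: "'a list \<Rightarrow> 'a pair_pre_digraph" where
  "list_cycle ys = \<lparr> pverts = set ys, parcs = cycle_edges ys \<rparr>"

lemma set_zip_tl: "set (zip ys (tl ys)) = {(ys ! i, ys ! Suc i) |i. Suc i < length ys}"
  by (auto simp: set_zip nth_tl)

lemma list_cycle_edge_graphs:
  assumes "distinct ys" "2 \<le> length ys"
  shows "cycle_edges ys \<in> edge_graphs (set ys)"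
proof -
  have ne: "ys \<noteq> []" using assms by auto
  have "ys ! i \<noteq> ys ! Suc i" if "Suc i < length ys" for i using assms that by (simp add: nth_eq_iff_index_eq)
  moreover have "hd ys \<noteq> last ys"
    using assms ne by (simp add: hd_conv_nth last_conv_nth nth_eq_iff_index_eq)
  ultimately show ?thesis
    using ne unfolding edge_graphs_def cycle_edges_def set_zip_tl irrefl_def sym_def
    by (auto dest: sym)
qed

text \<open>Appending a vertex subdivides the closing edge. From three vertices on, this edge is not
  also one between consecutive entries, so subdividing really removes it.\<close>

lemma list_cycle_snoc:
  assumes "distinct (ys @ [w])" "3 \<le> length ys"
  shows "list_cycle (ys @ [w]) = subdivide (list_cycle ys) (last ys, hd ys) w"
    "(last ys, hd ys) \<in> parcs (list_cycle ys)" "w \<notin> pverts (list_cycle ys)"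
proof -
  have ne: "ys \<noteq> []" using assms by auto
  have z: "set (zip (ys @ [w]) (tl (ys @ [w]))) = set (zip ys (tl ys)) \<union> {(last ys, w)}"
  proof -
    have "zip (ys @ [w]) (tl (ys @ [w])) = zip ys (tl ys) @ [(last ys, w)]"
      using ne by (induction ys rule: induct_list012) auto
    then show ?thesis by simp
  qed
  have n: "(last ys, hd ys) \<notin> set (zip ys (tl ys))" "(hd ys, last ys) \<notin> set (zip ys (tl ys))"
    using assms ne by (auto simp: set_zip_tl hd_conv_nth last_conv_nth nth_eq_iff_index_eq)
  show "list_cycle (ys @ [w]) = subdivide (list_cycle ys) (last ys, hd ys) w"
    using n ne unfolding list_cycle_def cycle_edges_def subdivide.simps z by auto
  show "(last ys, hd ys) \<in> parcs (list_cycle ys)" by (simp add: list_cycle_def cycle_edges_def)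
  show "w \<notin> pverts (list_cycle ys)" using assms by (simp add: list_cycle_def)
qed

lemma list_cycle_iso:
  assumes "distinct ys" "length ys = 5"
  shows "digraph_iso (with_proj (cycle_graph 5)) (with_proj (list_cycle ys))"
proof -
  define h where "h = \<lparr> iso_verts = (!) ys, iso_arcs = (\<lambda>(i, j). (ys ! i, ys ! j)),
    iso_head = snd, iso_tail = fst \<rparr>"
  have inj: "inj_on ((!) ys) {0..<5}" using assms by (auto simp: inj_on_def nth_eq_iff_index_eq)
  have sub: "parcs (cycle_graph 5) \<subseteq> {0..<5} \<times> {0..<5}" by (auto simp: cycle_graph_def)
  have "wf_digraph (with_proj (cycle_graph 5))"
    unfolding wf_digraph_wp_iff by unfold_locales (auto simp: cycle_graph_def)
  moreover have "inj_on (\<lambda>(i, j). (ys ! i, ys ! j)) (parcs (cycle_graph 5))"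
    using inj_on_subset[OF map_prod_inj_on[OF inj inj] sub] by (simp add: map_prod_def)
  ultimately have "pre_digraph.digraph_isomorphism (with_proj (cycle_graph 5)) h"
    using inj by (auto simp: pre_digraph.digraph_isomorphism_def h_def cycle_graph_def)
  moreover have "with_proj (list_cycle ys) = app_iso h (with_proj (cycle_graph 5))"
  proof -
    have "pverts (list_cycle ys) = (!) ys ` pverts (cycle_graph 5)"
      using assms(2) by (auto simp: list_cycle_def cycle_graph_def set_conv_nth)
    moreover have "parcs (list_cycle ys) = (\<lambda>(i, j). (ys ! i, ys ! j)) ` parcs (cycle_graph 5)"
    proof -
      obtain a b c d e where "ys = [a, b, c, d, e]" using assms(2)
        by (auto simp: numeral_eq_Suc length_Suc_conv)
      then show ?thesis unfolding parcs_cycle_graph_5 by (auto simp: list_cycle_def cycle_edges_def)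
    qed
    ultimately show ?thesis by (simp add: app_iso_def with_proj_def h_def)
  qed
  ultimately show ?thesis by (auto simp: digraph_iso_def)
qed

lemma list_cycle_bidirected:
  assumes "distinct ys" "2 \<le> length ys"
  shows "pair_bidirected_digraph (list_cycle ys)"
proof -
  have "pair_graph (list_cycle ys)"
    using list_cycle_edge_graphs[OF assms] by (simp add: pair_graph_iff list_cycle_def)
  then interpret pair_graph "list_cycle ys" .
  show ?thesis by unfold_locales
qed

text \<open>The first five vertices form the isomorphic copy of C_5; each further vertex is one
  subdivision.\<close>

lemma list_cycle_subdivision:
  assumes "distinct ys" "5 \<le> length ys"
  shows "subdivision_pair (list_cycle (take 5 ys)) (list_cycle ys)"
  using assms
proof (induction ys rule: rev_induct)
  case (snoc w ys)
  show ?case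
  proof (cases "5 \<le> length ys")
    case True
    then have "subdivision_pair (list_cycle (take 5 ys)) (list_cycle ys)" using snoc by simp
    then show ?thesis
      using list_cycle_snoc[of ys w] snoc.prems True
        subdivision_pair_divide[of "(last ys, hd ys)" "list_cycle ys" w "list_cycle (take 5 ys)"]
      by simp
  next
    case False
    then have "take 5 (ys @ [w]) = ys @ [w]" using snoc.prems by simp
    then show ?thesis
      using list_cycle_bidirected[of "ys @ [w]"] snoc.prems subdivision_pair_base by auto
  qed
qed simp

lemma successively_zip: "successively P xs \<longleftrightarrow> (\<forall>(a, b)\<in>set (zip xs (tl xs)). P a b)"
  by (induction xs rule: induct_list012) auto

lemma longcyc_topological_minor:
  assumes "longcyc (parcs G)" "parcs G \<in> edge_graphs (pverts G)"
  shows "topological_minor (cycle_graph 5) G"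
proof -
  obtain ys where ys: "cyc (parcs G) ys" "5 \<le> length ys" using assms by (auto simp: longcyc_def)
  have d: "distinct ys" "ys \<noteq> []" using ys by (auto simp: cyc_def)
  have sub: "set ys \<subseteq> pverts G" using cyc_Field[OF ys(1)] assms by (simp add: edge_graphs_def)
  have "cycle_edges ys \<subseteq> parcs G"
    using ys assms(2) unfolding cyc_def successively_zip cycle_edges_def edge_graphs_def
    by (auto dest: symD)
  moreover have "wf_digraph (with_proj G)" "wf_digraph (with_proj (list_cycle ys))"
    using assms(2) list_cycle_edge_graphs[OF d(1)] ys
    by (auto simp: wf_digraph_wp_iff pair_wf_digraph_def edge_graphs_def list_cycle_def)
  ultimately have "subgraph (with_proj (list_cycle ys)) (with_proj G)"
    using sub by (simp add: subgraph_def list_cycle_def compatible_def)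
  moreover have "digraph_iso (with_proj (cycle_graph 5)) (with_proj (list_cycle (take 5 ys)))"
    by (rule list_cycle_iso) (use d ys in auto)
  ultimately show ?thesis
    using list_cycle_subdivision[OF d(1) ys(2)] unfolding topological_minor_def by blast
qed

lemma Forb_iff:
  "G \<in> Forb (cycle_graph 5) \<longleftrightarrow> finite (pverts G) \<and> parcs G \<in> conn_graphs (pverts G)"
  using topological_minor_longcyc[of G] longcyc_topological_minor[of G] connected_iff_conn[of G]
  by (auto simp: Forb_def pair_graph_iff conn_graphs_def)

lemma blocks_iff:
  "G \<in> blocks (Forb (cycle_graph 5)) \<longleftrightarrow> finite (pverts G) \<and> parcs G \<in> block_graphs (pverts G)"
  using block_iff[of G] by (auto simp: blocks_def Forb_iff block_graphs_def conn_graphs_def)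

lemma card_graphs_on:
  "card {G :: 'a pair_pre_digraph. pverts G = S \<and> parcs G \<in> P} = card P"
proof -
  have "bij_betw parcs {G :: 'a pair_pre_digraph. pverts G = S \<and> parcs G \<in> P} P"
    by (rule bij_betwI[where g = "\<lambda>E. \<lparr> pverts = S, parcs = E \<rparr>"]) auto
  then show ?thesis by (rule bij_betw_same_card)
qed

text \<open>With unit costs, \<open>\<mu>\<close> is the infimum of walk lengths. The empty walk is
  excluded by \<open>r \<noteq> 0\<close>, and a walk of length 1 is the edge itself.\<close>

lemma sp_eq:
  assumes G: "parcs G \<in> edge_graphs (pverts G)" and r: "0 \<in> pverts G" "r \<in> pverts G" "r \<noteq> 0"
    and two: "(0, r) \<notin> parcs G \<Longrightarrow> \<exists>w. (0, w) \<in> parcs G \<and> (w, r) \<in> parcs G"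
  shows "sp (G, r) = (if (0, r) \<in> parcs G then 1 else 2)"
proof -
  have wf: "wf_digraph (with_proj G)"
    using G by (auto simp: wf_digraph_wp_iff pair_wf_digraph_def edge_graphs_def)
  have aw: "pre_digraph.awalk (with_proj G) 0 p r \<longleftrightarrow> set p \<subseteq> parcs G \<and> pcas 0 p r" for p
    using r by (simp add: pre_digraph.awalk_def cas_with_proj_eq)
  have cost: "wf_digraph.awalk_cost (\<lambda>_. 1) p = real (length p)" for p :: "(nat \<times> nat) list"
    by (simp add: wf_digraph.awalk_cost_def[OF wf] sum_list_triv)
  define d where "d = (if (0, r) \<in> parcs G then 1 else 2 :: nat)"
  have "(INF p\<in>{p. pre_digraph.awalk (with_proj G) 0 p r}. ereal (wf_digraph.awalk_cost (\<lambda>_. 1) p)) = ereal (real d)"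
  proof (rule antisym)
    have "\<exists>p. pre_digraph.awalk (with_proj G) 0 p r \<and> length p = d"
    proof (cases "(0, r) \<in> parcs G")
      case True
      then show ?thesis by (intro exI[of _ "[(0, r)]"]) (simp add: aw d_def)
    next
      case False
      then obtain w where "(0, w) \<in> parcs G" "(w, r) \<in> parcs G" using two by blast
      then show ?thesis using False by (intro exI[of _ "[(0, w), (w, r)]"]) (simp add: aw d_def)
    qed
    then obtain p where p: "pre_digraph.awalk (with_proj G) 0 p r" "length p = d" by blast
    then show "(INF p\<in>{p. pre_digraph.awalk (with_proj G) 0 p r}. ereal (wf_digraph.awalk_cost (\<lambda>_. 1) p)) \<le> ereal (real d)"
      by (intro INF_lower2[of p]) (auto simp: cost)
    show "ereal (real d) \<le> (INF p\<in>{p. pre_digraph.awalk (with_proj G) 0 p r}. ereal (wf_digraph.awalk_cost (\<lambda>_. 1) p))"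
    proof (rule INF_greatest)
      fix p assume "p \<in> {p. pre_digraph.awalk (with_proj G) 0 p r}"
      then have p: "set p \<subseteq> parcs G" "pcas 0 p r" by (auto simp: aw)
      consider "p = []" | e where "p = [e]" | "2 \<le> length p"
        by (cases p; cases "tl p") auto
      then have "d \<le> length p"
      proof cases
        case 1
        then show ?thesis using p r by simp
      next
        case 2
        then have "e = (0, r)" using p by (cases e) auto
        then show ?thesis using p 2 by (simp add: d_def)
      next
        case 3
        then show ?thesis by (simp add: d_def)
      qed
      then show "ereal (real d) \<le> ereal (wf_digraph.awalk_cost (\<lambda>_. 1) p)" by (simp add: cost)
    qed
  qed
  then show ?thesis by (simp add: sp_def wf_digraph.\<mu>_def[OF wf] d_def)
qed

subsection \<open>Numerical values and the Boltzmann distribution\<close>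

text \<open>The Lagrange remainder of order 12, with exp t at most 3 and 3 / 12! below
  10^-8.\<close>

lemma exp_taylor_bounds:
  assumes "0 \<le> x" "x \<le> (1::real)"
  shows "(\<Sum>m<12. x ^ m / fact m) \<le> exp x" "exp x \<le> (\<Sum>m<12. x ^ m / fact m) + x ^ 12 / 10 ^ 8"
proof -
  obtain t where t: "\<bar>t\<bar> \<le> \<bar>x\<bar>" "exp x = (\<Sum>m<12. x ^ m / fact m) + exp t / fact 12 * x ^ 12"
    using Maclaurin_exp_le[of x 12] by blast
  show "(\<Sum>m<12. x ^ m / fact m) \<le> exp x" using t(2) assms by simp
  have "exp t \<le> exp 1" using t(1) assms by simp
  then have "exp t \<le> 3" using exp_le by linarith
  then have "exp t / fact 12 \<le> 1 / 10 ^ 8" by (simp add: fact_numeral)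
  then have "exp t / fact 12 * x ^ 12 \<le> 1 / 10 ^ 8 * x ^ 12" by (rule mult_right_mono) (use assms in simp)
  then show "exp x \<le> (\<Sum>m<12. x ^ m / fact m) + x ^ 12 / 10 ^ 8" using t(2) by simp
qed

text \<open>A bracket of width 3 * 10^-8 for the root of z B''(z) = 1, narrow enough for five
  correct decimals of both constants.\<close>

definition y_lo :: real where "y_lo = 40384362 / 10 ^ 8"
definition y_hi :: real where "y_hi = 40384365 / 10 ^ 8"

lemma exp_y_lo: "1497569738690 / 10 ^ 12 \<le> exp y_lo" "exp y_lo \<le> 1497569738691 / 10 ^ 12"
proof -
  have "1497569738690 / 10 ^ 12 \<le> (\<Sum>m<12. y_lo ^ m / fact m)"
    "(\<Sum>m<12. y_lo ^ m / fact m) + y_lo ^ 12 / 10 ^ 8 \<le> 1497569738691 / 10 ^ 12"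
    by (simp_all add: y_lo_def lessThan_nat_numeral fact_numeral power_divide)
  then show "1497569738690 / 10 ^ 12 \<le> exp y_lo" "exp y_lo \<le> 1497569738691 / 10 ^ 12"
    using exp_taylor_bounds[of y_lo] by (simp_all add: y_lo_def)
qed

lemma exp_y_hi: "1497569783617 / 10 ^ 12 \<le> exp y_hi" "exp y_hi \<le> 1497569783618 / 10 ^ 12"
proof -
  have "1497569783617 / 10 ^ 12 \<le> (\<Sum>m<12. y_hi ^ m / fact m)"
    "(\<Sum>m<12. y_hi ^ m / fact m) + y_hi ^ 12 / 10 ^ 8 \<le> 1497569783618 / 10 ^ 12"
    by (simp_all add: y_hi_def lessThan_nat_numeral fact_numeral power_divide)
  then show "1497569783617 / 10 ^ 12 \<le> exp y_hi" "exp y_hi \<le> 1497569783618 / 10 ^ 12"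
    using exp_taylor_bounds[of y_hi] by (simp_all add: y_hi_def)
qed

lemma y_lo_below: "y_lo * Bpp y_lo < 1"
proof -
  have "(y_lo ^ 2 + 4 * y_lo + 2) * exp y_lo \<le> (y_lo ^ 2 + 4 * y_lo + 2) * (1497569738691 / 10 ^ 12)"
    by (rule mult_left_mono[OF exp_y_lo(2)]) (simp add: y_lo_def)
  then have "Bpp y_lo \<le> (y_lo ^ 2 + 4 * y_lo + 2) * (1497569738691 / 10 ^ 12) - y_lo ^ 2 - 5 * y_lo - 1"
    unfolding Bpp_def by linarith
  then have "y_lo * Bpp y_lo \<le> y_lo * ((y_lo ^ 2 + 4 * y_lo + 2) * (1497569738691 / 10 ^ 12) - y_lo ^ 2 - 5 * y_lo - 1)"
    by (rule mult_left_mono) (simp add: y_lo_def)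
  also have "\<dots> < 1" by (simp add: y_lo_def power_divide)
  finally show ?thesis .
qed

lemma y_hi_above: "1 < y_hi * Bpp y_hi"
proof -
  have "1 < y_hi * ((y_hi ^ 2 + 4 * y_hi + 2) * (1497569783617 / 10 ^ 12) - y_hi ^ 2 - 5 * y_hi - 1)"
    by (simp add: y_hi_def power_divide)
  also have "\<dots> \<le> y_hi * Bpp y_hi"
  proof (rule mult_left_mono)
    have "(y_hi ^ 2 + 4 * y_hi + 2) * (1497569783617 / 10 ^ 12) \<le> (y_hi ^ 2 + 4 * y_hi + 2) * exp y_hi"
      by (rule mult_left_mono[OF exp_y_hi(1)]) (simp add: y_hi_def)
    then show "(y_hi ^ 2 + 4 * y_hi + 2) * (1497569783617 / 10 ^ 12) - y_hi ^ 2 - 5 * y_hi - 1 \<le> Bpp y_hi"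
      unfolding Bpp_def by linarith
  qed (simp add: y_hi_def)
  finally show ?thesis .
qed

lemma tau_exists: "\<exists>\<tau>. 0 < \<tau> \<and> \<tau> * Bpp \<tau> = 1"
proof -
  have "\<exists>x\<ge>y_lo. x \<le> y_hi \<and> x * Bpp x = 1"
  proof (rule IVT')
    show "continuous_on {y_lo..y_hi} (\<lambda>x. x * Bpp x)"
      by (intro continuous_intros continuous_at_imp_continuous_on ballI DERIV_continuous[OF Bpp_deriv])
  qed (use y_lo_below y_hi_above in \<open>auto simp: y_lo_def y_hi_def\<close>)
  moreover have "0 < y_lo" by (simp add: y_lo_def)
  ultimately show ?thesis by (meson less_le_trans)
qed

lemma tau_unique:
  assumes "0 < u" "u * Bpp u = 1" "0 < v" "v * Bpp v = 1"
  shows "u = v"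
  using w_Bpp_strict_mono[of u v] w_Bpp_strict_mono[of v u] assms by (cases u v rule: linorder_cases) auto

lemma tau_bounds:
  assumes "0 < y" "y * Bpp y = 1"
  shows "y_lo \<le> y" "y \<le> y_hi"
  using w_Bpp_strict_mono[of y y_lo] w_Bpp_strict_mono[of y_hi y] y_lo_below y_hi_above assms
  by (auto simp: not_le[symmetric] y_hi_def intro: ccontr)

text \<open>Both terms increase with \<open>y\<close>, so their difference is estimated from
  opposite ends of the bracket. The tolerance is half a unit in the fifth decimal.\<close>

lemma kappa_numeric:
  assumes "0 < y" "y * Bpp y = 1"
  shows "\<bar>(2 * y ^ 2 + 4 * y + 3) * y * exp y - (3 * y ^ 2 + 12 * y + 4) * y / 2 - 1.10355\<bar> < 5 / 10 ^ 6"
proof -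
  note b = tau_bounds[OF assms]
  have lo0: "0 \<le> y_lo" "0 \<le> y" "0 \<le> y_hi" using assms by (simp_all add: y_lo_def y_hi_def)
  have "exp y_lo \<le> exp y" "exp y \<le> exp y_hi" using b by simp_all
  then have e: "1497569738690 / 10 ^ 12 \<le> exp y" "exp y \<le> 1497569783618 / 10 ^ 12"
    using exp_y_lo(1) exp_y_hi(2) by linarith+
  have p: "y_lo ^ 2 \<le> y ^ 2" "y ^ 2 \<le> y_hi ^ 2" using b lo0 by (auto intro: power_mono)
  have "(2 * y ^ 2 + 4 * y + 3) * y * exp y \<le> (2 * y_hi ^ 2 + 4 * y_hi + 3) * y_hi * (1497569783618 / 10 ^ 12)"
    by (intro mult_mono add_mono) (use b lo0 p e in auto)
  moreover have "(2 * y_lo ^ 2 + 4 * y_lo + 3) * y_lo * (1497569738690 / 10 ^ 12) \<le> (2 * y ^ 2 + 4 * y + 3) * y * exp y"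
    by (intro mult_mono add_mono) (use b lo0 p e in auto)
  moreover have "(3 * y ^ 2 + 12 * y + 4) * y / 2 \<le> (3 * y_hi ^ 2 + 12 * y_hi + 4) * y_hi / 2"
    by (intro divide_right_mono mult_mono add_mono) (use b lo0 p in auto)
  moreover have "(3 * y_lo ^ 2 + 12 * y_lo + 4) * y_lo / 2 \<le> (3 * y ^ 2 + 12 * y + 4) * y / 2"
    by (intro divide_right_mono mult_mono add_mono) (use b lo0 p in auto)
  moreover have "(2 * y_hi ^ 2 + 4 * y_hi + 3) * y_hi * (1497569783618 / 10 ^ 12) -
      (3 * y_lo ^ 2 + 12 * y_lo + 4) * y_lo / 2 < 1.10355 + 5 / 10 ^ 6"
    "(2 * y_lo ^ 2 + 4 * y_lo + 3) * y_lo * (1497569738690 / 10 ^ 12) -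
      (3 * y_hi ^ 2 + 12 * y_hi + 4) * y_hi / 2 > 1.10355 - 5 / 10 ^ 6"
    by (simp_all add: y_lo_def y_hi_def power_divide)
  ultimately show ?thesis unfolding abs_less_iff by linarith
qed

lemma sigma_numeric:
  assumes "0 < y" "y * Bpp y = 1"
  shows "\<bar>1 + Bppp y * y ^ 2 - 2.14989\<bar> < 5 / 10 ^ 6"
proof -
  note b = tau_bounds[OF assms]
  have lo0: "0 \<le> y_lo" "0 \<le> y" "0 \<le> y_hi" using assms by (simp_all add: y_lo_def y_hi_def)
  have "exp y_lo \<le> exp y" "exp y \<le> exp y_hi" using b by simp_all
  then have e: "1497569738690 / 10 ^ 12 \<le> exp y" "exp y \<le> 1497569783618 / 10 ^ 12"
    using exp_y_lo(1) exp_y_hi(2) by linarith+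
  have p: "y_lo ^ 2 \<le> y ^ 2" "y ^ 2 \<le> y_hi ^ 2" using b lo0 by (auto intro: power_mono)
  have "(y ^ 2 + 6 * y + 6) * exp y \<le> (y_hi ^ 2 + 6 * y_hi + 6) * (1497569783618 / 10 ^ 12)"
    by (intro mult_mono add_mono) (use b lo0 p e in auto)
  moreover have "(y_lo ^ 2 + 6 * y_lo + 6) * (1497569738690 / 10 ^ 12) \<le> (y ^ 2 + 6 * y + 6) * exp y"
    by (intro mult_mono add_mono) (use b lo0 p e in auto)
  ultimately have "Bppp y \<le> (y_hi ^ 2 + 6 * y_hi + 6) * (1497569783618 / 10 ^ 12) - 2 * y_lo - 5" (is "_ \<le> ?U")
    "(y_lo ^ 2 + 6 * y_lo + 6) * (1497569738690 / 10 ^ 12) - 2 * y_hi - 5 \<le> Bppp y" (is "?L \<le> _")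
    using b unfolding Bppp_def by linarith+
  note bb = this
  have L: "0 \<le> ?L" by (simp add: y_lo_def y_hi_def power_divide)
  have "Bppp y * y ^ 2 \<le> ?U * y_hi ^ 2" using bb L p by (intro mult_mono) auto
  also have "\<dots> < 1.14989 + 5 / 10 ^ 6" by (simp add: y_lo_def y_hi_def power_divide)
  finally have u: "Bppp y * y ^ 2 < 1.14989 + 5 / 10 ^ 6" .
  have "1.14989 - 5 / 10 ^ 6 < ?L * y_lo ^ 2" by (simp add: y_lo_def y_hi_def power_divide)
  also have "\<dots> \<le> Bppp y * y ^ 2" using bb L p by (intro mult_mono) auto
  finally have "1.14989 - 5 / 10 ^ 6 < Bppp y * y ^ 2" .
  then show ?thesis unfolding abs_less_iff using u by (intro conjI; simp)
qed

section \<open>Generating functions of the two graph classes\<close>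

abbreviation blocks_C5 :: "nat pair_pre_digraph set" where
  "blocks_C5 \<equiv> blocks (Forb (cycle_graph 5))"

definition conn_egf :: "real fps" where "conn_egf = egf (Forb (cycle_graph 5))"
definition block_egf :: "real fps" where "block_egf = egf blocks_C5"

lemma conn_egf_nth: "fps_nth conn_egf n = real (conn_num n) / fact n"
proof -
  have "{G \<in> Forb (cycle_graph 5). pverts G = {1..n}} = {G. pverts G = {1..n} \<and> parcs G \<in> conn_graphs {1..n}}"
    by (auto simp: Forb_iff)
  then show ?thesis by (simp add: conn_egf_def egf_def conn_num_def card_graphs_on)
qed

lemma block_egf_nth: "fps_nth block_egf n = real (block_num n) / fact n"
proof -
  have "{G \<in> blocks_C5. pverts G = {1..n}} = {G. pverts G = {1..n} \<and> parcs G \<in> block_graphs {1..n}}"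
    by (auto simp: blocks_iff)
  then show ?thesis by (simp add: block_egf_def egf_def block_num_def card_graphs_on)
qed

lemma conn_num_0: "conn_num 0 = 0"
  by (simp add: conn_num_def conn_graphs_def conn_def)

lemma block_num_1: "block_num 1 = 0"
  by (simp add: block_num_def block_graphs_def)

lemma deriv_conn_egf: "fps_deriv conn_egf = conn_fps"
  by (rule fps_ext) (simp add: conn_egf_nth conn_fps_def del: of_nat_Suc)

lemma pointed_conn_egf: "pointed conn_egf = rooted_fps"
  by (simp add: pointed_def rooted_fps_def deriv_conn_egf)

lemma deriv_deriv_block_egf: "fps_deriv (fps_deriv block_egf) = block_fps"
  by (rule fps_ext) (simp add: block_egf_nth block_fps_def del: of_nat_Suc)

lemma deriv_block_egf:
  "fps_deriv block_egf = (fps_X ^ 2 + 2 * fps_X) * fps_exp 1 - fps_const (5 / 2) * fps_X ^ 2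
    - fps_const (1 / 3) * fps_X ^ 3 - fps_X" (is "_ = ?Q")
proof -
  have "fps_deriv ?Q = block_fps"
  proof -
    have "fps_const (5 / 2 :: real) * (2 * fps_X) = 5 * fps_X" "fps_const (1 / 3 :: real) * (3 * fps_X ^ 2) = fps_X ^ 2"
      by (simp_all add: numeral_fps_const mult.assoc[symmetric])
    then have "fps_deriv ?Q = (2 * fps_X + 2) * fps_exp 1 + (fps_X ^ 2 + 2 * fps_X) * fps_exp 1 - 5 * fps_X - fps_X ^ 2 - 1"
      by (simp add: fps_deriv_power power2_eq_square mult_ac)
    then show ?thesis unfolding block_fps_eq by (simp add: algebra_simps)
  qed
  then have "fps_deriv (fps_deriv block_egf) = fps_deriv ?Q" by (simp add: deriv_deriv_block_egf)
  \<comment> \<open>The derivatives agree; the constant terms are both 0 because no block has a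
    single vertex.\<close>
  moreover have "fps_nth (fps_deriv block_egf) 0 = fps_nth ?Q 0"
    using block_num_1 by (simp add: block_egf_nth power2_eq_square power3_eq_cube)
  ultimately show ?thesis using fps_deriv_eq_iff[of "fps_deriv block_egf" ?Q] by simp
qed

lemma deriv_block_egf_sums: "(\<lambda>n. fps_nth (fps_deriv block_egf) n * z ^ n) sums Bp z"
proof -
  have r: "fps_conv_radius (fps_deriv block_egf) = \<infinity>"
    unfolding deriv_block_egf by (simp add: conv_radius_infty)
  have "eval_fps (fps_deriv block_egf) z = Bp z"
    unfolding deriv_block_egf Bp_def
    by (simp add: eval_fps_diff eval_fps_add eval_fps_mult conv_radius_infty)
       (simp add: field_simps power2_eq_square power3_eq_cube)
  then show ?thesis using sums_eval_fps[of z "fps_deriv block_egf"] r by simp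
qed

lemma block_fps_deriv_eval: "eval_fps (fps_deriv block_fps) z = Bppp z"
proof -
  have "(eval_fps block_fps has_real_derivative eval_fps (fps_deriv block_fps) z) (at z)"
    by (rule has_field_derivative_eval_fps) simp
  then have "(Bpp has_real_derivative eval_fps (fps_deriv block_fps) z) (at z)"
    by (simp add: fun_eq_iff[THEN iffD2, rule_format, OF block_fps_eval] cong: )
  then show ?thesis using Bpp_deriv DERIV_unique by blast
qed

text \<open>Differentiation and multiplication by the variable do not shrink the disc of
  convergence. Conversely, the coefficients of C are dominated by those of z C', which are
  \<open>n\<close> times as large, the constant term being 0.\<close>

lemma conn_egf_radius:
  assumes "0 < \<tau>" "\<tau> * Bpp \<tau> = 1"
  shows "fps_conv_radius conn_egf = ereal (inv_rooted \<tau>)"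
proof (rule antisym)
  have "fps_conv_radius conn_egf \<le> fps_conv_radius conn_fps"
    using fps_conv_radius_deriv[of conn_egf] by (simp add: deriv_conn_egf)
  also have "\<dots> \<le> fps_conv_radius rooted_fps"
    using fps_conv_radius_mult[of fps_X conn_fps] by (simp add: rooted_fps_def)
  finally show "fps_conv_radius conn_egf \<le> ereal (inv_rooted \<tau>)"
    by (simp add: rooted_radius[OF assms])
  have r: "0 < inv_rooted \<tau>" by (rule rho_pos[OF assms])
  have "summable (\<lambda>n. fps_nth conn_egf n * inv_rooted \<tau> ^ n)"
  proof (rule summable_comparison_test'[OF rooted_summable[OF assms], of 0])
    fix n
    have "0 \<le> fps_nth conn_egf n" by (simp add: conn_egf_nth)
    moreover have "fps_nth rooted_fps n = real n * fps_nth conn_egf n"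
      unfolding pointed_conn_egf[symmetric] pointed_def by (cases n) auto
    moreover have "fps_nth conn_egf 0 = 0" by (simp add: conn_egf_nth conn_num_0)
    ultimately have "fps_nth conn_egf n \<le> fps_nth rooted_fps n" "0 \<le> fps_nth conn_egf n"
      by (cases n; simp add: mult_right_mono[of 1 "real n" "fps_nth conn_egf n", simplified] distrib_right)+
    then show "norm (fps_nth conn_egf n * inv_rooted \<tau> ^ n) \<le> fps_nth rooted_fps n * inv_rooted \<tau> ^ n"
      using r by (simp add: abs_mult mult_right_mono)
  qed
  then show "ereal (inv_rooted \<tau>) \<le> fps_conv_radius conn_egf"
    using conv_radius_geI[of "fps_nth conn_egf" "inv_rooted \<tau>"] r by (simp add: fps_conv_radius_def)
qed

text \<open>Grouped by size, the objects form finite sets of constant weight, so the integral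
  becomes a real series. Nonnegativity allows the summation to be done first for the extended
  integral, which then yields integrability.\<close>

lemma has_bochner_integral_point_measure_UNION:
  fixes D :: "nat \<Rightarrow> 'a set" and f :: "'a \<Rightarrow> real" and w :: "nat \<Rightarrow> real"
  assumes fin: "\<And>m. finite (D m)" and disj: "disjoint_family D"
    and p: "\<And>m X. X \<in> D m \<Longrightarrow> p X = ennreal (w m)" and w: "\<And>m. 0 \<le> w m"
    and f: "\<And>X. 0 \<le> f X" and s: "(\<lambda>m. w m * (\<Sum>X\<in>D m. f X)) sums L"
  shows "has_bochner_integral (point_measure (\<Union>m. D m) p) f L"
    and "(\<integral>\<^sup>+X. f X \<partial>point_measure (\<Union>m. D m) p) = ennreal L"
proof -
  let ?A = "\<Union>m. D m"
  have "(\<integral>\<^sup>+X. f X \<partial>point_measure ?A p) = (\<integral>\<^sup>+X. p X * ennreal (f X) \<partial>count_space ?A)"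
    unfolding point_measure_def by (subst nn_integral_density) auto
  also have "\<dots> = (\<integral>\<^sup>+X\<in>?A. p X * ennreal (f X) \<partial>count_space ?A)"
    by (rule nn_integral_cong) (simp add: indicator_def)
  also have "\<dots> = (\<Sum>m. \<integral>\<^sup>+X\<in>D m. p X * ennreal (f X) \<partial>count_space ?A)"
    by (rule nn_integral_disjoint_family[OF _ _ disj]) auto
  also have "\<dots> = (\<Sum>m. ennreal (w m * (\<Sum>X\<in>D m. f X)))"
  proof (rule suminf_cong)
    fix m
    have "(\<integral>\<^sup>+X\<in>D m. p X * ennreal (f X) \<partial>count_space ?A) =
      (\<Sum>X\<in>D m. p X * ennreal (f X) * indicator (D m) X)"
      by (rule nn_integral_count_space'[OF fin]) auto
    also have "\<dots> = (\<Sum>X\<in>D m. ennreal (w m * f X))"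
      by (rule sum.cong) (auto simp: p ennreal_mult w f)
    also have "\<dots> = ennreal (\<Sum>X\<in>D m. w m * f X)"
      by (rule sum_ennreal) (simp add: w f)
    finally show "(\<integral>\<^sup>+X\<in>D m. p X * ennreal (f X) \<partial>count_space ?A) = ennreal (w m * (\<Sum>X\<in>D m. f X))"
      by (simp add: sum_distrib_left)
  qed
  also have "\<dots> = ennreal L"
    by (rule suminf_ennreal_eq[OF _ s]) (simp add: w f sum_nonneg)
  finally show nn: "(\<integral>\<^sup>+X. f X \<partial>point_measure ?A p) = ennreal L" .
  have "0 \<le> L" using sums_le[OF _ sums_zero s] w f by (simp add: sum_nonneg)
  then show "has_bochner_integral (point_measure ?A p) f L"
    by (intro has_bochner_integral_nn_integral nn) (auto simp: f)
qed

section \<open>Boltzmann objects and their distances\<close>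

abbreviation "objs \<equiv> derived_pointed_objects blocks_C5"

lemma bij_betw_objs:
  "bij_betw (\<lambda>(E, r). (\<lparr> pverts = {0..m}, parcs = E \<rparr>, r)) (block_graphs {0..m} \<times> {1..m}) (objs {1..m})"
proof -
  have z: "insert 0 {1..m} = {0..m}" by auto
  have o: "objs {1..m} = {(G, r). parcs G \<in> block_graphs {0..m} \<and> pverts G = {0..m} \<and> r \<in> {1..m}}"
    unfolding derived_pointed_objects_def z blocks_iff by auto
  show ?thesis unfolding o
    by (rule bij_betwI[where g = "\<lambda>(G, r). (parcs G, r)"]) auto
qed

lemma sum_objs:
  "(\<Sum>X\<in>objs {1..m}. f X) = (\<Sum>E\<in>block_graphs {0..m}. \<Sum>r\<in>{1..m}. f (\<lparr> pverts = {0..m}, parcs = E \<rparr>, r))"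
  using sum.reindex_bij_betw[OF bij_betw_objs[of m], of f] by (simp add: sum.cartesian_product split_def)

lemma finite_objs: "finite (objs {1..m})"
  using bij_betw_finite[OF bij_betw_objs[of m]] finite_block_graphs[of "{0..m}"] by simp

lemma obj_size_objs: "X \<in> objs {1..m} \<Longrightarrow> obj_size X = m"
  by (auto simp: derived_pointed_objects_def obj_size_def)

lemma disjoint_objs: "disjoint_family (\<lambda>m. objs {1..m})"
  unfolding disjoint_family_on_def using obj_size_objs by (metis disjoint_iff)

lemma card_block_graphs_0: "card (block_graphs {0..m}) = block_num (m + 1)"
  by (subst card_block_graphs) auto

text \<open>Distances in a block are 1 or 2, so the degree of the vertex 0 determines their sum.\<close>

lemma sum_sp_objs: "(\<Sum>X\<in>objs {1..m}. sp X) = 2 * real m * real (block_num (m + 1)) - real (degree_sum m)"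
proof -
  have "(\<Sum>r\<in>{1..m}. sp (\<lparr> pverts = {0..m}, parcs = E \<rparr>, r)) = 2 * real m - real (card {v. (0, v) \<in> E})"
    if E: "E \<in> block_graphs {0..m}" for E
  proof -
    have g: "E \<in> edge_graphs {0..m}" using E by (simp add: block_graphs_def conn_graphs_def)
    have d: "{v. (0, v) \<in> E} \<subseteq> {1..m}" using g in_S[OF E] by fastforce
    have "(\<Sum>r\<in>{1..m}. sp (\<lparr> pverts = {0..m}, parcs = E \<rparr>, r)) =
      (\<Sum>r\<in>{1..m}. 2 - (if r \<in> {v. (0, v) \<in> E} then 1 else 0))"
    proof (rule sum.cong[OF refl])
      fix r assume r: "r \<in> {1..m}"
      show "sp (\<lparr> pverts = {0..m}, parcs = E \<rparr>, r) = 2 - (if r \<in> {v. (0, v) \<in> E} then 1 else 0)"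
        by (subst sp_eq) (use g r block_common_neighbour[OF E, of 0 r] in auto)
    qed
    also have "\<dots> = 2 * real m - real (card ({1..m} \<inter> {v. (0, v) \<in> E}))"
      by (simp add: sum_subtractf sum.If_cases)
    also have "{1..m} \<inter> {v. (0, v) \<in> E} = {v. (0, v) \<in> E}" using d by blast
    finally show ?thesis .
  qed
  then have "(\<Sum>X\<in>objs {1..m}. sp X) = (\<Sum>E\<in>block_graphs {0..m}. 2 * real m - real (card {v. (0, v) \<in> E}))"
    unfolding sum_objs by (rule sum.cong[OF refl])
  then show ?thesis by (simp add: sum_subtractf degree_sum_def card_block_graphs_0 mult_ac)
qed

text \<open>For \<open>m \<ge> 4\<close> the distance sum is 2m(m + 1)m - (4m^2 - 3m), which in
  falling factorials is 2m(m - 1)(m - 2) + 4m(m - 1) + 3m; this gives the exponential part. The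
  polynomial corrects the coefficients for \<open>m\<close> = 1, 2, 3 from 3, 7, 15/2 to 1, 1,
  6.\<close>

definition sp_fps :: "real fps" where
  "sp_fps = (2 * fps_X ^ 3 + 4 * fps_X ^ 2 + 3 * fps_X) * fps_exp 1 -
    (fps_const (3 / 2) * fps_X ^ 3 + 6 * fps_X ^ 2 + 2 * fps_X)"

lemma sp_fps_nth: "fps_nth sp_fps m = (2 * real m * real (block_num (m + 1)) - real (degree_sum m)) / fact m"
proof -
  have e: "fps_nth ((2 * fps_X ^ 3 + 4 * fps_X ^ 2 + 3 * fps_X) * fps_exp (1::real)) m =
    2 * (if m < 3 then 0 else 1 / fact (m - 3)) + 4 * (if m < 2 then 0 else 1 / fact (m - 2)) +
    3 * (if m = 0 then 0 else 1 / fact (m - 1))"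
    by (simp add: distrib_right fps_X_power_mult_nth mult.assoc fps_mult_numeral_left)
  have q: "fps_nth (fps_const (3 / 2) * fps_X ^ 3 + 6 * fps_X ^ 2 + 2 * fps_X :: real fps) m =
    (if m = 3 then 3 / 2 else 0) + (if m = 2 then 6 else 0) + (if m = 1 then 2 else 0)"
    by (simp add: numeral_fps_const fps_X_power_nth)
  have r: "fps_nth sp_fps m = 2 * (if m < 3 then 0 else 1 / fact (m - 3)) + 4 * (if m < 2 then 0 else 1 / fact (m - 2)) +
    3 * (if m = 0 then 0 else 1 / fact (m - 1)) -
    ((if m = 3 then 3 / 2 else 0) + (if m = 2 then 6 else 0) + (if m = 1 then 2 else 0))"
    unfolding sp_fps_def fps_sub_nth e q ..
  consider "m = 0" | "m = 1" | "m = 2" | "m = 3" | "4 \<le> m" by linarith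
  then show ?thesis
  proof cases
    case 1
    have "block_graphs {0..0::nat} = {}" by (auto simp: block_graphs_def)
    then show ?thesis using 1 unfolding r by (simp add: degree_sum_def)
  next
    case 2
    have e: "m + 1 = 2" using 2 by simp
    show ?thesis unfolding r e block_num_2 using 2 degree_sum_1 by simp
  next
    case 3
    have e: "m + 1 = 3" using 3 by simp
    show ?thesis unfolding r e block_num_3 using 3 degree_sum_2 by simp
  next
    case 4
    have e: "m + 1 = 4" using 4 by simp
    show ?thesis unfolding r e block_num_4 using 4 degree_sum_3 by (simp add: fact_numeral)
  next
    case 5
    then obtain k where k: "m = k + 4" by (metis add.commute le_Suc_ex)
    have b: "real (block_num (m + 1)) = (real k + 5) * (real k + 4)"
      using block_num_large[of "m + 1"] 5 by (simp add: k algebra_simps)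
    define F :: real where "F = fact (k + 1)"
    have F: "F \<noteq> 0" "real k + 4 \<noteq> 0" "real k + 3 \<noteq> 0" "real k + 2 \<noteq> 0" by (auto simp: F_def)
    have f: "fact m = (real k + 4) * (real k + 3) * (real k + 2) * F" "fact (m - 1) = (real k + 3) * (real k + 2) * F"
      "fact (m - 2) = (real k + 2) * F" "fact (m - 3) = F"
      by (simp_all add: k F_def eval_nat_numeral algebra_simps)
    have "2 / F + 4 / ((real k + 2) * F) + 3 / ((real k + 3) * (real k + 2) * F) =
      (2 * (real k + 4) * ((real k + 5) * (real k + 4)) - (4 * (real k + 4) ^ 2 - 3 * (real k + 4))) /
      ((real k + 4) * (real k + 3) * (real k + 2) * F)"
      using F by (simp add: divide_simps) (simp add: algebra_simps power2_eq_square)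
    moreover have "real (degree_sum m) = 4 * (real k + 4) ^ 2 - 3 * (real k + 4)"
      using degree_sum_large[OF 5] by (simp add: k)
    ultimately show ?thesis using 5 unfolding r b f by (simp add: k)
  qed
qed

lemma sp_fps_sums: "(\<lambda>m. fps_nth sp_fps m * y ^ m) sums
    ((2 * y ^ 2 + 4 * y + 3) * y * exp y - (3 * y ^ 2 + 12 * y + 4) * y / 2)"
proof -
  have r: "fps_conv_radius sp_fps = \<infinity>"
    unfolding sp_fps_def by (simp add: conv_radius_infty)
  have "eval_fps sp_fps y = (2 * y ^ 2 + 4 * y + 3) * y * exp y - (3 * y ^ 2 + 12 * y + 4) * y / 2"
    unfolding sp_fps_def
    by (simp add: eval_fps_diff eval_fps_add eval_fps_mult conv_radius_infty)
       (simp add: field_simps power2_eq_square power3_eq_cube)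
  then show ?thesis using sums_eval_fps[of y sp_fps] r by simp
qed

lemma pointed_block_nth:
  "fps_nth (pointed (fps_deriv block_egf)) m = real m * real (block_num (m + 1)) / fact m"
  unfolding pointed_def deriv_deriv_block_egf
  by (cases m) (auto simp: block_fps_def simp del: of_nat_Suc)

lemma pointed_block_radius: "fps_conv_radius (pointed (fps_deriv block_egf)) = \<infinity>"
  unfolding pointed_def deriv_deriv_block_egf by (simp add: conv_radius_infty)

lemma pointed_block_eval: "eval_fps (pointed (fps_deriv block_egf)) y = y * Bpp y"
  unfolding pointed_def deriv_deriv_block_egf by (simp add: eval_fps_mult)

context
  fixes y :: real
  assumes y: "0 < y" "y * Bpp y = 1"
begin

text \<open>The normalising constant y B''(y) equals 1 at this parameter, so an object of size
  \<open>m\<close> has weight \<open>y ^ m / fact m\<close>.\<close>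

lemma boltzmann_integral:
  assumes f: "\<And>X. 0 \<le> f X" and s: "(\<lambda>m. y ^ m / fact m * (\<Sum>X\<in>objs {1..m}. f X)) sums L"
  shows "has_bochner_integral (boltzmann blocks_C5 y) f L"
    and "(\<integral>\<^sup>+X. f X \<partial>boltzmann blocks_C5 y) = ennreal L"
proof -
  have p: "ennreal (y ^ obj_size X / (fact (obj_size X) *
      eval_fps (pointed (fps_deriv (egf blocks_C5))) y)) = ennreal (y ^ m / fact m)"
    if "X \<in> objs {1..m}" for m X
    using obj_size_objs[OF that] pointed_block_eval[of y] y by (simp add: block_egf_def)
  show "has_bochner_integral (boltzmann blocks_C5 y) f L"
    "(\<integral>\<^sup>+X. f X \<partial>boltzmann blocks_C5 y) = ennreal L"
    unfolding boltzmann_def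
    by (rule has_bochner_integral_point_measure_UNION[OF finite_objs disjoint_objs p _ f s]; use y in simp)+
qed

lemma boltzmann_prob_space: "prob_space (boltzmann blocks_C5 y)"
proof (rule prob_spaceI)
  have c: "(\<Sum>X\<in>objs {1..m}. 1) = real m * real (block_num (m + 1))" for m
    unfolding sum_objs by (simp add: card_block_graphs_0)
  have "(\<lambda>m. y ^ m / fact m * (\<Sum>X\<in>objs {1..m}. 1)) sums (y * Bpp y)"
    using sums_eval_fps[of y "pointed (fps_deriv block_egf)"]
    unfolding c pointed_block_eval pointed_block_nth pointed_block_radius by (simp add: mult_ac)
  from boltzmann_integral(2)[OF _ this] show "emeasure (boltzmann blocks_C5 y)
      (space (boltzmann blocks_C5 y)) = 1"
    using y by simp
qed

text \<open>With P(z) = z B''(z), the expected size is y P'(y) / P(y). Since P(y) = 1, this is y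
  B''(y) + y^2 B'''(y) = 1 + y^2 B'''(y).\<close>

lemma boltzmann_size:
  "has_bochner_integral (boltzmann blocks_C5 y) (\<lambda>X. real (obj_size X)) (1 + Bppp y * y ^ 2)"
proof (rule boltzmann_integral(1))
  let ?P = "pointed (fps_deriv block_egf)"
  have r: "fps_conv_radius ?P = \<infinity>" by (rule pointed_block_radius)
  have "fps_conv_radius (fps_deriv ?P) = \<infinity>" using fps_conv_radius_deriv[of ?P] r by simp
  then have rr: "fps_conv_radius (fps_X * fps_deriv ?P) = \<infinity>" by (simp add: conv_radius_infty)
  have "eval_fps (fps_X * fps_deriv ?P) y = y * eval_fps (fps_deriv ?P) y"
    using \<open>fps_conv_radius (fps_deriv ?P) = \<infinity>\<close> by (simp add: eval_fps_mult)
  also have "eval_fps (fps_deriv ?P) y = Bpp y + y * Bppp y"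
  proof -
    have d: "fps_conv_radius (fps_deriv block_fps) = \<infinity>" using fps_conv_radius_deriv[of block_fps] by simp
    have "fps_deriv ?P = block_fps + fps_X * fps_deriv block_fps"
      unfolding pointed_def deriv_deriv_block_egf by (simp add: add.commute)
    then show ?thesis using d
      by (simp add: eval_fps_add eval_fps_mult conv_radius_infty block_fps_deriv_eval)
  qed
  also have "y * (Bpp y + y * Bppp y) = 1 + Bppp y * y ^ 2"
    using y(2) by (simp add: distrib_left power2_eq_square mult_ac)
  finally have ev: "eval_fps (fps_X * fps_deriv ?P) y = 1 + Bppp y * y ^ 2" .
  have nth: "fps_nth (fps_X * fps_deriv ?P) m * y ^ m = y ^ m / fact m * (\<Sum>X\<in>objs {1..m}. real (obj_size X))" for m
  proof -
    have "(\<Sum>X\<in>objs {1..m}. real (obj_size X)) = (\<Sum>X\<in>objs {1..m}. real m)"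
      by (rule sum.cong) (auto simp: obj_size_objs)
    also have "\<dots> = real m * (real m * real (block_num (m + 1)))"
      unfolding sum_objs by (simp add: card_block_graphs_0)
    finally have "(\<Sum>X\<in>objs {1..m}. real (obj_size X)) = real m * (real m * real (block_num (m + 1)))" .
    moreover have "fps_nth (fps_X * fps_deriv ?P) m = real m * fps_nth ?P m" by (cases m) auto
    ultimately show ?thesis by (simp add: pointed_block_nth)
  qed
  show "(\<lambda>m. y ^ m / fact m * (\<Sum>X\<in>objs {1..m}. real (obj_size X))) sums (1 + Bppp y * y ^ 2)"
    using sums_eval_fps[of y "fps_X * fps_deriv ?P"] unfolding rr ev nth by simp
qed simp

lemma boltzmann_sp:
  "has_bochner_integral (boltzmann blocks_C5 y) sp
    ((2 * y ^ 2 + 4 * y + 3) * y * exp y - (3 * y ^ 2 + 12 * y + 4) * y / 2)"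
proof -
  have pos: "0 \<le> sp X" if X: "X \<in> objs {1..m}" for X m
  proof -
    obtain G r where Gr: "X = (G, r)" by (cases X)
    have G: "parcs G \<in> block_graphs (pverts G)" "finite (pverts G)" "0 \<in> pverts G" "r \<in> pverts G" "r \<noteq> 0"
      using X by (auto simp: Gr derived_pointed_objects_def blocks_iff)
    then have "parcs G \<in> edge_graphs (pverts G)" by (simp add: block_graphs_def conn_graphs_def)
    then show ?thesis using sp_eq[of G r] block_common_neighbour[of "parcs G" "pverts G" 0 r] G by (simp add: Gr)
  qed
  \<comment> \<open>off the support, the junk values of \<open>sp\<close> may be negative\<close>
  have "has_bochner_integral (boltzmann blocks_C5 y) (\<lambda>X. max 0 (sp X))
    ((2 * y ^ 2 + 4 * y + 3) * y * exp y - (3 * y ^ 2 + 12 * y + 4) * y / 2)"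
  proof (rule boltzmann_integral(1))
    have "(\<Sum>X\<in>objs {1..m}. max 0 (sp X)) = (\<Sum>X\<in>objs {1..m}. sp X)" for m
      by (rule sum.cong) (use pos in auto)
    then have "y ^ m / fact m * (\<Sum>X\<in>objs {1..m}. max 0 (sp X)) = fps_nth sp_fps m * y ^ m" for m
      unfolding sum_sp_objs sp_fps_nth by simp
    then show "(\<lambda>m. y ^ m / fact m * (\<Sum>X\<in>objs {1..m}. max 0 (sp X))) sums
      ((2 * y ^ 2 + 4 * y + 3) * y * exp y - (3 * y ^ 2 + 12 * y + 4) * y / 2)"
      using sp_fps_sums[of y] by simp
  qed simp
  moreover have "max 0 (sp X) = sp X" if X: "X \<in> space (boltzmann blocks_C5 y)" for X
  proof -
    obtain m where "X \<in> objs {1..m}" using X by (auto simp: boltzmann_def space_point_measure)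
    then show ?thesis using pos by simp
  qed
  ultimately show ?thesis by (subst (asm) has_bochner_integral_cong[OF refl _ refl]) auto
qed

end

theorem proposition8p3:
  fixes \<C> \<B> :: "nat pair_pre_digraph set"
    and C B :: "real fps"
    and \<rho> y \<kappa> \<sigma>_sq :: real
  assumes "\<C> = Forb (cycle_graph 5)"
    and "\<B> = blocks \<C>"
    and "C = egf \<C>"
    and "B = egf \<B>"
    and "\<rho> = real_of_ereal (fps_conv_radius C)"
    and "y = eval_fps (pointed C) \<rho>"
    and "\<kappa> = integral\<^sup>L (boltzmann \<B> y) sp"
    and "\<sigma>_sq = integral\<^sup>L (boltzmann \<B> y) (\<lambda>X. real (obj_size X))"
  shows "0 < \<rho> \<and> fps_conv_radius C = ereal \<rho>
    \<and> summable (\<lambda>n. fps_nth (pointed C) n * \<rho> ^ n)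
    \<and> (\<forall>z. (\<lambda>n. fps_nth (fps_deriv B) n * z ^ n) sums
            (z * (z + 2) * exp z - z * (15 * z + 2 * z ^ 2 + 6) / 6))
    \<and> 0 < y
    \<and> (\<forall>z > 0. z * eval_fps (fps_deriv (fps_deriv B)) z = 1 \<longleftrightarrow> z = y)
    \<and> prob_space (boltzmann \<B> y)
    \<and> integrable (boltzmann \<B> y) sp
    \<and> \<kappa> = (2 * y ^ 2 + 4 * y + 3) * y * exp y - (3 * y ^ 2 + 12 * y + 4) * y / 2
    \<and> \<bar>\<kappa> - 1.10355\<bar> < 5 / 10 ^ 6
    \<and> integrable (boltzmann \<B> y) (\<lambda>X. real (obj_size X))
    \<and> \<sigma>_sq = 1 + eval_fps (fps_deriv (fps_deriv (fps_deriv B))) y * y ^ 2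
    \<and> \<bar>\<sigma>_sq - 2.14989\<bar> < 5 / 10 ^ 6"
proof -
  obtain \<tau> where tau: "0 < \<tau>" "\<tau> * Bpp \<tau> = 1" using tau_exists by blast
  have C: "C = conn_egf" and B: "B = block_egf" and blk: "\<B> = blocks_C5"
    using assms(1-4) by (simp_all add: conn_egf_def block_egf_def)
  have rad: "fps_conv_radius C = ereal (inv_rooted \<tau>)" unfolding C by (rule conn_egf_radius[OF tau])
  have rho: "\<rho> = inv_rooted \<tau>" using assms(5) rad by simp
  \<comment> \<open>From here on the solution of z B''(z) = 1 is known to be the value of z C' at
    the radius of convergence.\<close>
  have y: "y = \<tau>" using assms(6) rooted_eval[OF tau] by (simp add: C rho pointed_conn_egf)
  have tau': "0 < y" "y * Bpp y = 1" using tau y by simp_all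
  have k: "\<kappa> = (2 * y ^ 2 + 4 * y + 3) * y * exp y - (3 * y ^ 2 + 12 * y + 4) * y / 2"
    and ki: "integrable (boltzmann \<B> y) sp"
    using boltzmann_sp[OF tau'] assms(7) unfolding blk has_bochner_integral_iff by auto
  have s: "\<sigma>_sq = 1 + Bppp y * y ^ 2"
    and si: "integrable (boltzmann \<B> y) (\<lambda>X. real (obj_size X))"
    using boltzmann_size[OF tau'] assms(8) unfolding blk has_bochner_integral_iff by auto
  have "0 < \<rho>" unfolding rho by (rule rho_pos[OF tau])
  moreover have "fps_conv_radius C = ereal \<rho>" unfolding rho by (rule rad)
  moreover have "summable (\<lambda>n. fps_nth (pointed C) n * \<rho> ^ n)"
    unfolding C rho pointed_conn_egf by (rule rooted_summable[OF tau])
  moreover have "(\<lambda>n. fps_nth (fps_deriv B) n * z ^ n) sums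
            (z * (z + 2) * exp z - z * (15 * z + 2 * z ^ 2 + 6) / 6)" for z
    unfolding B Bp_def[symmetric] by (rule deriv_block_egf_sums)
  moreover have "z * eval_fps (fps_deriv (fps_deriv B)) z = 1 \<longleftrightarrow> z = y" if "z > 0" for z
    using tau_unique[OF that _ tau'] tau' by (auto simp: B deriv_deriv_block_egf)
  moreover have "prob_space (boltzmann \<B> y)" unfolding blk by (rule boltzmann_prob_space[OF tau'])
  moreover have "\<bar>\<kappa> - 1.10355\<bar> < 5 / 10 ^ 6" unfolding k by (rule kappa_numeric[OF tau'])
  moreover have "\<sigma>_sq = 1 + eval_fps (fps_deriv (fps_deriv (fps_deriv B))) y * y ^ 2"
    unfolding s B deriv_deriv_block_egf block_fps_deriv_eval ..
  moreover have "\<bar>\<sigma>_sq - 2.14989\<bar> < 5 / 10 ^ 6" unfolding s by (rule sigma_numeric[OF tau'])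
  ultimately show ?thesis using tau'(1) k ki si by blast
qed

end
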